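(* Let $a,b,n$ be positive integers. Then the Kazhdan–Lusztig polynomial of the $(a,b)$-Catalan matroid satisfies $$P_{C_n^{a,b}}(t)=\sum_{\lambda\vdash n}\frac1{z_\lambda}\,P_{U_\lambda^{a,b}}(t),$$ where the sum is over all partitions $\lambda=(\lambda_1,\dots,\lambda_k)$ of $n$ and $P_{U_\lambda^{a,b}}(t)=\prod_{j=1}^k P_{U_{\lambda_j}^{a,b}}(t)$.
   Context: For $m\ge1$, $U_m^{a,b}=U_{mb,m(a+b)}$ is the uniform matroid of rank $mb$ on $m(a+b)$ elements. For $S\subseteq[N]$, the Schubert matroid $\mathrm{SM}_N(S)$ is the matroid on $[N]$ whose bases are the $T\subseteq[N]$ with $|T|=|S|$ such that for every $i$ the $i$-th smallest element of $T$ is at most the $i$-th smallest element of $S$. The $(a,b)$-Catalan matroid $C_n^{a,b}$ is $\mathrm{SM}_{n(a+b)}(S)$ where $S$ has indicator vector $(0^a,1^b,\dots,0^a,1^b)$ ($n$ blocks of $a$ zeros followed by $b$ ones). For a partition $\lambda$ of $n$ in which $i$ appears $\alpha_i$ times, $z_\lambda=\prod_i i^{\alpha_i}\alpha_i!$. The Kazhdan–Lusztig polynomial $P_M(t)\in\mathbb Z[t]$ of a loopless matroid $M$ (Elias–Proudfoot–Wakefield) is the unique assignment such that: $P_M(t)=1$ if $\mathrm{rk}(M)=0$; $\deg P_M<\frac12\mathrm{rk}(M)$ if $\mathrm{rk}(M)>0$; and for every $M$, $t^{\mathrm{rk}(M)}P_M(t^{-1})=\sum_{F}\chi_{M|F}(t)\,P_{M/F}(t)$,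 the sum over all flats $F$ of $M$, where $M|F$ is the restriction to $F$, $M/F$ the contraction by $F$, and $\chi$ the characteristic polynomial. *)

theory Defs
  imports Complex_Main "HOL-Library.Multiset" "HOL-Computational_Algebra.Polynomial"
begin

section \<open>Finite matroids, presented by their bases\<close>

datatype 'a matroid = Matroid (ground: "'a set") (bases: "'a set set")

definition is_matroid :: "'a matroid \<Rightarrow> bool" where
  "is_matroid M \<longleftrightarrow>
     finite (ground M) \<and> bases M \<noteq> {} \<and> (\<forall>B\<in>bases M. B \<subseteq> ground M) \<and>
     (\<forall>A\<in>bases M. \<forall>B\<in>bases M. \<forall>x\<in>A - B. \<exists>y\<in>B - A. insert y (A - {x}) \<in> bases M)"

definition indep :: "'a matroid \<Rightarrow> 'a set \<Rightarrow> bool" where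
  "indep M I \<longleftrightarrow> (\<exists>B\<in>bases M. I \<subseteq> B)"

definition rk :: "'a matroid \<Rightarrow> 'a set \<Rightarrow> nat" where
  "rk M A = Max (card ` {I. I \<subseteq> A \<and> indep M I})"

abbreviation rank :: "'a matroid \<Rightarrow> nat" where
  "rank M \<equiv> rk M (ground M)"

definition loopless :: "'a matroid \<Rightarrow> bool" where
  "loopless M \<longleftrightarrow> (\<forall>e\<in>ground M. indep M {e})"

definition flats :: "'a matroid \<Rightarrow> 'a set set" where
  "flats M = {F. F \<subseteq> ground M \<and> (\<forall>e\<in>ground M - F. rk M F < rk M (insert e F))}"

definition restriction :: "'a matroid \<Rightarrow> 'a set \<Rightarrow> 'a matroid" where
  "restriction M F =
     Matroid F {I. I \<subseteq> F \<and> indep M I \<and> (\<forall>J. J \<subseteq> F \<and> indep M J \<and> I \<subseteq> J \<longrightarrow> J = I)}"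

definition contraction :: "'a matroid \<Rightarrow> 'a set \<Rightarrow> 'a matroid" where
  "contraction M F =
     Matroid (ground M - F)
       {B. B \<subseteq> ground M - F \<and> (\<exists>I\<in>bases (restriction M F). B \<union> I \<in> bases M)}"

definition char_poly :: "'a matroid \<Rightarrow> int poly" where
  "char_poly M = (\<Sum>A\<in>Pow (ground M). monom ((-1) ^ card A) (rank M - rk M A))"


section \<open>The Kazhdan--Lusztig polynomial of a loopless matroid\<close>

text \<open>For \<open>degree p \<le> d\<close>, this is the polynomial \<open>t ^ d * p (1 / t)\<close>.\<close>

definition reverse_poly :: "nat \<Rightarrow> 'a::comm_semiring_1 poly \<Rightarrow> 'a poly" where
  "reverse_poly d p = monom 1 (d - degree p) * reflect_poly p"

lemma poly_reverse_poly:
  fixes p :: "'a::field poly"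
  assumes "degree p \<le> d" "t \<noteq> 0"
  shows "poly (reverse_poly d p) t = t ^ d * poly p (inverse t)"
proof -
  have "t ^ d = t ^ (d - degree p) * t ^ degree p"
    using assms(1) by (simp flip: power_add)
  then show ?thesis
    using assms(2) by (simp add: reverse_poly_def poly_monom poly_reflect_poly_nz mult.assoc)
qed

definition KL_assignment :: "('a matroid \<Rightarrow> int poly) \<Rightarrow> bool" where
  "KL_assignment P \<longleftrightarrow>
     (\<forall>M. is_matroid M \<and> loopless M \<longrightarrow>
        (rank M = 0 \<longrightarrow> P M = 1) \<and>
        (rank M > 0 \<longrightarrow> 2 * degree (P M) < rank M) \<and>
        reverse_poly (rank M) (P M) =
          (\<Sum>F\<in>flats M. char_poly (restriction M F) * P (contraction M F)))"

text \<open>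
  A Kazhdan--Lusztig assignment is unique on loopless matroids but unconstrained elsewhere;
  therefore the description is applied to its value at \<open>M\<close> rather than to the whole function.
\<close>

definition KL_poly :: "'a matroid \<Rightarrow> int poly" where
  "KL_poly M = (THE p. \<exists>P. KL_assignment P \<and> P M = p)"


section \<open>Uniform, Schubert and Catalan matroids\<close>

definition uniform_matroid :: "nat \<Rightarrow> nat \<Rightarrow> nat matroid" where
  "uniform_matroid r N = Matroid {1..N} {T. T \<subseteq> {1..N} \<and> card T = r}"

definition U_matroid :: "nat \<Rightarrow> nat \<Rightarrow> nat \<Rightarrow> nat matroid" where
  "U_matroid a b m = uniform_matroid (m * b) (m * (a + b))"

definition schubert_matroid :: "nat \<Rightarrow> nat set \<Rightarrow> nat matroid" where
  "schubert_matroid N S =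
     Matroid {1..N}
       {T. T \<subseteq> {1..N} \<and> card T = card S \<and>
           (\<forall>i<card S. sorted_list_of_set T ! i \<le> sorted_list_of_set S ! i)}"

definition catalan_word :: "nat \<Rightarrow> nat \<Rightarrow> nat \<Rightarrow> nat list" where
  "catalan_word a b n = concat (replicate n (replicate a 0 @ replicate b 1))"

definition catalan_matroid :: "nat \<Rightarrow> nat \<Rightarrow> nat \<Rightarrow> nat matroid" where
  "catalan_matroid a b n =
     schubert_matroid (n * (a + b)) {i \<in> {1..n * (a + b)}. catalan_word a b n ! (i - 1) = 1}"


section \<open>Integer partitions\<close>

definition partitions :: "nat \<Rightarrow> nat multiset set" where
  "partitions n = {l. (\<forall>i\<in>#l. 0 < i) \<and> sum_mset l = n}"

lemma finite_partitions: "finite (partitions n)"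
proof (rule finite_subset)
  show "partitions n \<subseteq> mset ` {xs. set xs \<subseteq> {..n} \<and> length xs \<le> n}"
  proof
    fix l assume l: "l \<in> partitions n"
    obtain xs where xs: "mset xs = l" using ex_mset by blast
    have pos: "\<forall>i\<in>set xs. 0 < i" and sum: "sum_list xs = n"
      using l xs by (auto simp: partitions_def sum_mset_sum_list)
    have "length xs \<le> sum_list xs"
      using pos by (induction xs) (auto simp: Suc_le_eq)
    moreover have "set xs \<subseteq> {..n}"
      using sum member_le_sum_list by auto
    ultimately show "l \<in> mset ` {xs. set xs \<subseteq> {..n} \<and> length xs \<le> n}"
      using xs sum by auto
  qed
qed (simp add: finite_lists_length_le)

definition z_part :: "nat multiset \<Rightarrow> nat" where
  "z_part l = (\<Prod>i\<in>set_mset l. i ^ count l i * fact (count l i))"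

end

(* A matroid invariant is treated as a function of the rank function r along complete chains of subsets;
   it is valuative if it is a sum, over the complete chains, of functions of the values of r along the
   chain. The Kazhdan-Lusztig recursion makes sense for arbitrary set functions once the sum over flats
   is replaced by the sum over all subsets, because P is 0 in the presence of loops; in this form P is
   visibly valuative, multiplicative on direct sums and invariant under bijections.

   Divide the ground set into n blocks of size a + b. The rank in the Catalan matroid with block order
   x_1, ..., x_n is governed by the maximal prefix sum of the weights b - |X \<inter> block x_i|, so the question
   becomes one of fluctuation theory, as in Spitzer's identity. For a fixed chain and a fixed set T of rank jumps, the
   orders with jump set T decompose at the last jump: the blocks before the first maximum have weight 1
   and form one uniform matroid, and by the cycle lemma they occur in (k - 1)! orders. This shows that,
   summed over all block orders, n [C_n] and the sum over k of [U_k + C_(n-k)] agree along every chain. Hence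
   n P(C_n) = P(U_1) P(C_(n-1)) + ... + P(U_n) P(C_0), and the sum over partitions weighted by 1 / z_l
   is the solution of this recursion. *)
theory Submission
  imports Defs "HOL-Combinatorics.Multiset_Permutations"
begin

section \<open>Reversal and truncation of polynomials\<close>

text \<open>A chain may have different rank sequences for different block orders, so nothing can be
  compared order by order. Sorting the orders by the jump set T makes every function of the rank
  sequence constant on each class, and only two counts have to agree. The cycle lemma gives an
  asymmetric recursion for these counts: the first segment D contains the block of the last jump and
  carries the factor (k - 1)!. Multiplying by n = |D| + |A - D| and inducting on A - D yields the
  symmetric form, with k! and all nonempty D; this is the origin of the factor n in the recursion
  for P(C_n). Each k then occurs binomial(n, k) times with weight k! (n - k)!, so n! cancels.
  Solving the Kazhdan-Lusztig recursion is a separate matter. The low degrees are taken as a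
  definition; the high degrees follow because the remaining sum Q satisfies t^r Q(1/t) = -Q(t), a
  consequence of Moebius inversion on the Boolean lattice. Existence and uniqueness of the
  polynomials are thus proved along the way.\<close>

lemma coeff_reverse_poly:
  assumes "degree p \<le> d"
  shows "coeff (reverse_poly d p) i = (if i \<le> d then coeff p (d - i) else 0)"
  using assms
  by (auto simp: reverse_poly_def coeff_monom_mult coeff_reflect_poly not_less intro!: coeff_eq_0)

lemma reverse_poly_0 [simp]: "reverse_poly d 0 = 0"
  by (simp add: reverse_poly_def)

lemma reverse_poly_monom:
  assumes "k \<le> d"
  shows "reverse_poly d (monom c k) = monom c (d - k)"
  using assms by (intro poly_eqI) (auto simp: coeff_reverse_poly[OF order.trans[OF degree_monom_le]])

lemma reverse_poly_sum:
  assumes "\<And>x. x \<in> A \<Longrightarrow> degree (f x) \<le> d"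
  shows "reverse_poly d (\<Sum>x\<in>A. f x) = (\<Sum>x\<in>A. reverse_poly d (f x))"
proof (cases "finite A")
  case True
  have "degree (\<Sum>x\<in>A. f x) \<le> d"
    using True assms by (rule degree_sum_le)
  then show ?thesis
    using assms by (intro poly_eqI) (simp add: coeff_reverse_poly coeff_sum)
qed simp

lemma reverse_poly_mult:
  fixes p q :: "'a::idom poly"
  assumes "degree p \<le> d" "degree q \<le> e"
  shows "reverse_poly (d + e) (p * q) = reverse_poly d p * reverse_poly e q"
proof (cases "p = 0 \<or> q = 0")
  case False
  then have "degree (p * q) = degree p + degree q" by (simp add: degree_mult_eq)
  moreover have "d + e - (degree p + degree q) = (d - degree p) + (e - degree q)"
    using assms by simp
  moreover have "monom 1 (m + n) = monom 1 m * (monom 1 n :: 'a poly)" for m n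
    by (simp add: mult_monom)
  ultimately show ?thesis
    by (simp only: reverse_poly_def reflect_poly_mult) (simp add: ac_simps)
qed auto

text \<open>If \<open>2 * degree p < d\<close>, then \<open>reverse_poly d p\<close> lives in
  degrees above \<open>d / 2\<close>. In an equation \<open>reverse_poly d p = p + q\<close> the
  coefficients of \<open>q\<close> strictly below the middle therefore determine \<open>p\<close>,
  as \<open>- low_part d q\<close>.\<close>

definition low_part :: "nat \<Rightarrow> 'a::comm_monoid_add poly \<Rightarrow> 'a poly" where
  "low_part d p = (\<Sum>i\<in>{i. 2 * i < d}. monom (coeff p i) i)"

lemma coeff_low_part [simp]: "coeff (low_part d p) i = (if 2 * i < d then coeff p i else 0)"
proof -
  have "finite {i. 2 * i < d}" by (rule finite_subset[of _ "{..<d}"]) auto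
  then show ?thesis by (simp add: low_part_def coeff_sum if_distrib[of "\<lambda>x. x = _"] sum.delta)
qed

lemma low_part_0 [simp]: "low_part d 0 = 0"
  by (rule poly_eqI) simp

lemma low_part_add: "low_part d (p + q) = low_part d p + low_part d q"
  by (rule poly_eqI) simp

section \<open>The Kazhdan--Lusztig recursion for set functions\<close>

definition chi :: "'a set \<Rightarrow> ('a set \<Rightarrow> nat) \<Rightarrow> int poly" where
  "chi E r = (\<Sum>A\<in>Pow E. monom ((-1) ^ card A) (r E - r A))"

definition contr :: "('a set \<Rightarrow> nat) \<Rightarrow> 'a set \<Rightarrow> 'a set \<Rightarrow> nat" where
  "contr r F X = r (X \<union> F) - r F"

text \<open>The term for \<open>F = {}\<close> in the Kazhdan-Lusztig equation is the unknown
  itself, so the equation is solved for it from the terms with \<open>F\<close> nonempty. A nonempty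
  \<open>E\<close> with \<open>r E = 0\<close> receives the value 0, as befits a set of loops; the
  value 1 on infinite sets is a default that keeps the recursion well founded.\<close>

function kl :: "'a set \<Rightarrow> ('a set \<Rightarrow> nat) \<Rightarrow> int poly" where
  "kl E r = (if E = {} \<or> infinite E then 1
     else - low_part (r E) (\<Sum>F\<in>Pow E - {{}}. chi F r * kl (E - F) (contr r F)))"
  by auto
termination
proof (relation "measure (\<lambda>(E, r). card E)")
  fix E F :: "'a set" and r :: "'a set \<Rightarrow> nat"
  assume "\<not> (E = {} \<or> infinite E)" "F \<in> Pow E - {{}}"
  then show "((E - F, contr r F), (E, r)) \<in> measure (\<lambda>(E, r). card E)"
    by (auto intro!: psubset_card_mono)
qed auto

declare kl.simps [simp del]

lemma kl_empty [simp]: "kl {} r = 1"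
  by (simp add: kl.simps)

lemma chi_empty [simp]: "chi {} r = 1"
  by (simp add: chi_def)

lemma chi_cong:
  assumes "\<And>X. X \<subseteq> E \<Longrightarrow> r X = s X"
  shows "chi E r = chi E s"
  using assms unfolding chi_def by (intro sum.cong) auto

lemma kl_cong:
  assumes "\<And>X. X \<subseteq> E \<Longrightarrow> r X = s X"
  shows "kl E r = kl E s"
proof (cases "finite E")
  case True
  then show ?thesis using assms
  proof (induction E arbitrary: r s rule: finite_psubset_induct)
    case (psubset E)
    have "kl (E - F) (contr r F) = kl (E - F) (contr s F)" if "F \<in> Pow E - {{}}" for F
    proof (rule psubset.IH)
      fix X assume "X \<subseteq> E - F"
      then have "X \<union> F \<subseteq> E" "F \<subseteq> E" using that by auto
      then show "contr r F X = contr s F X" using psubset.prems by (simp add: contr_def)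
    qed (use that in auto)
    moreover have "chi F r = chi F s" if "F \<in> Pow E" for F
      using that psubset.prems by (intro chi_cong) auto
    ultimately have "(\<Sum>F\<in>Pow E - {{}}. chi F r * kl (E - F) (contr r F)) =
        (\<Sum>F\<in>Pow E - {{}}. chi F s * kl (E - F) (contr s F))"
      by (intro sum.cong) auto
    then show ?case
      using psubset.prems by (simp add: kl.simps[of E])
  qed
qed (simp add: kl.simps)

lemma sum_Pow_image:
  assumes "inj_on f E"
  shows "(\<Sum>A\<in>Pow (f ` E). g A) = (\<Sum>A\<in>Pow E. g (f ` A))"
proof -
  have "inj_on ((`) f) (Pow E)" using assms by (simp add: inj_on_image_Pow)
  moreover have "Pow (f ` E) = (`) f ` Pow E" by (simp add: image_Pow_surj)
  ultimately show ?thesis by (simp add: sum.reindex)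
qed

lemma chi_image:
  assumes "inj_on f E"
  shows "chi (f ` E) r = chi E (\<lambda>X. r (f ` X))"
proof -
  have "card (f ` A) = card A" if "A \<subseteq> E" for A
    using assms that by (meson card_image inj_on_subset)
  then show ?thesis unfolding chi_def sum_Pow_image[OF assms] by (intro sum.cong) auto
qed

lemma kl_image:
  assumes "inj_on f E"
  shows "kl (f ` E) r = kl E (\<lambda>X. r (f ` X))"
proof (cases "finite E")
  case True
  then show ?thesis using assms
  proof (induction E arbitrary: r rule: finite_psubset_induct)
    case (psubset E)
    have *: "chi (f ` F) r * kl (f ` E - f ` F) (contr r (f ` F)) =
        chi F (\<lambda>X. r (f ` X)) * kl (E - F) (contr (\<lambda>X. r (f ` X)) F)"
      if F: "F \<in> Pow E - {{}}" for F
    proof -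
      have "f ` E - f ` F = f ` (E - F)"
        using F psubset.prems by (auto dest: inj_onD)
      moreover have "kl (f ` (E - F)) (contr r (f ` F)) = kl (E - F) (\<lambda>X. contr r (f ` F) (f ` X))"
        using F psubset.prems by (intro psubset.IH) (auto intro: inj_on_subset)
      moreover have "(\<lambda>X. contr r (f ` F) (f ` X)) = contr (\<lambda>X. r (f ` X)) F"
        by (simp add: fun_eq_iff contr_def image_Un)
      moreover have "chi (f ` F) r = chi F (\<lambda>X. r (f ` X))"
        using F psubset.prems by (intro chi_image) (auto intro: inj_on_subset)
      ultimately show ?thesis by simp
    qed
    have "(\<Sum>F\<in>Pow (f ` E) - {{}}. chi F r * kl (f ` E - F) (contr r F)) =
        (\<Sum>F\<in>Pow E - {{}}. chi (f ` F) r * kl (f ` E - f ` F) (contr r (f ` F)))"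
    proof -
      have "inj_on ((`) f) (Pow E - {{}})"
        using psubset.prems by (meson Diff_subset inj_on_image_Pow inj_on_subset)
      moreover have "Pow (f ` E) - {{}} = (`) f ` (Pow E - {{}})"
        by (auto simp: subset_image_iff intro!: imageI)
      ultimately show ?thesis by (simp add: sum.reindex)
    qed
    also have "\<dots> = (\<Sum>F\<in>Pow E - {{}}. chi F (\<lambda>X. r (f ` X)) * kl (E - F) (contr (\<lambda>X. r (f ` X)) F))"
      using * by (rule sum.cong[OF refl])
    finally show ?case using psubset.hyps by (simp add: kl.simps[of E] kl.simps[of "f ` E"])
  qed
next
  case False
  then show ?thesis using assms by (simp add: kl.simps finite_image_iff)
qed

section \<open>Moebius inversion on the Boolean lattice\<close>

lemma sum_Pow_insert:
  assumes "e \<notin> E"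
  shows "(\<Sum>A\<in>Pow (insert e E). f A) = (\<Sum>A\<in>Pow E. f A) + (\<Sum>A\<in>Pow E. f (insert e A))"
proof (cases "finite E")
  case True
  have "inj_on (insert e) (Pow E)" "Pow E \<inter> insert e ` Pow E = {}"
    using assms by (auto intro!: inj_onI)
  then show ?thesis using True by (simp add: Pow_insert sum.union_disjoint sum.reindex)
qed (simp add: finite_Pow_iff)

lemma sum_alternating_Pow:
  assumes "finite S"
  shows "(\<Sum>A\<in>Pow S. (-1) ^ card A) = (if S = {} then 1 else (0::'a::comm_ring_1))"
  using assms
proof (induction S rule: finite_induct)
  case (insert x S)
  have "(-1) ^ card (insert x A) = - ((-1) ^ card A :: 'a)" if "A \<in> Pow S" for A
  proof -
    have "finite A" "x \<notin> A" using that insert.hyps finite_subset by auto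
    then show ?thesis by simp
  qed
  then show ?case using insert.hyps by (simp add: sum_Pow_insert sum_negf)
qed simp

lemma sum_alternating_interval:
  assumes "finite B" "A \<subseteq> B"
  shows "(\<Sum>F | A \<subseteq> F \<and> F \<subseteq> B. (-1) ^ card (B - F)) = (if A = B then 1 else (0::'a::comm_ring_1))"
proof -
  have "(\<Sum>F | A \<subseteq> F \<and> F \<subseteq> B. (-1) ^ card (B - F)) = (\<Sum>A\<in>Pow (B - A). (-1) ^ card A :: 'a)"
    by (rule sum.reindex_bij_witness[of _ "\<lambda>X. B - X" "\<lambda>X. B - X"])
      (use assms in \<open>auto simp: double_diff\<close>)
  moreover have "B - A = {} \<longleftrightarrow> A = B" using assms by auto
  ultimately show ?thesis using assms by (simp add: sum_alternating_Pow)
qed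

text \<open>Normalisation and monotonicity turn every exponent \<open>r E - r A\<close> and every
  contracted rank into a true difference, and they pass to subsets and contractions, so that
  inductions stay within this class.\<close>

definition rank_fun :: "'a set \<Rightarrow> ('a set \<Rightarrow> nat) \<Rightarrow> bool" where
  "rank_fun E r \<longleftrightarrow> finite E \<and> r {} = 0 \<and> (\<forall>A B. A \<subseteq> B \<and> B \<subseteq> E \<longrightarrow> r A \<le> r B)"

lemma rank_fun_mono: "rank_fun E r \<Longrightarrow> A \<subseteq> B \<Longrightarrow> B \<subseteq> E \<Longrightarrow> r A \<le> r B"
  by (simp add: rank_fun_def)

lemma rank_fun_subset: "rank_fun E r \<Longrightarrow> F \<subseteq> E \<Longrightarrow> rank_fun F r"
  by (meson order.trans rank_fun_def rev_finite_subset)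

lemma rank_fun_contr:
  assumes "rank_fun E r" "F \<subseteq> E"
  shows "rank_fun (E - F) (contr r F)"
proof -
  have "contr r F A \<le> contr r F B" if "A \<subseteq> B" "B \<subseteq> E - F" for A B
  proof -
    have "A \<union> F \<subseteq> B \<union> F" "B \<union> F \<subseteq> E" using that assms by auto
    then show ?thesis unfolding contr_def using assms by (intro diff_le_mono rank_fun_mono)
  qed
  then show ?thesis using assms by (simp add: rank_fun_def contr_def)
qed

lemma contr_contr:
  assumes "rank_fun E r" "F \<subseteq> E" "G \<subseteq> E"
  shows "contr (contr r F) G = contr r (G \<union> F)"
proof
  fix X
  have "r F \<le> r (G \<union> F)" using assms by (auto intro: rank_fun_mono)
  then show "contr (contr r F) G X = contr r (G \<union> F) X" by (simp add: contr_def Un_assoc)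
qed

lemma contr_empty [simp]: "r {} = 0 \<Longrightarrow> contr r {} = r"
  by (simp add: contr_def fun_eq_iff)

lemma degree_chi_le: "degree (chi E r) \<le> r E"
proof (cases "finite E")
  case True
  then show ?thesis unfolding chi_def
    by (intro degree_sum_le) (auto intro: order.trans[OF degree_monom_le])
qed (simp add: chi_def finite_Pow_iff)

lemma reverse_chi:
  assumes "rank_fun E r"
  shows "reverse_poly (r E) (chi E r) = (\<Sum>A\<in>Pow E. monom ((-1) ^ card A) (r A))"
  unfolding chi_def using assms
  by (subst reverse_poly_sum)
    (auto intro!: order.trans[OF degree_monom_le] sum.cong simp: reverse_poly_monom rank_fun_def)

lemma chi_contr:
  assumes "rank_fun E r" "F \<subseteq> G" "G \<subseteq> E"
  shows "chi (G - F) (contr r F) = (\<Sum>B | F \<subseteq> B \<and> B \<subseteq> G. monom ((-1) ^ card (B - F)) (r G - r B))"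
  unfolding chi_def
proof (rule sum.reindex_bij_witness[of _ "\<lambda>B. B - F" "\<lambda>B. B \<union> F"])
  fix B assume B: "B \<in> Pow (G - F)"
  then have "r F \<le> r (B \<union> F)" using assms by (auto intro!: rank_fun_mono)
  moreover have "B \<union> F - F = B" "G - F \<union> F = G" using B assms by auto
  ultimately show "monom ((-1) ^ card (B \<union> F - F)) (r G - r (B \<union> F)) =
    monom ((-1) ^ card B) (contr r F (G - F) - contr r F B)" by (simp add: contr_def)
qed (use assms in auto)

text \<open>With \<open>\<zeta>\<close> the zeta function of the Boolean lattice and \<open>D\<close> the diagonal matrix with entries
  \<open>t ^ r A\<close>, the characteristic polynomials of the minors form the matrix \<open>\<zeta>\<inverse> D\<inverse> \<zeta> D\<close>
  and their reversals form \<open>D\<inverse> \<zeta>\<inverse> D \<zeta>\<close>, which are inverse to each other.\<close>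

lemma chi_kernel:
  assumes E: "rank_fun E r" and G: "G \<subseteq> E"
  shows "(\<Sum>F\<in>Pow G. reverse_poly (r F) (chi F r) * chi (G - F) (contr r F)) = (if G = {} then 1 else 0)"
proof -
  have fin: "finite G" using assms by (meson rank_fun_def finite_subset)
  let ?f = "\<lambda>A. monom ((-1) ^ card A) (r A) :: int poly"
  let ?g = "\<lambda>F B. monom ((-1) ^ card (B - F)) (r G - r B) :: int poly"
  have "(\<Sum>F\<in>Pow G. reverse_poly (r F) (chi F r) * chi (G - F) (contr r F)) =
    (\<Sum>F\<in>Pow G. \<Sum>A | A \<in> Pow G \<and> A \<subseteq> F. \<Sum>B | B \<in> Pow G \<and> F \<subseteq> B. ?f A * ?g F B)"
  proof (rule sum.cong[OF refl])
    fix F assume F: "F \<in> Pow G"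
    then have 1: "rank_fun F r" using E G by (auto intro: rank_fun_subset)
    have 2: "Pow F = {A. A \<in> Pow G \<and> A \<subseteq> F}" "{B. F \<subseteq> B \<and> B \<subseteq> G} = {B. B \<in> Pow G \<and> F \<subseteq> B}"
      using F by auto
    show "reverse_poly (r F) (chi F r) * chi (G - F) (contr r F) =
      (\<Sum>A | A \<in> Pow G \<and> A \<subseteq> F. \<Sum>B | B \<in> Pow G \<and> F \<subseteq> B. ?f A * ?g F B)"
      using F G by (simp only: reverse_chi[OF 1] chi_contr[OF E _ G] 2 sum_product PowD)
  qed
  \<comment> \<open>With \<open>A\<close> and \<open>B\<close> fixed, \<open>F\<close> runs through
    the interval between them, and the alternating sum of \<open>(-1) ^ card (B - F)\<close> leaves
    only \<open>B = A\<close>.\<close>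
  also have "\<dots> = (\<Sum>A\<in>Pow G. \<Sum>F | F \<in> Pow G \<and> A \<subseteq> F. \<Sum>B | B \<in> Pow G \<and> F \<subseteq> B. ?f A * ?g F B)"
    using fin by (intro sum.swap_restrict) auto
  also have "\<dots> = (\<Sum>A\<in>Pow G. monom ((-1) ^ card A) (r G))"
  proof (rule sum.cong[OF refl])
    fix A assume A: "A \<in> Pow G"
    have "(\<Sum>F | F \<in> Pow G \<and> A \<subseteq> F. \<Sum>B | B \<in> Pow G \<and> F \<subseteq> B. ?f A * ?g F B) =
      (\<Sum>B\<in>Pow G. \<Sum>F | F \<in> {F. F \<in> Pow G \<and> A \<subseteq> F} \<and> F \<subseteq> B. ?f A * ?g F B)"
      using fin by (intro sum.swap_restrict) auto
    also have "\<dots> = (\<Sum>B\<in>Pow G. if B = A then monom ((-1) ^ card A) (r G) else 0)"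
    proof (rule sum.cong[OF refl])
      fix B assume B: "B \<in> Pow G"
      then have finB: "finite B" using fin finite_subset by auto
      have le: "r A \<le> r G" using A E G by (auto intro: rank_fun_mono)
      have "{F. F \<in> {F. F \<in> Pow G \<and> A \<subseteq> F} \<and> F \<subseteq> B} = {F. A \<subseteq> F \<and> F \<subseteq> B}" using B by auto
      then have "(\<Sum>F | F \<in> {F. F \<in> Pow G \<and> A \<subseteq> F} \<and> F \<subseteq> B. ?f A * ?g F B) =
        ?f A * monom (\<Sum>F | A \<subseteq> F \<and> F \<subseteq> B. (-1) ^ card (B - F)) (r G - r B)"
        by (simp add: sum_distrib_left[symmetric] monom_sum[symmetric])
      also have "\<dots> = (if B = A then monom ((-1) ^ card A) (r G) else 0)"
      proof (cases "A \<subseteq> B")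
        case True
        show ?thesis unfolding sum_alternating_interval[OF finB True] using le
          by (simp add: mult_monom)
      next
        case False
        then have "{F. A \<subseteq> F \<and> F \<subseteq> B} = {}" by auto
        then show ?thesis unfolding \<open>{F. A \<subseteq> F \<and> F \<subseteq> B} = {}\<close> using False by auto
      qed
      finally show "(\<Sum>F | F \<in> {F. F \<in> Pow G \<and> A \<subseteq> F} \<and> F \<subseteq> B. ?f A * ?g F B) =
        (if B = A then monom ((-1) ^ card A) (r G) else 0)" .
    qed
    also have "\<dots> = monom ((-1) ^ card A) (r G)" using A fin by (simp add: sum.delta)
    finally show "(\<Sum>F | F \<in> Pow G \<and> A \<subseteq> F. \<Sum>B | B \<in> Pow G \<and> F \<subseteq> B. ?f A * ?g F B) =
      monom ((-1) ^ card A) (r G)" .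
  qed
  also have "\<dots> = monom (\<Sum>A\<in>Pow G. (-1) ^ card A) (r G)" by (simp add: monom_sum)
  also have "\<dots> = (if G = {} then 1 else 0)"
    using fin sum_alternating_Pow[OF fin, where 'a=int] E by (auto simp: rank_fun_def)
  finally show ?thesis .
qed

lemma sum_Pow_minus_empty:
  fixes f :: "'a set \<Rightarrow> 'b::ab_group_add"
  assumes "finite E"
  shows "(\<Sum>F\<in>Pow E - {{}}. f F) = (\<Sum>F\<in>Pow E. f F) - f {}"
  using assms by (simp add: sum_diff1)

lemma coeff_kl_eq_0:
  assumes "finite E" "E \<noteq> {}" "r E \<le> 2 * i"
  shows "coeff (kl E r) i = 0"
  using assms by (simp add: kl.simps)

lemma degree_kl_less:
  assumes "finite E" "E \<noteq> {}" "0 < r E"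
  shows "2 * degree (kl E r) < r E"
proof (rule ccontr)
  assume *: "\<not> ?thesis"
  then have "coeff (kl E r) (degree (kl E r)) = 0" using assms by (intro coeff_kl_eq_0) auto
  then show False using * assms by simp
qed

lemma degree_kl_le: "finite E \<Longrightarrow> degree (kl E r) \<le> r E"
  by (cases "E = {}") (auto intro!: degree_le coeff_kl_eq_0)

text \<open>Let \<open>Q\<close> be the sum over nonempty \<open>F\<close>. Reversing it, and
  applying induction to the contractions and the kernel identity to the products of characteristic
  polynomials, gives \<open>- Q\<close>. This antisymmetry carries the definition of
  \<open>kl\<close>, which only concerns degrees below \<open>r E / 2\<close>, over to all
  degrees.\<close>

theorem kl_equation:
  assumes "rank_fun E r"
  shows "reverse_poly (r E) (kl E r) = (\<Sum>F\<in>Pow E. chi F r * kl (E - F) (contr r F))"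
proof -
  have "finite E" using assms by (simp add: rank_fun_def)
  then show ?thesis using assms
  proof (induction E arbitrary: r rule: finite_psubset_induct)
    case (psubset E)
    note fin = psubset.hyps and E = psubset.prems
    have r0: "r {} = 0" using E by (simp add: rank_fun_def)
    show ?case
    proof (cases "E = {}")
      case True
      then show ?thesis using r0 by (simp add: reverse_poly_def)
    next
      case False
      define Q where "Q = (\<Sum>F\<in>Pow E - {{}}. chi F r * kl (E - F) (contr r F))"
      have degF: "degree (chi F r * kl (E - F) (contr r F)) \<le> r E" if "F \<in> Pow E - {{}}" for F
      proof -
        have "degree (kl (E - F) (contr r F)) \<le> r E - r F"
          using degree_kl_le[of "E - F" "contr r F"] fin that
          by (auto simp: contr_def Un_absorb2 Diff_partition)
        moreover have "r F \<le> r E" using E that by (auto intro: rank_fun_mono)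
        ultimately show ?thesis
          using degree_chi_le[of F r] degree_mult_le[of "chi F r" "kl (E - F) (contr r F)"] by linarith
      qed
      have degQ: "degree Q \<le> r E" unfolding Q_def using fin degF by (intro degree_sum_le) auto
      have "reverse_poly (r E) Q =
        (\<Sum>F\<in>Pow E - {{}}. reverse_poly (r E) (chi F r * kl (E - F) (contr r F)))"
        unfolding Q_def using degF by (rule reverse_poly_sum)
      also have "\<dots> = (\<Sum>F\<in>Pow E - {{}}. \<Sum>G | G \<in> Pow E \<and> F \<subseteq> G.
        reverse_poly (r F) (chi F r) * chi (G - F) (contr r F) * kl (E - G) (contr r G))"
      proof (rule sum.cong[OF refl])
        fix F assume F: "F \<in> Pow E - {{}}"
        have le: "r F \<le> r E" using E F by (auto intro: rank_fun_mono)
        have c: "contr r F (E - F) = r E - r F" using F by (auto simp: contr_def Un_absorb2)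
        have "reverse_poly (r E) (chi F r * kl (E - F) (contr r F)) =
          reverse_poly (r F) (chi F r) * reverse_poly (r E - r F) (kl (E - F) (contr r F))"
          using reverse_poly_mult[OF degree_chi_le degree_kl_le, of "E - F" r F "contr r F"] fin le c by simp
        also have "reverse_poly (r E - r F) (kl (E - F) (contr r F)) =
          (\<Sum>G\<in>Pow (E - F). chi G (contr r F) * kl (E - F - G) (contr (contr r F) G))"
          unfolding c[symmetric] using F by (intro psubset.IH rank_fun_contr[OF E]) auto
        also have "\<dots> = (\<Sum>G | G \<in> Pow E \<and> F \<subseteq> G. chi (G - F) (contr r F) * kl (E - G) (contr r G))"
        proof (rule sum.reindex_bij_witness[of _ "\<lambda>G. G - F" "\<lambda>G. G \<union> F"])
          fix G assume G: "G \<in> Pow (E - F)"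
          have "E - F - G = E - (G \<union> F)" "G \<union> F - F = G" using G by auto
          moreover have "contr (contr r F) G = contr r (G \<union> F)"
            using F G by (intro contr_contr[OF E]) auto
          ultimately show "chi (G \<union> F - F) (contr r F) * kl (E - (G \<union> F)) (contr r (G \<union> F)) =
            chi G (contr r F) * kl (E - F - G) (contr (contr r F) G)" by simp
        qed (use F in auto)
        finally show "reverse_poly (r E) (chi F r * kl (E - F) (contr r F)) =
          (\<Sum>G | G \<in> Pow E \<and> F \<subseteq> G.
            reverse_poly (r F) (chi F r) * chi (G - F) (contr r F) * kl (E - G) (contr r G))"
          by (simp add: sum_distrib_left mult.assoc)
      qed
      also have "\<dots> = (\<Sum>G\<in>Pow E. \<Sum>F | F \<in> Pow E - {{}} \<and> F \<subseteq> G.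
        reverse_poly (r F) (chi F r) * chi (G - F) (contr r F) * kl (E - G) (contr r G))"
        using fin by (intro sum.swap_restrict) auto
      \<comment> \<open>The kernel identity includes \<open>F = {}\<close>, whose contribution
        \<open>chi G r\<close> is therefore subtracted.\<close>
      also have "\<dots> = (\<Sum>G\<in>Pow E. ((if G = {} then 1 else 0) - chi G r) * kl (E - G) (contr r G))"
      proof (rule sum.cong[OF refl])
        fix G assume G: "G \<in> Pow E"
        then have finG: "finite G" using fin finite_subset by auto
        have "{F. F \<in> Pow E - {{}} \<and> F \<subseteq> G} = Pow G - {{}}" using G by auto
        then have "(\<Sum>F | F \<in> Pow E - {{}} \<and> F \<subseteq> G.
            reverse_poly (r F) (chi F r) * chi (G - F) (contr r F) * kl (E - G) (contr r G)) =
          (\<Sum>F\<in>Pow G - {{}}. reverse_poly (r F) (chi F r) * chi (G - F) (contr r F)) * kl (E - G) (contr r G)"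
          by (simp add: sum_distrib_right)
        also have "(\<Sum>F\<in>Pow G - {{}}. reverse_poly (r F) (chi F r) * chi (G - F) (contr r F)) =
          (if G = {} then 1 else 0) - chi G r"
          using G finG r0
          by (simp only: sum_Pow_minus_empty chi_kernel[OF E] PowD)
            (simp add: reverse_poly_def)
        finally show "(\<Sum>F | F \<in> Pow E - {{}} \<and> F \<subseteq> G.
            reverse_poly (r F) (chi F r) * chi (G - F) (contr r F) * kl (E - G) (contr r G)) =
          ((if G = {} then 1 else 0) - chi G r) * kl (E - G) (contr r G)" .
      qed
      also have "\<dots> = (\<Sum>G\<in>Pow E - {{}}. ((if G = {} then 1 else 0) - chi G r) * kl (E - G) (contr r G))"
        by (subst sum_Pow_minus_empty[OF fin]) simp
      also have "\<dots> = - Q"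
        unfolding Q_def sum_negf[symmetric] by (intro sum.cong) auto
      finally have rev: "reverse_poly (r E) Q = - Q" .
      have anti: "coeff Q (r E - i) = - coeff Q i" if "i \<le> r E" for i
        using arg_cong[OF rev, of "\<lambda>p. coeff p i"] that degQ by (simp add: coeff_reverse_poly)
      have K: "kl E r = - low_part (r E) Q" using False fin by (simp add: kl.simps[of E] Q_def)
      have "reverse_poly (r E) (kl E r) = Q + kl E r"
      proof (rule poly_eqI)
        fix i
        show "coeff (reverse_poly (r E) (kl E r)) i = coeff (Q + kl E r) i"
        proof (cases "i \<le> r E")
          case True
          \<comment> \<open>In the middle degree the coefficient equals its own negative.\<close>
          have "coeff Q i = 0" if "2 * i = r E"
          proof -
            have "r E - i = i" using that by simp
            then show ?thesis using anti[OF True] by simp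
          qed
          then show ?thesis
            using anti[OF True] True degree_kl_le[OF fin, of r]
            by (cases "2 * i" "r E" rule: linorder_cases) (auto simp: coeff_reverse_poly K)
        next
          case False
          then show ?thesis using degQ degree_kl_le[OF fin, of r]
            by (auto simp: coeff_reverse_poly coeff_eq_0 K)
        qed
      qed
      also have "\<dots> = (\<Sum>F\<in>Pow E. chi F r * kl (E - F) (contr r F))"
        using fin r0 by (simp add: Q_def sum_Pow_minus_empty)
      finally show ?thesis .
    qed
  qed
qed

text \<open>Below degree \<open>r E / 2\<close> the left side of the equation vanishes, which leaves
  \<open>p\<close> equal to minus the low part of the sum. The candidates tested in this way are
  products, for direct sums, and arbitrary Kazhdan-Lusztig assignments.\<close>

lemma kl_unique:
  assumes "finite E" "E \<noteq> {}" and deg: "degree p \<le> r E" and p: "\<And>i. r E \<le> 2 * i \<Longrightarrow> coeff p i = 0"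
    and eq: "reverse_poly (r E) p = p + (\<Sum>F\<in>Pow E - {{}}. chi F r * kl (E - F) (contr r F))"
      (is "_ = p + ?Q")
  shows "p = kl E r"
proof (rule poly_eqI)
  fix i
  have K: "kl E r = - low_part (r E) ?Q" using assms by (simp add: kl.simps[of E])
  show "coeff p i = coeff (kl E r) i"
  proof (cases "2 * i < r E")
    case True
    then have "coeff p (r E - i) = 0" by (intro p) auto
    then show ?thesis
      using arg_cong[OF eq, of "\<lambda>p. coeff p i"] True deg by (simp add: coeff_reverse_poly K)
  qed (use p in \<open>simp add: K\<close>)
qed

text \<open>Pairing \<open>A\<close> with \<open>insert e A\<close> reverses the sign and preserves
  the exponent.\<close>

lemma chi_loop:
  assumes "finite E" "e \<in> E" and loop: "\<And>A. A \<subseteq> E \<Longrightarrow> r (insert e A) = r A"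
  shows "chi E r = 0"
proof -
  have "monom ((-1) ^ card (insert e A)) (r E - r (insert e A)) =
      - (monom ((-1) ^ card A) (r E - r A) :: int poly)" if "A \<in> Pow (E - {e})" for A
  proof -
    have "card (insert e A) = Suc (card A)" "r (insert e A) = r A"
      using that assms finite_subset[of A E] by (auto intro!: card_insert_disjoint loop)
    then show ?thesis by (simp add: minus_monom)
  qed
  then have "(\<Sum>A\<in>Pow (insert e (E - {e})). monom ((-1) ^ card A) (r E - r A)) = (0 :: int poly)"
    by (subst sum_Pow_insert) (simp_all add: sum_negf)
  then show ?thesis using assms by (simp add: chi_def insert_absorb)
qed

text \<open>A term with \<open>e\<close> in \<open>F\<close> vanishes by \<open>chi_loop\<close>; if
  \<open>e\<close> lies outside \<open>F\<close>, it is still a loop of the contraction and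
  induction applies.\<close>

lemma kl_loop:
  assumes "finite E" "e \<in> E" "\<And>A. A \<subseteq> E \<Longrightarrow> r (insert e A) = r A"
  shows "kl E r = 0"
  using assms
proof (induction E arbitrary: r rule: finite_psubset_induct)
  case (psubset E)
  note loop = psubset.prems(2)
  have "chi F r * kl (E - F) (contr r F) = 0" if F: "F \<in> Pow E - {{}}" for F
  proof (cases "e \<in> F")
    case True
    have "chi F r = 0"
      using F True psubset.hyps finite_subset[of F E] by (intro chi_loop[of F e] loop) auto
    then show ?thesis by simp
  next
    case False
    have "contr r F (insert e A) = contr r F A" if "A \<subseteq> E - F" for A
    proof -
      have "A \<union> F \<subseteq> E" using that F by auto
      then show ?thesis using loop[of "A \<union> F"] by (simp add: contr_def)
    qed
    then have "kl (E - F) (contr r F) = 0"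
      using F False psubset.prems(1) by (intro psubset.IH) auto
    then show ?thesis by simp
  qed
  then have "(\<Sum>F\<in>Pow E - {{}}. chi F r * kl (E - F) (contr r F)) = 0" by (rule sum.neutral[OF ballI])
  then show ?case using psubset.hyps psubset.prems(1) by (auto simp: kl.simps[of E])
qed

section \<open>Direct sums\<close>

lemma sum_Pow_Un:
  assumes "A \<inter> B = {}"
  shows "(\<Sum>F\<in>Pow (A \<union> B). f F) = (\<Sum>F\<in>Pow A. \<Sum>G\<in>Pow B. f (F \<union> G))"
proof -
  have "(\<Sum>F\<in>Pow (A \<union> B). f F) = (\<Sum>(F, G)\<in>Pow A \<times> Pow B. f (F \<union> G))"
    by (rule sum.reindex_bij_witness[of _ "\<lambda>(F, G). F \<union> G" "\<lambda>F. (F \<inter> A, F \<inter> B)"])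
      (use assms in \<open>auto simp: Int_Un_distrib[symmetric] intro: arg_cong[of _ _ f]\<close>)
  then show ?thesis by (simp add: sum.cartesian_product)
qed

lemma chi_direct_sum:
  assumes "A \<inter> B = {}" "rank_fun A r" "rank_fun B s"
  shows "chi (A \<union> B) (\<lambda>X. r (X \<inter> A) + s (X \<inter> B)) = chi A r * chi B s"
proof -
  have "chi (A \<union> B) (\<lambda>X. r (X \<inter> A) + s (X \<inter> B)) = (\<Sum>F\<in>Pow A. \<Sum>G\<in>Pow B.
      monom ((-1) ^ card F) (r A - r F) * monom ((-1) ^ card G) (s B - s G))"
    unfolding chi_def sum_Pow_Un[OF assms(1)]
  proof (intro sum.cong refl)
    fix F G assume FG: "F \<in> Pow A" "G \<in> Pow B"
    have fin: "finite F" "finite G" "F \<inter> G = {}"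
      using FG assms by (auto simp: rank_fun_def intro: finite_subset)
    have eqs: "(F \<union> G) \<inter> A = F" "(F \<union> G) \<inter> B = G" "(A \<union> B) \<inter> A = A" "(A \<union> B) \<inter> B = B"
      using FG assms(1) by auto
    have "r F \<le> r A" "s G \<le> s B" using FG assms by (auto intro: rank_fun_mono)
    then show "monom ((-1) ^ card (F \<union> G)) (r ((A \<union> B) \<inter> A) + s ((A \<union> B) \<inter> B) -
        (r ((F \<union> G) \<inter> A) + s ((F \<union> G) \<inter> B))) =
      monom ((-1) ^ card F) (r A - r F) * (monom ((-1) ^ card G) (s B - s G) :: int poly)"
      unfolding eqs using fin by (simp add: card_Un_disjoint mult_monom power_add)
  qed
  then show ?thesis by (simp add: chi_def sum_product)
qed

text \<open>\<open>2 * j < r A\<close> and \<open>2 * (i - j) < s B\<close> cannot both hold. Both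
  sets are taken nonempty because \<open>kl {} r = 1\<close> has a coefficient in degree 0 even at
  rank 0.\<close>

lemma coeff_mult_kl_eq_0:
  assumes "finite A" "A \<noteq> {}" "finite B" "B \<noteq> {}" "r A + s B \<le> 2 * i"
  shows "coeff (kl A r * kl B s) i = 0"
  unfolding coeff_mult
proof (rule sum.neutral, rule ballI)
  fix j assume "j \<in> {..i}"
  then have "r A \<le> 2 * j \<or> s B \<le> 2 * (i - j)" using assms(5) by auto
  then show "coeff (kl A r) j * coeff (kl B s) (i - j) = 0"
    using coeff_kl_eq_0[OF assms(1,2), of r j] coeff_kl_eq_0[OF assms(3,4), of s "i - j"] by auto
qed

text \<open>The product is a candidate for \<open>kl_unique\<close>: multiplying the equations of
  the two summands gives one term for each pair of \<open>F\<close> and \<open>G\<close>, which by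
  induction is the term of \<open>F \<union> G\<close>.\<close>

lemma kl_direct_sum:
  assumes "A \<inter> B = {}" "rank_fun A r" "rank_fun B s"
  shows "kl (A \<union> B) (\<lambda>X. r (X \<inter> A) + s (X \<inter> B)) = kl A r * kl B s"
proof -
  have "finite (A \<union> B)" using assms by (simp add: rank_fun_def)
  then show ?thesis using assms
  proof (induction "A \<union> B" arbitrary: A B r s rule: finite_psubset_induct)
    case (psubset A B)
    let ?E = "A \<union> B" and ?t = "\<lambda>X. r (X \<inter> A) + s (X \<inter> B)"
    note AB = psubset.prems(1) and r = psubset.prems(2) and s = psubset.prems(3)
    have fin: "finite A" "finite B" and r0: "r {} = 0" and s0: "s {} = 0"
      using r s by (auto simp: rank_fun_def)
    consider "A = {}" | "B = {}" | "A \<noteq> {}" "B \<noteq> {}" by blast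
    then show ?case
    proof cases
      case 1
      then have "kl B ?t = kl B s" using r0 by (intro kl_cong) (simp add: Int_absorb2)
      then show ?thesis using 1 by simp
    next
      case 2
      then have "kl A ?t = kl A r" using s0 by (intro kl_cong) (simp add: Int_absorb2)
      then show ?thesis using 2 by simp
    next
      case 3
      let ?p = "kl A r * kl B s"
      \<comment> \<open>At \<open>F = {}\<close> the contraction is the whole direct sum and
        induction does not apply; there the candidate product itself is the term.\<close>
      let ?h = "\<lambda>F. if F = {} then ?p else chi F ?t * kl (?E - F) (contr ?t F)"
      have tE: "?t ?E = r A + s B" using AB by (simp add: Int_absorb1)
      have "reverse_poly (?t ?E) ?p =
          (\<Sum>F\<in>Pow A. chi F r * kl (A - F) (contr r F)) * (\<Sum>G\<in>Pow B. chi G s * kl (B - G) (contr s G))"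
        unfolding tE reverse_poly_mult[OF degree_kl_le degree_kl_le, OF fin] kl_equation[OF r] kl_equation[OF s] ..
      also have "\<dots> = (\<Sum>F\<in>Pow A. \<Sum>G\<in>Pow B. ?h (F \<union> G))"
        unfolding sum_product
      proof (intro sum.cong refl)
        fix F G assume FG: "F \<in> Pow A" "G \<in> Pow B"
        show "chi F r * kl (A - F) (contr r F) * (chi G s * kl (B - G) (contr s G)) = ?h (F \<union> G)"
        proof (cases "F \<union> G = {}")
          case True
          then show ?thesis using r0 s0 by simp
        next
          case False
          have E: "?E - (F \<union> G) = (A - F) \<union> (B - G)" using FG AB by auto
          have sub: "(A - F) \<union> (B - G) \<subset> ?E"
            unfolding E[symmetric] using FG False by auto
          have "chi (F \<union> G) ?t = chi (F \<union> G) (\<lambda>X. r (X \<inter> F) + s (X \<inter> G))"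
          proof (rule chi_cong)
            fix X assume "X \<subseteq> F \<union> G"
            then have "X \<inter> A = X \<inter> F" "X \<inter> B = X \<inter> G" using FG AB by auto
            then show "?t X = r (X \<inter> F) + s (X \<inter> G)" by simp
          qed
          also have "\<dots> = chi F r * chi G s"
            using FG AB r s by (intro chi_direct_sum) (auto intro: rank_fun_subset)
          finally have chi: "chi (F \<union> G) ?t = chi F r * chi G s" .
          have "kl (?E - (F \<union> G)) (contr ?t (F \<union> G)) =
              kl ((A - F) \<union> (B - G)) (\<lambda>X. contr r F (X \<inter> (A - F)) + contr s G (X \<inter> (B - G)))"
            unfolding E
          proof (rule kl_cong)
            fix X assume X: "X \<subseteq> (A - F) \<union> (B - G)"
            have eqs: "(X \<union> (F \<union> G)) \<inter> A = X \<inter> (A - F) \<union> F" "(X \<union> (F \<union> G)) \<inter> B = X \<inter> (B - G) \<union> G"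
              "(F \<union> G) \<inter> A = F" "(F \<union> G) \<inter> B = G"
              using FG AB X by auto
            have "r F \<le> r (X \<inter> (A - F) \<union> F)" "s G \<le> s (X \<inter> (B - G) \<union> G)"
              using FG by (auto intro!: rank_fun_mono[OF r] rank_fun_mono[OF s])
            then show "contr ?t (F \<union> G) X = contr r F (X \<inter> (A - F)) + contr s G (X \<inter> (B - G))"
              unfolding contr_def eqs by simp
          qed
          also have "\<dots> = kl (A - F) (contr r F) * kl (B - G) (contr s G)"
            using FG AB by (intro psubset.hyps(2)[OF sub] rank_fun_contr r s) auto
          finally show ?thesis using False chi by (simp only: if_False mult.assoc mult.left_commute)
        qed
      qed
      also have "\<dots> = (\<Sum>F\<in>Pow ?E. ?h F)" by (simp add: sum_Pow_Un[OF AB])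
      also have "\<dots> = ?p + (\<Sum>F\<in>Pow ?E - {{}}. ?h F)"
        by (subst sum_Pow_minus_empty) (use fin in simp_all)
      also have "(\<Sum>F\<in>Pow ?E - {{}}. ?h F) = (\<Sum>F\<in>Pow ?E - {{}}. chi F ?t * kl (?E - F) (contr ?t F))"
        by (intro sum.cong) auto
      finally have eq: "reverse_poly (?t ?E) ?p =
        ?p + (\<Sum>F\<in>Pow ?E - {{}}. chi F ?t * kl (?E - F) (contr ?t F))" .
      have "degree ?p \<le> ?t ?E"
        using degree_mult_le[of "kl A r" "kl B s"] degree_kl_le[OF fin(1), of r]
          degree_kl_le[OF fin(2), of s] tE by linarith
      then show ?thesis
        using fin 3 tE by (intro kl_unique[symmetric] eq coeff_mult_kl_eq_0) auto
    qed
  qed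
qed

section \<open>Valuative functionals\<close>

text \<open>A functional of set functions is valuative if it depends linearly on the indicator functions
  of the sequences of values along complete chains of subsets. This is the description of valuative
  matroid invariants of Derksen and Fink, which avoids matroid polytopes.\<close>

inductive_set valuative :: "'a set \<Rightarrow> (('a set \<Rightarrow> nat) \<Rightarrow> int poly) set" for E where
  chain: "distinct w \<Longrightarrow> set w = E \<Longrightarrow> (\<lambda>r. \<phi> (\<lambda>j. r (set (take j w)))) \<in> valuative E"
| add: "f \<in> valuative E \<Longrightarrow> g \<in> valuative E \<Longrightarrow> (\<lambda>r. f r + g r) \<in> valuative E"

lemma valuative_sum:
  assumes "finite E" "\<And>x. x \<in> A \<Longrightarrow> f x \<in> valuative E"
  shows "(\<lambda>r. \<Sum>x\<in>A. f x r) \<in> valuative E"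
proof -
  obtain w where w: "distinct w" "set w = E" using assms(1) finite_distinct_list by auto
  have zero: "(\<lambda>r. 0) \<in> valuative E" using valuative.chain[OF w, of "\<lambda>_. 0"] .
  show ?thesis using assms(2)
    by (induction A rule: infinite_finite_induct) (auto intro: zero valuative.add)
qed

text \<open>A complete chain of \<open>F\<close> followed by one of \<open>G\<close> is a complete
  chain of the union that passes through \<open>F\<close>; its values determine both
  \<open>r\<close> on the first chain and \<open>contr r F\<close> on the second.\<close>

lemma valuative_mult:
  assumes "f \<in> valuative F" "g \<in> valuative G" "F \<inter> G = {}"
  shows "(\<lambda>r. f r * g (contr r F)) \<in> valuative (F \<union> G)"
  using assms(1)
proof induction
  case (chain w \<phi>)
  from assms(2) show ?case
  proof induction
    case (chain w' \<psi>)
    let ?k = "length w"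
    have *: "set (take j w') \<union> F = set (take (j + ?k) (w @ w'))" for j
      using \<open>set w = F\<close> by auto
    \<comment> \<open>\<open>take\<close> saturates beyond the length of \<open>w\<close>, whereas
      the longer word goes on; \<open>min\<close> stops the index at \<open>F\<close>.\<close>
    have **: "set (take j w) = set (take (min j ?k) (w @ w'))" for j
      by (simp add: min_def)
    have "F = set (take ?k (w @ w'))" using \<open>set w = F\<close> by simp
    then have "(\<lambda>r. \<phi> (\<lambda>j. r (set (take j w))) * \<psi> (\<lambda>j. contr r F (set (take j w')))) =
        (\<lambda>r. (\<lambda>v. \<phi> (\<lambda>j. v (min j ?k)) * \<psi> (\<lambda>j. v (j + ?k) - v ?k)) (\<lambda>j. r (set (take j (w @ w')))))"
      unfolding contr_def * ** by simp
    also have "\<dots> \<in> valuative (F \<union> G)"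
      using chain \<open>distinct w\<close> \<open>set w = F\<close> assms(3) by (intro valuative.chain) auto
    finally show ?case .
  next
    case (add f g)
    then show ?case using valuative.add[OF add.IH] by (simp add: algebra_simps)
  qed
next
  case (add f f')
  then show ?case using valuative.add[OF add.IH] by (simp add: algebra_simps)
qed

text \<open>The cut-off depends on \<open>r\<close>, but only through \<open>r E\<close>, the last
  value along every complete chain, so it can be absorbed into the function of the chain.\<close>

lemma valuative_uminus_low_part:
  assumes "f \<in> valuative E"
  shows "(\<lambda>r. - low_part (r E) (f r)) \<in> valuative E"
  using assms
proof induction
  case (chain w \<phi>)
  show ?case
    using valuative.chain[OF chain, of "\<lambda>v. - low_part (v (length w)) (\<phi> v)"] chain by simp
next
  case (add f g)
  then show ?case using valuative.add[OF add.IH] by (simp add: low_part_add)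
qed

text \<open>Each summand depends on \<open>r A\<close> and \<open>r E\<close> only, and both values
  occur on a complete chain through \<open>A\<close>.\<close>

lemma valuative_chi:
  assumes "finite E"
  shows "chi E \<in> valuative E"
proof -
  have "(\<lambda>r. monom ((-1) ^ card A) (r E - r A)) \<in> valuative E" if "A \<in> Pow E" for A
  proof -
    have "finite A" "finite (E - A)" using that assms by (auto intro: finite_subset)
    then obtain u v where "distinct u" "set u = A" "distinct v" "set v = E - A"
      by (blast dest: finite_distinct_list)
    then have w: "distinct (u @ v)" "set (u @ v) = E" using that by auto
    show ?thesis
      using valuative.chain[OF w, of "\<lambda>x. monom ((-1) ^ card A) (x (length (u @ v)) - x (length u))"] w \<open>set u = A\<close>
      by simp
  qed
  then have "(\<lambda>r. \<Sum>A\<in>Pow E. monom ((-1) ^ card A) (r E - r A)) \<in> valuative E"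
    by (rule valuative_sum[OF assms])
  then show ?thesis by (simp add: chi_def[abs_def])
qed

lemma valuative_kl:
  assumes "finite E"
  shows "kl E \<in> valuative E"
  using assms
proof (induction E rule: finite_psubset_induct)
  case (psubset E)
  show ?case
  proof (cases "E = {}")
    case True
    then show ?thesis using valuative.chain[of "[]" E "\<lambda>_. 1"] by (simp add: fun_eq_iff)
  next
    case False
    have "(\<lambda>r. chi F r * kl (E - F) (contr r F)) \<in> valuative E" if F: "F \<in> Pow E - {{}}" for F
    proof -
      have "E - F \<subset> E" "finite F" "F \<union> (E - F) = E" using F psubset.hyps finite_subset by auto
      then show ?thesis
        using valuative_mult[OF valuative_chi psubset.IH, of F "E - F"] by simp
    qed
    then have "(\<lambda>r. - low_part (r E) (\<Sum>F\<in>Pow E - {{}}. chi F r * kl (E - F) (contr r F))) \<in> valuative E"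
      using psubset.hyps by (intro valuative_uminus_low_part valuative_sum)
    then show ?thesis using False psubset.hyps by (subst kl.simps[abs_def]) simp
  qed
qed

text \<open>Reduces an identity between values of an invariant to a single chain \<open>w\<close>
  and an arbitrary function \<phi> of the ranks along it; what remains is a statement about
  words.\<close>

lemma valuative_eqI:
  assumes "f \<in> valuative E"
    and "\<And>w \<phi>. distinct w \<Longrightarrow> set w = E \<Longrightarrow>
      (\<Sum>i\<in>I. c i * \<phi> (\<lambda>j. r i (set (take j w)))) = (\<Sum>i\<in>J. d i * \<phi> (\<lambda>j. s i (set (take j w))))"
  shows "(\<Sum>i\<in>I. c i * f (r i)) = (\<Sum>i\<in>J. d i * f (s i))"
  using assms(1) by induction (simp_all add: assms(2) distrib_left sum.distrib)

section \<open>Matroids given by bases\<close>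

context
  fixes M :: "'a matroid"
  assumes M: "is_matroid M"
begin

lemma finite_ground: "finite (ground M)"
  using M by (simp add: is_matroid_def)

lemma basis_subset: "B \<in> bases M \<Longrightarrow> B \<subseteq> ground M"
  using M by (simp add: is_matroid_def)

lemma basis_exchange:
  assumes "A \<in> bases M" "B \<in> bases M" "x \<in> A - B"
  obtains y where "y \<in> B - A" "insert y (A - {x}) \<in> bases M"
  using M assms unfolding is_matroid_def by meson

lemma basis_finite: "B \<in> bases M \<Longrightarrow> finite B"
  using basis_subset finite_ground finite_subset by blast

lemma card_basis:
  assumes "A \<in> bases M" "B \<in> bases M"
  shows "card A = card B"
  using assms
proof (induction "card (A - B)" arbitrary: A rule: less_induct)
  case less
  show ?case
  proof (cases "A - B = {}")
    case True
    have "B - A = {}"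
    proof (rule ccontr)
      assume "B - A \<noteq> {}"
      then obtain x where "x \<in> B - A" by blast
      then show False using basis_exchange[OF less.prems(2,1)] True by blast
    qed
    then show ?thesis using True by (metis Diff_eq_empty_iff subset_antisym)
  next
    case False
    then obtain x where x: "x \<in> A - B" by blast
    then obtain y where y: "y \<in> B - A" "insert y (A - {x}) \<in> bases M"
      using basis_exchange less.prems by blast
    have "insert y (A - {x}) - B = (A - B) - {x}" using x y by auto
    moreover have "finite (A - B)" using basis_finite less.prems by blast
    ultimately have "card (insert y (A - {x}) - B) < card (A - B)"
      using x by (simp only: card_Diff1_less)
    then have "card (insert y (A - {x})) = card B" using less.hyps y less.prems by blast
    moreover have "card (insert y (A - {x})) = card A"
      using x y basis_finite[OF less.prems(1)] card.remove[of A x] by simp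
    ultimately show ?thesis by simp
  qed
qed

lemma indep_subset: "indep M I \<Longrightarrow> J \<subseteq> I \<Longrightarrow> indep M J"
  by (auto simp: indep_def)

lemma indep_subset_ground: "indep M I \<Longrightarrow> I \<subseteq> ground M"
  using basis_subset by (auto simp: indep_def)

lemma indep_finite: "indep M I \<Longrightarrow> finite I"
  using indep_subset_ground finite_ground finite_subset by blast

lemma indep_empty: "indep M {}"
  using M by (auto simp: indep_def is_matroid_def)

text \<open>Among the bases containing \<open>I\<close>, let \<open>A\<close> have the largest
  overlap with a basis \<open>B\<close> containing \<open>J\<close>. Exchange then gives
  \<open>A - I \<subseteq> B\<close>. If no element of \<open>J\<close> augments \<open>I\<close>,
  the set \<open>A - I\<close> even lies in \<open>B - J\<close>, and counting contradicts
  \<open>card I < card J\<close>.\<close>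

lemma indep_augment:
  assumes "indep M I" "indep M J" "card I < card J"
  shows "\<exists>y\<in>J - I. indep M (insert y I)"
proof -
  obtain B where B: "B \<in> bases M" "J \<subseteq> B" using assms by (auto simp: indep_def)
  obtain A0 where A0: "A0 \<in> bases M" "I \<subseteq> A0" using assms by (auto simp: indep_def)
  obtain A where A: "A \<in> bases M" "I \<subseteq> A"
    and max: "\<And>A'. A' \<in> bases M \<Longrightarrow> I \<subseteq> A' \<Longrightarrow> card (A' \<inter> B) \<le> card (A \<inter> B)"
  proof -
    let ?P = "\<lambda>A. A \<in> bases M \<and> I \<subseteq> A" and ?f = "\<lambda>A. card (A \<inter> B)"
    have "\<forall>A. ?P A \<longrightarrow> ?f A < Suc (card B)"
      using basis_finite[OF B(1)] by (auto simp: less_Suc_eq_le intro: card_mono)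
    moreover have "?P A0" using A0 by simp
    ultimately have "\<exists>A. ?P A \<and> (\<forall>A'. ?P A' \<longrightarrow> ?f A' \<le> ?f A)"
      by (intro ex_has_greatest_nat)
    then show ?thesis using that by blast
  qed
  have AB: "A - I \<subseteq> B"
  proof (rule ccontr)
    assume "\<not> A - I \<subseteq> B"
    then obtain x where x: "x \<in> A - B" "x \<notin> I" by blast
    then obtain y where y: "y \<in> B - A" "insert y (A - {x}) \<in> bases M"
      using basis_exchange A B by blast
    have "insert y (A - {x}) \<inter> B = insert y (A \<inter> B)" using x y by auto
    then have "card (insert y (A - {x}) \<inter> B) = Suc (card (A \<inter> B))"
      using y basis_finite[OF B(1)] by simp
    moreover have "card (insert y (A - {x}) \<inter> B) \<le> card (A \<inter> B)"
      using A x y by (intro max) auto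
    ultimately show False by simp
  qed
  show ?thesis
  proof (rule ccontr)
    assume *: "\<not> ?thesis"
    have "(A - I) \<inter> J = {}"
    proof (rule ccontr)
      assume "(A - I) \<inter> J \<noteq> {}"
      then obtain y where y: "y \<in> A" "y \<notin> I" "y \<in> J" by blast
      then have "indep M (insert y I)" using A by (auto simp: indep_def)
      then show False using * y by blast
    qed
    then have "A - I \<subseteq> B - J" using AB by blast
    then have "card (A - I) \<le> card (B - J)" using basis_finite[OF B(1)] by (intro card_mono) auto
    then have "card A - card I \<le> card B - card J"
      using A B assms by (simp add: card_Diff_subset indep_finite)
    moreover have "card I \<le> card A" "card J \<le> card B"
      using A B by (auto intro: card_mono basis_finite)
    ultimately show False using card_basis[OF A(1) B(1)] assms(3) by linarith
  qed
qed

lemma finite_indep_cards: "finite (card ` {I. I \<subseteq> X \<and> indep M I})"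
proof (rule finite_imageI, rule finite_subset)
  show "{I. I \<subseteq> X \<and> indep M I} \<subseteq> Pow (ground M)" using indep_subset_ground by auto
qed (simp add: finite_ground)

lemma indep_card_le_rk: "indep M I \<Longrightarrow> I \<subseteq> X \<Longrightarrow> card I \<le> rk M X"
  unfolding rk_def using finite_indep_cards by (intro Max_ge) auto

lemma rk_attained: "\<exists>I\<subseteq>X. indep M I \<and> card I = rk M X"
proof -
  have "card ` {I. I \<subseteq> X \<and> indep M I} \<noteq> {}" using indep_empty by auto
  then have "rk M X \<in> card ` {I. I \<subseteq> X \<and> indep M I}"
    unfolding rk_def by (intro Max_in finite_indep_cards)
  then show ?thesis by auto
qed

lemma indep_extend:
  assumes "indep M I" "I \<subseteq> X"
  shows "\<exists>J. I \<subseteq> J \<and> J \<subseteq> X \<and> indep M J \<and> card J = rk M X"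
  using assms
proof (induction "rk M X - card I" arbitrary: I rule: less_induct)
  case less
  show ?case
  proof (cases "card I = rk M X")
    case True
    then show ?thesis using less.prems by blast
  next
    case False
    then have lt: "card I < rk M X" using indep_card_le_rk[OF less.prems] by simp
    obtain K where K: "K \<subseteq> X" "indep M K" "card K = rk M X" using rk_attained by blast
    then obtain y where y: "y \<in> K - I" "indep M (insert y I)"
      using indep_augment[OF less.prems(1) K(2)] lt by auto
    have "card (insert y I) = Suc (card I)" using y indep_finite less.prems by auto
    then have "rk M X - card (insert y I) < rk M X - card I" using lt by simp
    then show ?thesis using less.hyps[of "insert y I"] y K less.prems by auto
  qed
qed

lemma rk_empty: "rk M {} = 0"
  using rk_attained[of "{}"] by auto

lemma rk_mono:
  assumes "X \<subseteq> Y"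
  shows "rk M X \<le> rk M Y"
  using rk_attained[of X] indep_card_le_rk assms by (metis order.trans)

lemma rank_fun_rk: "rank_fun (ground M) (rk M)"
  by (simp add: rank_fun_def finite_ground rk_empty rk_mono)

text \<open>Closure is monotone: a maximal independent subset of \<open>F\<close> extends to one of
  \<open>X\<close>, and if \<open>e\<close> augmented the latter, it would augment the
  former.\<close>

lemma rk_insert_eq:
  assumes "rk M (insert e F) = rk M F" "F \<subseteq> X"
  shows "rk M (insert e X) = rk M X"
proof (rule ccontr)
  assume "\<not> ?thesis"
  then have lt: "rk M X < rk M (insert e X)" 
    using rk_mono[OF subset_insertI, of X e] by simp
  obtain I where I: "I \<subseteq> F" "indep M I" "card I = rk M F" using rk_attained by blast
  then obtain J where J: "I \<subseteq> J" "J \<subseteq> X" "indep M J" "card J = rk M X"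
    using indep_extend[of I X] assms by blast
  obtain K where K: "K \<subseteq> insert e X" "indep M K" "card K = rk M (insert e X)"
    using rk_attained by blast
  obtain y where y: "y \<in> K - J" "indep M (insert y J)"
    using indep_augment[OF J(3) K(2)] lt J K by auto
  have "\<not> insert y J \<subseteq> X"
  proof
    assume "insert y J \<subseteq> X"
    then have "card (insert y J) \<le> rk M X" using indep_card_le_rk y by blast
    then show False using y J indep_finite[OF J(3)] by simp
  qed
  then have "y = e" using y K J by auto
  then have "indep M (insert e I)" using y J by (auto intro: indep_subset)
  then have "card (insert e I) \<le> rk M F" using indep_card_le_rk[of "insert e I" "insert e F"] I assms by auto
  moreover have "e \<notin> I" using y J \<open>y = e\<close> by auto
  ultimately show False using I indep_finite[OF I(2)] by simp
qed

lemma basis_indep: "B \<in> bases M \<Longrightarrow> indep M B"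
  by (auto simp: indep_def)

lemma basis_iff: "B \<in> bases M \<longleftrightarrow> indep M B \<and> card B = rank M"
proof -
  have "card B = rank M" if "B \<in> bases M" for B
  proof -
    obtain I where I: "I \<subseteq> ground M" "indep M I" "card I = rank M" using rk_attained by blast
    then obtain A where "A \<in> bases M" "I \<subseteq> A" by (auto simp: indep_def)
    then have "rank M \<le> card B" using I card_basis[OF that] card_mono[OF basis_finite] by metis
    then show ?thesis
      using indep_card_le_rk[OF basis_indep[OF that] basis_subset[OF that]] by simp
  qed
  moreover have "B \<in> bases M" if "indep M B" "card B = rank M"
  proof -
    obtain A where A: "A \<in> bases M" "B \<subseteq> A" using \<open>indep M B\<close> by (auto simp: indep_def)
    then have "card A = card B" using \<open>\<And>B. B \<in> bases M \<Longrightarrow> card B = rank M\<close> that by simp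
    then show ?thesis using A card_subset_eq[OF basis_finite] by metis
  qed
  ultimately show ?thesis using basis_indep by blast
qed

lemma indep_extend_basis:
  assumes "indep M I"
  shows "\<exists>B\<in>bases M. I \<subseteq> B"
  using assms by (auto simp: indep_def)

section \<open>Restrictions and contractions\<close>

lemma basis_restriction_iff:
  "I \<in> bases (restriction M F) \<longleftrightarrow> I \<subseteq> F \<and> indep M I \<and> card I = rk M F"
proof
  assume "I \<in> bases (restriction M F)"
  then have I: "I \<subseteq> F" "indep M I" and max: "\<And>J. J \<subseteq> F \<Longrightarrow> indep M J \<Longrightarrow> I \<subseteq> J \<Longrightarrow> J = I"
    by (auto simp: restriction_def)
  obtain J where "I \<subseteq> J \<and> J \<subseteq> F \<and> indep M J \<and> card J = rk M F" using indep_extend[OF I(2,1)] by blast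
  then show "I \<subseteq> F \<and> indep M I \<and> card I = rk M F" using max I by metis
next
  assume I: "I \<subseteq> F \<and> indep M I \<and> card I = rk M F"
  have "J = I" if "J \<subseteq> F" "indep M J" "I \<subseteq> J" for J
    using that I indep_card_le_rk[of J F] card_seteq[OF indep_finite[OF that(2)], of I] by auto
  then show "I \<in> bases (restriction M F)" using I by (auto simp: restriction_def)
qed

lemma indep_restriction: "indep (restriction M F) I \<longleftrightarrow> I \<subseteq> F \<and> indep M I"
proof
  assume "indep (restriction M F) I"
  then obtain J where "J \<in> bases (restriction M F)" "I \<subseteq> J" by (auto simp: indep_def)
  then show "I \<subseteq> F \<and> indep M I" by (auto simp: basis_restriction_iff intro: indep_subset)
next
  assume "I \<subseteq> F \<and> indep M I"
  then obtain J where "I \<subseteq> J" "J \<in> bases (restriction M F)"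
    using indep_extend[of I F] by (auto simp: basis_restriction_iff)
  then show "indep (restriction M F) I" by (auto simp: indep_def)
qed

lemma rk_restriction:
  assumes "A \<subseteq> F"
  shows "rk (restriction M F) A = rk M A"
proof -
  have "{I. I \<subseteq> A \<and> indep (restriction M F) I} = {I. I \<subseteq> A \<and> indep M I}"
    using assms by (auto simp: indep_restriction)
  then show ?thesis by (simp add: rk_def)
qed

lemma char_poly_restriction: "char_poly (restriction M F) = chi F (rk M)"
proof -
  have "ground (restriction M F) = F" by (simp add: restriction_def)
  then show ?thesis unfolding char_poly_def chi_def
    by (intro sum.cong) (auto simp: rk_restriction)
qed

lemma ground_contraction: "ground (contraction M F) = ground M - F"
  by (simp add: contraction_def)

text \<open>\<open>contraction\<close> asks for some basis of \<open>F\<close>; a prescribed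
  \<open>I\<close> serves just as well. Extend \<open>I\<close> within
  \<open>B \<union> J \<union> I\<close>: maximality of \<open>I\<close> in \<open>F\<close> keeps
  the extension inside \<open>B \<union> I\<close>, and the cardinalities force equality.\<close>

lemma basis_contraction_iff:
  assumes "I \<in> bases (restriction M F)"
  shows "B \<in> bases (contraction M F) \<longleftrightarrow> B \<subseteq> ground M - F \<and> B \<union> I \<in> bases M"
proof -
  have I: "I \<subseteq> F" "indep M I" "card I = rk M F" using assms by (auto simp: basis_restriction_iff)
  have "B \<union> I \<in> bases M" if B: "B \<subseteq> ground M - F" and J: "J \<in> bases (restriction M F)" "B \<union> J \<in> bases M" for J
  proof -
    have J': "J \<subseteq> F" "indep M J" "card J = rk M F" using J by (auto simp: basis_restriction_iff)
    obtain C where C: "I \<subseteq> C" "C \<subseteq> B \<union> J \<union> I" "indep M C" "card C = rk M (B \<union> J \<union> I)"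
      using indep_extend[OF I(2), of "B \<union> J \<union> I"] by blast
    have "card (B \<union> J) \<le> card C"
      using indep_card_le_rk[OF basis_indep[OF J(2)], of "B \<union> J \<union> I"] C by auto
    have "C \<inter> F = I"
    proof -
      have "indep M (C \<inter> F)" using C by (auto intro: indep_subset)
      then have "card (C \<inter> F) \<le> card I" using indep_card_le_rk[of "C \<inter> F" F] I by auto
      then show ?thesis using C I indep_finite[OF C(3)] by (metis card_seteq finite_Int inf_greatest)
    qed
    then have sub: "C \<subseteq> B \<union> I" using C B J' by auto
    have fin: "finite B" using B finite_ground finite_subset by blast
    have "card (B \<union> J) = card B + card J" "card (B \<union> I) = card B + card I"
      using B I(1) J'(1) fin indep_finite[OF I(2)] indep_finite[OF J'(2)]
      by (blast intro!: card_Un_disjoint)+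
    then have "card (B \<union> I) = card (B \<union> J)" using I J' by simp
    then have "C = B \<union> I" using sub \<open>card (B \<union> J) \<le> card C\<close> fin I(2) indep_finite
      by (metis card_seteq finite_UnI)
    then show ?thesis using C(3) \<open>card (B \<union> I) = card (B \<union> J)\<close> J(2) by (simp add: basis_iff)
  qed
  then show ?thesis using assms unfolding contraction_def by auto
qed

lemma restriction_basis_exists: "\<exists>I. I \<in> bases (restriction M F)"
  using rk_attained[of F] by (auto simp: basis_restriction_iff)

lemma is_matroid_contraction: "is_matroid (contraction M F)"
proof -
  obtain I where I: "I \<in> bases (restriction M F)" using restriction_basis_exists by blast
  then have IF: "I \<subseteq> F" "indep M I" "card I = rk M F" by (auto simp: basis_restriction_iff)
  note iff = basis_contraction_iff[OF I]
  obtain B where B: "I \<subseteq> B" "B \<in> bases M" using indep_extend_basis[OF IF(2)] by blast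
  have "B \<inter> F = I"
  proof -
    have "indep M (B \<inter> F)" using B basis_indep by (auto intro: indep_subset)
    then have "card (B \<inter> F) \<le> card I" using indep_card_le_rk[of "B \<inter> F" F] IF by auto
    then show ?thesis using B IF basis_finite[OF B(2)] by (metis card_seteq finite_Int inf_greatest)
  qed
  then have "(B - F) \<union> I = B" by auto
  then have "B - F \<in> bases (contraction M F)" using B basis_subset[OF B(2)] by (auto simp: iff)
  moreover have "\<exists>y\<in>B - A. insert y (A - {x}) \<in> bases (contraction M F)"
    if AB: "A \<in> bases (contraction M F)" "B \<in> bases (contraction M F)" "x \<in> A - B" for A B x
  proof -
    have A: "A \<subseteq> ground M - F" "A \<union> I \<in> bases M" and B: "B \<subseteq> ground M - F" "B \<union> I \<in> bases M"
      using AB by (auto simp: iff)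
    have "x \<notin> I" using A IF AB(3) by auto
    then obtain y where y: "y \<in> (B \<union> I) - (A \<union> I)" "insert y ((A \<union> I) - {x}) \<in> bases M"
      using basis_exchange[OF A(2) B(2), of x] AB(3) by blast
    have "insert y ((A \<union> I) - {x}) = insert y (A - {x}) \<union> I" using \<open>x \<notin> I\<close> by auto
    then show ?thesis using y A B by (auto simp: iff intro!: bexI[of _ y])
  qed
  ultimately show ?thesis
    unfolding is_matroid_def ground_contraction using finite_ground iff by blast
qed

lemma indep_contraction_iff:
  assumes "I \<in> bases (restriction M F)"
  shows "indep (contraction M F) J \<longleftrightarrow> J \<subseteq> ground M - F \<and> indep M (J \<union> I)"
proof
  assume "indep (contraction M F) J"
  then obtain B where "B \<in> bases (contraction M F)" "J \<subseteq> B" by (auto simp: indep_def)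
  then show "J \<subseteq> ground M - F \<and> indep M (J \<union> I)"
    unfolding basis_contraction_iff[OF assms] indep_def by blast
next
  assume J: "J \<subseteq> ground M - F \<and> indep M (J \<union> I)"
  have IF: "I \<subseteq> F" "indep M I" "card I = rk M F" using assms by (auto simp: basis_restriction_iff)
  obtain B where B: "J \<union> I \<subseteq> B" "B \<in> bases M" using indep_extend_basis J by blast
  have "B \<inter> F = I"
  proof -
    have "indep M (B \<inter> F)" using B basis_indep by (auto intro: indep_subset)
    then have "card (B \<inter> F) \<le> card I" using indep_card_le_rk[of "B \<inter> F" F] IF by auto
    moreover have "I \<subseteq> B \<inter> F" using B IF by auto
    ultimately show ?thesis using basis_finite[OF B(2)] by (metis card_seteq finite_Int)
  qed
  then have "(B - F) \<union> I = B" by auto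
  then have "B - F \<in> bases (contraction M F)"
    using B basis_subset[OF B(2)] by (auto simp: basis_contraction_iff[OF assms])
  moreover have "J \<subseteq> B - F" using B J by auto
  ultimately show "indep (contraction M F) J" by (auto simp: indep_def)
qed

lemma rk_contraction:
  assumes X: "X \<subseteq> ground M - F"
  shows "rk (contraction M F) X = contr (rk M) F X"
proof -
  obtain I where I: "I \<in> bases (restriction M F)" using restriction_basis_exists by blast
  then have IF: "I \<subseteq> F" "indep M I" "card I = rk M F" by (auto simp: basis_restriction_iff)
  note iff = indep_contraction_iff[OF I]
  have le: "card J \<le> contr (rk M) F X" if "J \<subseteq> X" "indep (contraction M F) J" for J
  proof -
    have "indep M (J \<union> I)" "J \<inter> I = {}" using that IF X by (auto simp: iff)
    then have "card J + card I \<le> rk M (X \<union> F)"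
      using indep_card_le_rk[of "J \<union> I" "X \<union> F"] that IF indep_finite[of "J \<union> I"]
      by (auto simp: card_Un_disjoint)
    then show ?thesis using IF by (simp add: contr_def)
  qed
  obtain C where C: "I \<subseteq> C" "C \<subseteq> X \<union> F" "indep M C" "card C = rk M (X \<union> F)"
    using indep_extend[OF IF(2), of "X \<union> F"] IF by blast
  have "C \<inter> F = I"
  proof -
    have "indep M (C \<inter> F)" using C by (auto intro: indep_subset)
    then have "card (C \<inter> F) \<le> card I" using indep_card_le_rk[of "C \<inter> F" F] IF by auto
    then show ?thesis using C IF indep_finite[OF C(3)] by (metis card_seteq finite_Int inf_greatest)
  qed
  then have "C - F = C - I" "(C - F) \<union> I = C" by auto
  then have "indep (contraction M F) (C - F)" "C - F \<subseteq> X" "card (C - F) = contr (rk M) F X"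
    using C X indep_subset_ground[OF C(3)] IF
    by (auto simp: iff contr_def card_Diff_subset[OF indep_finite[OF IF(2)] C(1)])
  then have "contr (rk M) F X \<in> card ` {J. J \<subseteq> X \<and> indep (contraction M F) J}"
    by (metis (mono_tags, lifting) image_eqI mem_Collect_eq)
  moreover have "finite {J. J \<subseteq> X \<and> indep (contraction M F) J}"
    by (rule finite_subset[of _ "Pow (ground M)"]) (use X finite_ground in auto)
  ultimately show ?thesis unfolding rk_def[of "contraction M F"] using le by (intro Max_eqI) auto
qed

lemma loopless_contraction:
  assumes "F \<in> flats M"
  shows "loopless (contraction M F)"
  unfolding loopless_def ground_contraction
proof
  fix e assume e: "e \<in> ground M - F"
  obtain I where I: "I \<in> bases (restriction M F)" using restriction_basis_exists by blast
  then have IF: "I \<subseteq> F" "indep M I" "card I = rk M F" by (auto simp: basis_restriction_iff)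
  have "rk M F < rk M (insert e F)" using assms e by (simp add: flats_def)
  moreover obtain J where J: "I \<subseteq> J" "J \<subseteq> insert e F" "indep M J" "card J = rk M (insert e F)"
    using indep_extend[OF IF(2), of "insert e F"] IF by blast
  ultimately have "\<not> J \<subseteq> F" using indep_card_le_rk[OF J(3)] by (metis not_le)
  then have "indep M ({e} \<union> I)" using J by (auto intro!: indep_subset[OF J(3)])
  then show "indep (contraction M F) {e}" using e by (simp add: indep_contraction_iff[OF I])
qed

lemma kl_contraction: "kl (ground M - F) (rk (contraction M F)) = kl (ground M - F) (contr (rk M) F)"
  by (rule kl_cong) (rule rk_contraction)

text \<open>An element that fails to raise the rank of \<open>F\<close> becomes a loop of the
  contraction.\<close>

lemma kl_contraction_nonflat:
  assumes "F \<subseteq> ground M" "F \<notin> flats M"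
  shows "kl (ground M - F) (contr (rk M) F) = 0"
proof -
  obtain e where e: "e \<in> ground M - F" "rk M (insert e F) \<le> rk M F"
    using assms by (auto simp: flats_def not_less)
  then have "rk M (insert e F) = rk M F" 
    using rk_mono[OF subset_insertI, of F e] by simp
  then have "contr (rk M) F (insert e A) = contr (rk M) F A" for A
    using rk_insert_eq[of e F "A \<union> F"] by (simp add: contr_def)
  then show ?thesis using e finite_ground by (intro kl_loop[of _ e]) auto
qed

lemma contraction_empty: "contraction M {} = M"
proof -
  have "bases (restriction M {}) = {{}}"
    using indep_empty by (auto simp: basis_restriction_iff rk_empty)
  then show ?thesis using basis_subset by (cases M) (auto simp: contraction_def)
qed

text \<open>\<open>X\<close> is \<open>{}\<close> for the defining equation, and \<open>{{}}\<close>
  when the equation is solved for the unknown term of the empty flat.\<close>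

lemma sum_flats:
  "(\<Sum>F\<in>flats M - X. chi F (rk M) * kl (ground M - F) (contr (rk M) F)) =
   (\<Sum>F\<in>Pow (ground M) - X. chi F (rk M) * kl (ground M - F) (contr (rk M) F))"
  using finite_ground kl_contraction_nonflat
  by (intro sum.mono_neutral_left) (auto simp: flats_def)

lemma loopless_rk:
  assumes "loopless M" "ground M \<noteq> {}"
  shows "0 < rank M"
proof -
  obtain e where "e \<in> ground M" using assms by blast
  then have "indep M {e}" using assms by (auto simp: loopless_def)
  then show ?thesis using indep_card_le_rk[of "{e}" "ground M"] \<open>e \<in> ground M\<close> by auto
qed

lemma empty_flat: "loopless M \<Longrightarrow> {} \<in> flats M"
  using indep_card_le_rk by (force simp: flats_def loopless_def rk_empty)

end

lemma KL_assignment_kl: "KL_assignment (\<lambda>M. kl (ground M) (rk M))"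
  unfolding KL_assignment_def
proof (intro allI impI conjI)
  fix M :: "'a matroid" assume M: "is_matroid M \<and> loopless M"
  then have fin: "finite (ground M)" by (simp add: finite_ground)
  show "kl (ground M) (rk M) = 1" if "rank M = 0"
    using loopless_rk[of M] M that by (cases "ground M = {}") auto
  show "2 * degree (kl (ground M) (rk M)) < rank M" if "rank M > 0"
    using that fin M by (intro degree_kl_less) (auto simp: rk_empty)
  show "reverse_poly (rank M) (kl (ground M) (rk M)) =
    (\<Sum>F\<in>flats M. char_poly (restriction M F) * kl (ground (contraction M F)) (rk (contraction M F)))"
    using sum_flats[of M "{}"] M
    by (simp add: kl_equation rank_fun_rk char_poly_restriction ground_contraction kl_contraction)
qed

text \<open>The empty set, a flat because \<open>M\<close> is loopless, contributes the unknown
  \<open>P M\<close>; all other flats give smaller loopless contractions, to which induction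
  applies.\<close>

lemma KL_assignment_unique:
  assumes P: "KL_assignment P" and "is_matroid M" "loopless M"
  shows "P M = kl (ground M) (rk M)"
  using assms(2,3)
proof (induction "card (ground M)" arbitrary: M rule: less_induct)
  case less
  note M = less.prems(1) and ll = less.prems(2)
  note fin = finite_ground[OF M]
  show ?case
  proof (cases "ground M = {}")
    case True
    then show ?thesis using P less.prems by (simp add: KL_assignment_def rk_empty)
  next
    case False
    then have pos: "0 < rank M" using M ll by (simp add: loopless_rk)
    then have deg: "2 * degree (P M) < rank M" using P less.prems by (simp add: KL_assignment_def)
    have IH: "P (contraction M F) = kl (ground M - F) (contr (rk M) F)" if "F \<in> flats M - {{}}" for F
    proof -
      have "ground M - F \<subset> ground M" using that by (auto simp: flats_def)
      then have "card (ground (contraction M F)) < card (ground M)"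
        using fin by (simp add: ground_contraction[OF M] psubset_card_mono)
      then have "P (contraction M F) = kl (ground (contraction M F)) (rk (contraction M F))"
        using that M by (intro less.hyps is_matroid_contraction loopless_contraction) auto
      then show ?thesis using M by (simp add: ground_contraction kl_contraction)
    qed
    have finF: "finite (flats M)" 
      by (rule finite_subset[of _ "Pow (ground M)"]) (use fin in \<open>auto simp: flats_def\<close>)
    have "reverse_poly (rank M) (P M) = (\<Sum>F\<in>flats M. chi F (rk M) * P (contraction M F))"
      using P less.prems by (simp add: KL_assignment_def char_poly_restriction)
    also have "\<dots> = P M + (\<Sum>F\<in>flats M - {{}}. chi F (rk M) * P (contraction M F))"
      using finF empty_flat[OF M ll] by (simp add: sum.remove contraction_empty[OF M])
    also have "(\<Sum>F\<in>flats M - {{}}. chi F (rk M) * P (contraction M F)) =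
        (\<Sum>F\<in>flats M - {{}}. chi F (rk M) * kl (ground M - F) (contr (rk M) F))"
      using IH by (intro sum.cong) auto
    also have "\<dots> = (\<Sum>F\<in>Pow (ground M) - {{}}. chi F (rk M) * kl (ground M - F) (contr (rk M) F))"
      by (rule sum_flats[OF M])
    finally show ?thesis using fin False deg
      by (intro kl_unique) (auto intro: coeff_eq_0)
  qed
qed

theorem KL_poly_eq_kl:
  assumes "is_matroid M" "loopless M"
  shows "KL_poly M = kl (ground M) (rk M)"
  unfolding KL_poly_def
  using KL_assignment_kl KL_assignment_unique[OF _ assms] by (intro the_equality) (auto 4 4)

section \<open>The cycle lemma\<close>

text \<open>Equivalently, the partial sums of the word reach their maximum for the first time at its
  very end. In this form an initial segment up to the first maximum is recognised without reference
  to what follows.\<close>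

definition good :: "('b \<Rightarrow> int) \<Rightarrow> 'b list \<Rightarrow> bool" where
  "good y xs \<longleftrightarrow> (\<forall>l<length xs. 0 < sum_list (map y (drop l xs)))"

lemma good_appendD: "good y (xs @ ys) \<Longrightarrow> ys \<noteq> [] \<Longrightarrow> 0 < sum_list (map y ys)"
  unfolding good_def by (drule spec[of _ "length xs"]) simp

lemma good_antimono:
  assumes "good y xs" "\<And>x. y x \<le> z x"
  shows "good z xs"
  unfolding good_def
proof (intro allI impI)
  fix l assume "l < length xs"
  then have "0 < sum_list (map y (drop l xs))" using assms by (simp add: good_def)
  also have "\<dots> \<le> sum_list (map z (drop l xs))" using assms by (intro sum_list_mono) auto
  finally show "0 < sum_list (map z (drop l xs))" .
qed

text \<open>Cut after the first maximum \<open>k\<close> of the partial sums and swap the two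
  pieces. A suffix starting in the first new piece is positive since \<open>k\<close> is a maximum
  and the total is 1; one starting in the second piece is positive since \<open>k\<close> is the
  first maximum.\<close>

lemma good_rotate_exists:
  assumes "sum_list (map y xs) = 1"
  shows "\<exists>m<length xs. \<exists>ys. good y ys \<and> xs = rotate m ys"
proof -
  let ?S = "\<lambda>k. sum_list (map y (take k xs))"
  define m where "m = Max (?S ` {..length xs})"
  have max: "?S l \<le> m" if "l \<le> length xs" for l
    unfolding m_def using that by (intro Max_ge) auto
  have "m \<in> ?S ` {..length xs}" unfolding m_def by (rule Max_in) auto
  then obtain k' where "k' \<le> length xs" "?S k' = m" by auto
  then have k': "k' \<le> length xs \<and> ?S k' = m" by simp
  define k where "k = (LEAST k. k \<le> length xs \<and> ?S k = m)"
  have k: "k \<le> length xs" "?S k = m" unfolding k_def using LeastI[of "\<lambda>k. k \<le> length xs \<and> ?S k = m", OF k'] by auto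
  have less: "?S l < ?S k" if "l < k" for l
  proof -
    have "?S l \<noteq> m" using not_less_Least[of l "\<lambda>k. k \<le> length xs \<and> ?S k = m"] that k unfolding k_def[symmetric] by auto
    then show ?thesis using max[of l] that k by auto
  qed
  have "?S (length xs) = 1" using assms by simp
  then have "1 \<le> m" using max[of "length xs"] by simp
  then have "k \<noteq> 0" using k by (intro notI) simp
  let ?ys = "drop k xs @ take k xs"
  have S: "sum_list (map y (drop l xs)) = 1 - ?S l" for l
    using assms by (metis append_take_drop_id map_append sum_list_append add_diff_cancel_left')
  have "good y ?ys" unfolding good_def
  proof (intro allI impI)
    fix l assume l: "l < length ?ys"
    show "0 < sum_list (map y (drop l ?ys))"
    proof (cases "l < length xs - k")
      case True
      then have "drop l ?ys = drop (l + k) xs @ take k xs" by simp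
      then have "sum_list (map y (drop l ?ys)) = 1 - ?S (l + k) + ?S k" by (simp add: S)
      then show ?thesis using max[of "l + k"] True k by linarith
    next
      case False
      let ?l = "l - (length xs - k)"
      have "?l < k" using l k False by auto
      have "drop l ?ys = drop ?l (take k xs)" using False by simp
      moreover have "take k xs = take ?l xs @ drop ?l (take k xs)"
        using \<open>?l < k\<close> by (metis append_take_drop_id min_def less_imp_le take_take)
      then have "?S k = ?S ?l + sum_list (map y (drop ?l (take k xs)))"
        by (metis map_append sum_list_append)
      ultimately show ?thesis using less[OF \<open>?l < k\<close>] by simp
    qed
  qed
  moreover have "xs = rotate (length xs - k) ?ys"
    using k rotate_append[of "drop k xs" "take k xs"] by simp
  moreover have "length xs - k < length xs" using \<open>k \<noteq> 0\<close> k by simp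
  ultimately show ?thesis by blast
qed

text \<open>A second good rotation would cut the word into two pieces, each a suffix of a good word;
  two positive integers cannot add up to 1.\<close>

lemma good_rotate_unique:
  assumes "sum_list (map y xs) = 1" "good y xs" "good y (rotate m xs)" "m < length xs"
  shows "m = 0"
proof (rule ccontr)
  assume "m \<noteq> 0"
  have "rotate m xs = drop m xs @ take m xs" using assms by (simp add: rotate_drop_take)
  then have "0 < sum_list (map y (take m xs))"
    using good_appendD[of y "drop m xs" "take m xs"] assms \<open>m \<noteq> 0\<close> by (cases xs) auto
  moreover have "0 < sum_list (map y (drop m xs))" using assms by (simp add: good_def)
  moreover have "sum_list (map y (take m xs)) + sum_list (map y (drop m xs)) = 1"
    using assms(1) by (metis append_take_drop_id map_append sum_list_append)
  ultimately show False by linarith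
qed

lemma sum_list_map_eq_sum: "xs \<in> permutations_of_set D \<Longrightarrow> sum_list (map y xs) = sum y D"
  by (auto simp: permutations_of_set_def sum_list_distinct_conv_sum_set)

lemma rotate_permutation: "xs \<in> permutations_of_set D \<Longrightarrow> rotate m xs \<in> permutations_of_set D"
  by (simp add: permutations_of_set_def)

text \<open>Every ordering is a rotation of exactly one good ordering by exactly one amount below
  \<open>card D\<close>, so the good ones make up a fraction \<open>1 / card D\<close> of
  all.\<close>

theorem cycle_lemma:
  fixes y :: "'b \<Rightarrow> int"
  assumes "finite D" "sum y D = 1"
  shows "card {xs \<in> permutations_of_set D. good y xs} = fact (card D - 1)"
proof -
  let ?G = "{xs \<in> permutations_of_set D. good y xs}" and ?n = "card D"
  have len: "length xs = ?n" if "xs \<in> permutations_of_set D" for xs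
    using that by (rule length_finite_permutations_of_set)
  have inj: "\<And>m m' xs xs'. m \<le> m' \<Longrightarrow> m' < ?n \<Longrightarrow> xs \<in> ?G \<Longrightarrow> xs' \<in> ?G \<Longrightarrow>
      rotate m xs = rotate m' xs' \<Longrightarrow> xs = xs' \<and> m = m'"
  proof -
    fix m m' xs xs' assume *: "m \<le> m'" "m' < ?n" "xs \<in> ?G" "xs' \<in> ?G" "rotate m xs = rotate m' xs'"
    then have "rotate m xs = rotate m (rotate (m' - m) xs')" by (simp add: rotate_rotate)
    moreover have "inj (rotate m)" unfolding rotate_def by (intro inj_fn inj_rotate1)
    ultimately have eq: "xs = rotate (m' - m) xs'" by (blast dest: injD)
    then have "m' - m = 0"
      using * assms len[of xs'] by (intro good_rotate_unique[of y xs']) (auto simp: sum_list_map_eq_sum)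
    then show "xs = xs' \<and> m = m'" using eq * by simp
  qed
  have "inj_on (\<lambda>(xs, m). rotate m xs) (?G \<times> {..<?n})"
  proof (rule inj_onI, clarify)
    fix xs m xs' m'
    assume "xs \<in> permutations_of_set D" "good y xs" "xs' \<in> permutations_of_set D" "good y xs'"
      "m < ?n" "m' < ?n" and eq: "rotate m xs = rotate m' xs'"
    then show "xs = xs' \<and> m = m'"
      using inj[of m m' xs xs'] inj[of m' m xs' xs] by (cases "m \<le> m'") auto
  qed
  moreover have "(\<lambda>(xs, m). rotate m xs) ` (?G \<times> {..<?n}) = permutations_of_set D"
  proof
    show "(\<lambda>(xs, m). rotate m xs) ` (?G \<times> {..<?n}) \<subseteq> permutations_of_set D"
      by (auto intro: rotate_permutation)
    show "permutations_of_set D \<subseteq> (\<lambda>(xs, m). rotate m xs) ` (?G \<times> {..<?n})"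
    proof
      fix xs assume xs: "xs \<in> permutations_of_set D"
      then obtain m ys where m: "m < length xs" "good y ys" "xs = rotate m ys"
        using good_rotate_exists[of y xs] assms by (auto simp: sum_list_map_eq_sum)
      then have "ys \<in> permutations_of_set D" using xs by (simp add: permutations_of_set_def)
      then show "xs \<in> (\<lambda>(xs, m). rotate m xs) ` (?G \<times> {..<?n})"
        using m len[OF xs] by (intro image_eqI[of _ _ "(ys, m)"]) auto
    qed
  qed
  ultimately have "card (?G \<times> {..<?n}) = card (permutations_of_set D)"
    using card_image by metis
  then have "card ?G * ?n = fact ?n" using assms by (simp add: card_cartesian_product)
  moreover have "D \<noteq> {}" using assms by auto
  then have "?n > 0" using assms by (simp add: card_gt_0_iff)
  then have "fact ?n = fact (?n - 1) * ?n" using fact_reduce[of ?n, where 'a = nat] by (simp add: mult.commute)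
  ultimately show ?thesis using \<open>?n > 0\<close> by simp
qed

section \<open>Maximal prefix sums\<close>

fun max_prefix :: "('b \<Rightarrow> int) \<Rightarrow> 'b list \<Rightarrow> int" where
  "max_prefix y [] = 0"
| "max_prefix y (x # xs) = max 0 (y x + max_prefix y xs)"

lemma max_prefix_nonneg: "0 \<le> max_prefix y xs"
  by (cases xs) auto

lemma max_prefix_cong: "(\<And>x. x \<in> set xs \<Longrightarrow> y x = z x) \<Longrightarrow> max_prefix y xs = max_prefix z xs"
  by (induction xs) auto

lemma max_prefix_mono: "(\<And>x. y x \<le> z x) \<Longrightarrow> max_prefix y xs \<le> max_prefix z xs"
proof (induction xs)
  case (Cons x xs)
  then have "y x \<le> z x" "max_prefix y xs \<le> max_prefix z xs" by auto
  then show ?case by simp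
qed simp

lemma max_prefix_append_le_iff:
  "max_prefix y (xs @ zs) \<le> c \<longleftrightarrow>
    (\<forall>k\<le>length xs. sum_list (map y (take k xs)) \<le> c) \<and> max_prefix y zs \<le> c - sum_list (map y xs)"
proof (induction xs arbitrary: c)
  case Nil
  then show ?case using max_prefix_nonneg[of y zs] by auto
next
  case (Cons x xs)
  have "(\<forall>k\<le>length (x # xs). sum_list (map y (take k (x # xs))) \<le> c) \<longleftrightarrow>
    0 \<le> c \<and> (\<forall>k\<le>length xs. y x + sum_list (map y (take k xs)) \<le> c)"
    by (simp add: less_Suc_eq_le[symmetric] All_less_Suc2)
  moreover have "max_prefix y ((x # xs) @ zs) \<le> c \<longleftrightarrow> 0 \<le> c \<and> max_prefix y (xs @ zs) \<le> c - y x"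
    by auto
  ultimately show ?case unfolding Cons.IH by (auto simp: algebra_simps)
qed

lemma max_prefix_le_iff:
  "max_prefix y xs \<le> c \<longleftrightarrow> (\<forall>k\<le>length xs. sum_list (map y (take k xs)) \<le> c)"
  using max_prefix_append_le_iff[of y xs "[]" c] by (auto simp: diff_le_eq dest: spec[of _ "length xs"])

text \<open>From every place before the end of \<open>xs\<close> the rest of \<open>xs\<close> still
  gains, so the maximum is not attained earlier.\<close>

lemma max_prefix_append_good:
  "good y xs \<Longrightarrow> max_prefix y (xs @ zs) = sum_list (map y xs) + max_prefix y zs"
proof (induction xs)
  case (Cons x xs)
  have "good y xs" using Cons.prems unfolding good_def by (auto dest: spec[of _ "Suc _"])
  moreover have "0 < y x + sum_list (map y xs)"
    using good_appendD[of y "[]" "x # xs"] Cons.prems by simp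
  ultimately show ?case using Cons.IH max_prefix_nonneg[of y zs] by simp
qed simp

lemma max_prefix_split:
  assumes "0 < max_prefix y xs"
  shows "\<exists>ys zs. xs = ys @ zs \<and> good y ys \<and> sum_list (map y ys) = max_prefix y xs"
proof -
  let ?m = "max_prefix y xs" and ?S = "\<lambda>k. sum_list (map y (take k xs))"
  have le: "?S k \<le> ?m" if "k \<le> length xs" for k
    using max_prefix_le_iff[of y xs ?m] that by simp
  have "\<not> max_prefix y xs \<le> ?m - 1" by simp
  then obtain k' where "k' \<le> length xs" "\<not> ?S k' \<le> ?m - 1" unfolding max_prefix_le_iff by blast
  then have k': "k' \<le> length xs \<and> ?S k' = ?m" using le[of k'] by simp
  define k where "k = (LEAST k. k \<le> length xs \<and> ?S k = ?m)"
  have k: "k \<le> length xs" "?S k = ?m"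
    unfolding k_def using LeastI[of "\<lambda>k. k \<le> length xs \<and> ?S k = ?m", OF k'] by auto
  have "good y (take k xs)" unfolding good_def
  proof (intro allI impI)
    fix l assume "l < length (take k xs)"
    then have l: "l < k" by simp
    have "?S l \<noteq> ?m"
      using not_less_Least[of l "\<lambda>k. k \<le> length xs \<and> ?S k = ?m"] l k unfolding k_def[symmetric] by auto
    then have "?S l < ?S k" using le[of l] l k by simp
    moreover have "take k xs = take l xs @ drop l (take k xs)"
      using l by (metis append_take_drop_id min_def less_imp_le take_take)
    then have "?S k = ?S l + sum_list (map y (drop l (take k xs)))"
      by (metis map_append sum_list_append)
    ultimately show "0 < sum_list (map y (drop l (take k xs)))" by simp
  qed
  then show ?thesis using k append_take_drop_id by metis
qed

text \<open>Otherwise one prefix extends the other by a nonempty piece, which would have sum 0 and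
  yet be a suffix of a good word.\<close>

lemma good_prefix_unique:
  assumes "good y xs" "good y xs'" "sum_list (map y xs) = sum_list (map y xs')" "xs @ zs = xs' @ zs'"
  shows "xs = xs'"
proof -
  have "us = []" if "good y (ys @ us)" "sum_list (map y (ys @ us)) = sum_list (map y ys)" for ys us
    using good_appendD[OF that(1)] that(2) by auto
  then show ?thesis using assms unfolding append_eq_append_conv2 by (metis append_Nil2)
qed

section \<open>Greedy sequences\<close>

text \<open>A chain of subsets adding one element at a time is recorded by the word \<open>\<beta>\<close> of the blocks
  of the added elements. \<open>nested_rank\<close> and \<open>unif_rank\<close> are the ranks along the chain in the Catalan
  matroid with block order \<open>xs\<close> and in the uniform matroid on the blocks in \<open>D\<close>; \<open>T\<close> will be the
  set of positions at which the rank increases.\<close>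

definition wt :: "(nat \<Rightarrow> 'b) \<Rightarrow> nat \<Rightarrow> nat \<Rightarrow> 'b \<Rightarrow> int" where
  "wt \<beta> b j x = int b - int (card {i. i < j \<and> \<beta> i = x})"

definition hits :: "(nat \<Rightarrow> 'b) \<Rightarrow> nat set \<Rightarrow> 'b set \<Rightarrow> nat \<Rightarrow> int" where
  "hits \<beta> T A j = int (card {i. i < j \<and> i \<in> T \<and> \<beta> i \<in> A})"

definition nested_rank :: "(nat \<Rightarrow> 'b) \<Rightarrow> nat \<Rightarrow> 'b list \<Rightarrow> nat \<Rightarrow> int" where
  "nested_rank \<beta> b xs j = int (b * length xs) - max_prefix (wt \<beta> b j) xs"

definition unif_rank :: "(nat \<Rightarrow> 'b) \<Rightarrow> nat \<Rightarrow> 'b set \<Rightarrow> nat \<Rightarrow> int" where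
  "unif_rank \<beta> b D j = int (b * card D) - max 0 (sum (wt \<beta> b j) D)"

context
  fixes \<beta> :: "nat \<Rightarrow> 'b" and b N :: nat
begin

private abbreviation "Y \<equiv> wt \<beta> b"
private abbreviation "R \<equiv> nested_rank \<beta> b"
private abbreviation "U \<equiv> unif_rank \<beta> b"

lemma wt_0 [simp]: "Y 0 x = int b"
  by (simp add: wt_def)

lemma wt_Suc: "Y (Suc j) x = Y j x - (if \<beta> j = x then 1 else 0)"
proof -
  have "{i. i < Suc j \<and> \<beta> i = x} = (if \<beta> j = x then insert j {i. i < j \<and> \<beta> i = x} else {i. i < j \<and> \<beta> i = x})"
    by (auto simp: less_Suc_eq)
  then show ?thesis by (simp add: wt_def)
qed

lemma wt_antimono: "i \<le> j \<Longrightarrow> Y j x \<le> Y i x"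
  by (induction rule: dec_induct) (auto simp: wt_Suc)

lemma sum_wt_Suc: "finite D \<Longrightarrow> sum (Y (Suc j)) D = sum (Y j) D - (if \<beta> j \<in> D then 1 else 0)"
  by (simp add: wt_Suc sum_subtractf)

lemma hits_0 [simp]: "hits \<beta> T A 0 = 0"
  by (simp add: hits_def)

lemma hits_Suc: "hits \<beta> T A (Suc j) = hits \<beta> T A j + (if j \<in> T \<and> \<beta> j \<in> A then 1 else 0)"
proof -
  have "{i. i < Suc j \<and> i \<in> T \<and> \<beta> i \<in> A} =
    (if j \<in> T \<and> \<beta> j \<in> A then insert j {i. i < j \<and> i \<in> T \<and> \<beta> i \<in> A} else {i. i < j \<and> i \<in> T \<and> \<beta> i \<in> A})"
    by (auto simp: less_Suc_eq)
  then show ?thesis by (simp add: hits_def)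
qed

lemma hits_Un:
  assumes "A \<inter> B = {}"
  shows "hits \<beta> T (A \<union> B) j = hits \<beta> T A j + hits \<beta> T B j"
  using assms by (induction j) (auto simp: hits_Suc)

lemma hits_const:
  assumes "\<And>i. t < i \<Longrightarrow> i < N \<Longrightarrow> i \<in> T \<Longrightarrow> \<beta> i \<notin> A" "t < j" "j \<le> N"
  shows "hits \<beta> T A j = hits \<beta> T A N"
  using assms(3,2)
proof (induction rule: inc_induct)
  case (step n)
  then show ?case using assms(1)[of n] by (auto simp: hits_Suc split: if_splits)
qed simp

lemma max_prefix_wt_0: "max_prefix (Y 0) xs = int (b * length xs)"
  by (induction xs) (auto simp: algebra_simps)

lemma nested_rank_0 [simp]: "R xs 0 = 0"
  by (simp add: nested_rank_def max_prefix_wt_0)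

lemma unif_rank_0 [simp]: "U D 0 = 0"
  by (simp add: unif_rank_def)

lemma max_prefix_wt_antimono: "i \<le> j \<Longrightarrow> max_prefix (Y j) xs \<le> max_prefix (Y i) xs"
  by (intro max_prefix_mono wt_antimono)

text \<open>One more chain element lowers the weight of a single block by one, and the block occurs
  at most once in \<open>xs\<close>.\<close>

lemma max_prefix_wt_Suc:
  assumes "distinct xs"
  shows "max_prefix (Y j) xs \<le> max_prefix (Y (Suc j)) xs + 1"
  unfolding max_prefix_le_iff
proof (intro allI impI)
  fix k assume k: "k \<le> length xs"
  have "sum_list (map (Y i) (take k xs)) = sum (Y i) (set (take k xs))" for i
    using assms by (simp add: sum_list_distinct_conv_sum_set)
  then have "sum_list (map (Y j) (take k xs)) \<le> sum_list (map (Y (Suc j)) (take k xs)) + 1"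
    by (simp add: sum_wt_Suc)
  also have "sum_list (map (Y (Suc j)) (take k xs)) \<le> max_prefix (Y (Suc j)) xs"
    using max_prefix_le_iff[of "Y (Suc j)" xs "max_prefix (Y (Suc j)) xs"] k by simp
  finally show "sum_list (map (Y j) (take k xs)) \<le> max_prefix (Y (Suc j)) xs + 1" by simp
qed

lemma nested_rank_Suc:
  assumes "distinct xs"
  shows "R xs (Suc j) = R xs j \<or> \<beta> j \<in> set xs \<and> R xs (Suc j) = R xs j + 1"
proof (cases "\<beta> j \<in> set xs")
  case True
  then show ?thesis
    using max_prefix_wt_Suc[OF assms, of j] max_prefix_wt_antimono[of j "Suc j" xs]
    unfolding nested_rank_def by auto
next
  case False
  then have "max_prefix (Y (Suc j)) xs = max_prefix (Y j) xs"
    by (intro max_prefix_cong) (auto simp: wt_Suc)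
  then show ?thesis by (simp add: nested_rank_def)
qed

lemma unif_rank_Suc:
  assumes "finite D"
  shows "U D (Suc j) = U D j \<or> \<beta> j \<in> D \<and> U D (Suc j) = U D j + 1"
  by (simp add: unif_rank_def sum_wt_Suc[OF assms] max_def)

lemma max_prefix_wt_nonpos: "(\<And>x. x \<in> set xs \<Longrightarrow> Y j x \<le> 0) \<Longrightarrow> max_prefix (Y j) xs = 0"
proof (induction xs)
  case (Cons x xs)
  then have "Y j x \<le> 0" "max_prefix (Y j) xs = 0" by auto
  then show ?case by simp
qed simp

text \<open>\<open>hits\<close> counts only positions whose block occurs in \<open>xs\<close>, so
  the same set \<open>T\<close> can be tested against complementary parts of the ground set.\<close>

definition nested_greedy :: "nat set \<Rightarrow> 'b list \<Rightarrow> bool" where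
  "nested_greedy T xs \<longleftrightarrow> (\<forall>j\<le>N. R xs j = hits \<beta> T (set xs) j)"

definition unif_greedy :: "nat set \<Rightarrow> 'b set \<Rightarrow> bool" where
  "unif_greedy T D \<longleftrightarrow> (\<forall>j\<le>N. U D j = hits \<beta> T D j)"

text \<open>Each summand can rise only at positions of its own blocks. As these are disjoint, the
  position tells which summand a rise of the total belongs to.\<close>

lemma direct_sum_greedy_iff:
  assumes "finite D" "distinct xs" "D \<inter> set xs = {}"
  shows "(\<forall>j\<le>N. U D j + R xs j = hits \<beta> T (D \<union> set xs) j) \<longleftrightarrow> unif_greedy T D \<and> nested_greedy T xs"
proof
  assume *: "\<forall>j\<le>N. U D j + R xs j = hits \<beta> T (D \<union> set xs) j"
  have "j \<le> N \<Longrightarrow> U D j = hits \<beta> T D j \<and> R xs j = hits \<beta> T (set xs) j" for j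
  proof (induction j)
    case (Suc j)
    have "U D (Suc j) + R xs (Suc j) = hits \<beta> T D (Suc j) + hits \<beta> T (set xs) (Suc j)"
      using * Suc.prems by (simp add: hits_Un[OF assms(3)])
    then show ?case
      using Suc assms(3) unif_rank_Suc[OF assms(1), of j] nested_rank_Suc[OF assms(2), of j]
      unfolding hits_Suc by (auto split: if_splits)
  qed simp
  then show "unif_greedy T D \<and> nested_greedy T xs" by (simp add: unif_greedy_def nested_greedy_def)
qed (simp add: unif_greedy_def nested_greedy_def hits_Un[OF assms(3)])

text \<open>As soon as one of the orders \<open>xs @ zs\<close> and \<open>zs\<close> is greedy, the
  ranks of \<open>xs @ zs\<close> are the sums of those of the uniform part and of
  \<open>zs\<close>. Up to \<open>t\<close> the word \<open>xs\<close> is good, so its weight adds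
  to the maximum of \<open>zs\<close>; after \<open>t\<close> all jumps are over and both maximal
  prefix sums are 0. \<open>direct_sum_greedy_iff\<close> then separates the parts.\<close>

lemma nested_greedy_append_iff:
  assumes xs: "xs \<in> permutations_of_set D" and zs: "zs \<in> permutations_of_set (A - D)"
    and D: "D \<subseteq> A" "finite A" and t: "t < N" "\<beta> t \<in> D"
    and last: "\<And>i. t < i \<Longrightarrow> i < N \<Longrightarrow> i \<in> T \<Longrightarrow> \<beta> i \<notin> A"
    and full: "\<And>x. x \<in> A \<Longrightarrow> Y N x \<le> 0"
    and one: "sum (Y t) D = 1" and good: "good (Y t) xs"
  shows "nested_greedy T (xs @ zs) \<longleftrightarrow> unif_greedy T D \<and> nested_greedy T zs"
proof -
  have set: "set xs = D" "distinct xs" "set zs = A - D" "distinct zs"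
    using xs zs by (auto simp: permutations_of_set_def)
  have fin: "finite D" using D finite_subset by auto
  have sum: "sum_list (map (Y j) xs) = sum (Y j) D" for j
    using xs by (rule sum_list_map_eq_sum)
  have len: "length xs = card D" using xs by (rule length_finite_permutations_of_set)
  have one_Suc: "sum (Y (Suc t)) D = 0" using one t fin by (simp add: sum_wt_Suc)
  have late_sum: "sum (Y j) D \<le> 0" if "t < j" for j
    using sum_mono[of D "Y j" "Y (Suc t)"] wt_antimono[of "Suc t" j] that one_Suc by auto
  have early: "max_prefix (Y j) (xs @ zs) = max 0 (sum (Y j) D) + max_prefix (Y j) zs" if "j \<le> t" for j
  proof -
    have "good (Y j) xs" using good wt_antimono[OF that] by (rule good_antimono)
    moreover have "1 \<le> sum (Y j) D"
      using sum_mono[of D "Y t" "Y j"] wt_antimono[OF that] one by auto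
    ultimately show ?thesis by (simp add: max_prefix_append_good sum)
  qed
  \<comment> \<open>No jump follows \<open>t\<close>, so the rank there is already the rank at
    \<open>N\<close>, where all weights are nonpositive.\<close>
  have greedy_late: "max_prefix (Y j) ys = 0" if "nested_greedy T ys" "set ys \<subseteq> A" "t < j" "j \<le> N" for ys j
  proof -
    have "hits \<beta> T (set ys) j = hits \<beta> T (set ys) N"
      using last that by (intro hits_const[of t]) auto
    then have "R ys j = R ys N" using that by (simp add: nested_greedy_def)
    moreover have "max_prefix (Y N) ys = 0" using that full by (intro max_prefix_wt_nonpos) auto
    ultimately show ?thesis by (simp add: nested_rank_def)
  qed
  have late: "max_prefix (Y j) (xs @ zs) = max_prefix (Y j) zs"
    if "nested_greedy T (xs @ zs) \<or> nested_greedy T zs" "t < j" "j \<le> N" for j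
    using that(1)
  proof
    assume g: "nested_greedy T (xs @ zs)"
    have 0: "max_prefix (Y i) (xs @ zs) = 0" if "t < i" "i \<le> N" for i
      using greedy_late[OF g] that set D by auto
    have "max_prefix (Y (Suc t)) zs \<le> 0"
      using max_prefix_append_le_iff[of "Y (Suc t)" xs zs 0] 0[of "Suc t"] t by (simp add: sum one_Suc)
    then have "max_prefix (Y j) zs \<le> 0"
      using max_prefix_wt_antimono[of "Suc t" j zs] that by simp
    then show ?thesis using 0 that max_prefix_nonneg[of "Y j" zs] by simp
  next
    assume g: "nested_greedy T zs"
    have 0: "max_prefix (Y i) zs = 0" if "t < i" "i \<le> N" for i
      using greedy_late[OF g] that set by auto
    have "max_prefix (Y (Suc t)) (xs @ zs) \<le> 0"
      unfolding max_prefix_append_le_iff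
    proof (intro conjI allI impI)
      fix k assume k: "k \<le> length xs"
      show "sum_list (map (Y (Suc t)) (take k xs)) \<le> 0"
      proof (cases "k = length xs")
        case True
        then show ?thesis by (simp add: sum one_Suc)
      next
        case False
        \<comment> \<open>The complementary suffix has weight at least 1 and the total weight of
          \<open>xs\<close> is 1, so a proper prefix of \<open>xs\<close> has weight at most
          0.\<close>
        then have "0 < sum_list (map (Y t) (drop k xs))" using good k by (simp add: good_def)
        moreover have "sum_list (map (Y t) (take k xs)) + sum_list (map (Y t) (drop k xs)) = 1"
          using sum[of t] one by (metis append_take_drop_id map_append sum_list_append)
        moreover have "sum_list (map (Y (Suc t)) (take k xs)) \<le> sum_list (map (Y t) (take k xs))"
          by (intro sum_list_mono wt_antimono) simp
        ultimately show ?thesis by linarith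
      qed
    qed (use 0 t in \<open>simp add: sum one_Suc\<close>)
    then have "max_prefix (Y j) (xs @ zs) \<le> 0"
      using max_prefix_wt_antimono[of "Suc t" j "xs @ zs"] that by simp
    then show ?thesis using 0 that max_prefix_nonneg[of "Y j" "xs @ zs"] by simp
  qed
  have "R (xs @ zs) j = U D j + R zs j"
    if "nested_greedy T (xs @ zs) \<or> nested_greedy T zs" "j \<le> N" for j
    using early[of j] late[OF that(1), of j] late_sum[of j] that(2)
    by (cases "j \<le> t") (auto simp: nested_rank_def unif_rank_def len algebra_simps)
  then have "nested_greedy T (xs @ zs) \<longleftrightarrow> (\<forall>j\<le>N. U D j + R zs j = hits \<beta> T (D \<union> set zs) j)"
    if "nested_greedy T (xs @ zs) \<or> nested_greedy T zs"
    using that set by (simp add: nested_greedy_def)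
  then show ?thesis
    using direct_sum_greedy_iff[OF fin, of zs T] set by auto
qed

definition num_greedy :: "nat set \<Rightarrow> 'b set \<Rightarrow> nat" where
  "num_greedy T A = card {xs \<in> permutations_of_set A. nested_greedy T xs}"

text \<open>The rank rises for the last time at \<open>t\<close>, so the maximal prefix sum drops
  from 1 to 0 there: the segment up to the first maximum has weight 1 and must contain the block
  \<beta> t in order to lose it. The summands are disjoint because a good prefix of given weight is
  unique.\<close>

lemma num_greedy_rec:
  assumes A: "finite A" and t: "t < N" "t \<in> T" "\<beta> t \<in> A"
    and last: "\<And>i. t < i \<Longrightarrow> i < N \<Longrightarrow> i \<in> T \<Longrightarrow> \<beta> i \<notin> A"
    and full: "\<And>x. x \<in> A \<Longrightarrow> Y N x \<le> 0"
  shows "num_greedy T A = (\<Sum>D | D \<subseteq> A \<and> \<beta> t \<in> D \<and> unif_greedy T D.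
    fact (card D - 1) * num_greedy T (A - D))"
proof -
  let ?P = "\<lambda>A. {xs \<in> permutations_of_set A. nested_greedy T xs}"
  let ?G = "\<lambda>D. {xs \<in> permutations_of_set D. good (Y t) xs}"
  let ?I = "{D. D \<subseteq> A \<and> \<beta> t \<in> D \<and> unif_greedy T D}"
  let ?S = "\<lambda>D. (\<lambda>(xs, zs). xs @ zs) ` (?G D \<times> ?P (A - D))"
  \<comment> \<open>Conversely, each uniform part compatible with \<open>T\<close> has the weight
    required by the cycle lemma: its last rise takes the truncated weight from 1 to 0.\<close>
  have one: "sum (Y t) D = 1" if "D \<in> ?I" for D
  proof -
    have D: "D \<subseteq> A" "\<beta> t \<in> D" "unif_greedy T D" "finite D" using that A finite_subset by auto
    have "hits \<beta> T D (Suc t) = hits \<beta> T D N" using D last t by (intro hits_const[of t]) auto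
    then have "U D (Suc t) = U D N" "U D (Suc t) = U D t + 1"
      using D t by (auto simp: unif_greedy_def hits_Suc)
    moreover have "sum (Y N) D \<le> 0" using D full by (intro sum_nonpos) auto
    ultimately show ?thesis by (simp add: unif_rank_def)
  qed
  have "?P A = (\<Union>D\<in>?I. ?S D)"
  proof (intro subset_antisym subsetI)
    fix ys assume ys: "ys \<in> ?P A"
    then have set: "set ys = A" "distinct ys" by (auto simp: permutations_of_set_def)
    have "hits \<beta> T A (Suc t) = hits \<beta> T A N" using last t by (intro hits_const[of t]) auto
    then have "R ys (Suc t) = R ys N" "R ys (Suc t) = R ys t + 1"
      using ys t set by (auto simp: nested_greedy_def hits_Suc)
    moreover have "max_prefix (Y N) ys = 0" using full set by (intro max_prefix_wt_nonpos) auto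
    ultimately have m: "max_prefix (Y t) ys = 1" "max_prefix (Y (Suc t)) ys = 0"
      by (simp_all add: nested_rank_def)
    then obtain xs zs where split: "ys = xs @ zs" "good (Y t) xs" "sum_list (map (Y t) xs) = 1"
      using max_prefix_split[of "Y t" ys] by auto
    let ?D = "set xs"
    have perm: "xs \<in> permutations_of_set ?D" "zs \<in> permutations_of_set (A - ?D)" "?D \<subseteq> A"
      using split set by (auto simp: permutations_of_set_def)
    have s: "sum (Y t) ?D = 1" using split perm by (simp add: sum_list_map_eq_sum)
    have "sum_list (map (Y (Suc t)) xs) \<le> 0"
      using max_prefix_append_le_iff[of "Y (Suc t)" xs zs 0] m split by (auto dest: spec[of _ "length xs"])
    then have "sum (Y (Suc t)) ?D \<le> 0" using perm by (simp add: sum_list_map_eq_sum)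
    then have tD: "\<beta> t \<in> ?D" using s by (auto simp: sum_wt_Suc split: if_splits)
    have "unif_greedy T ?D \<and> nested_greedy T zs"
      using nested_greedy_append_iff[OF perm A t(1) tD last full s split(2)] ys split by simp
    then have "?D \<in> ?I" "(xs, zs) \<in> ?G ?D \<times> ?P (A - ?D)" using perm split tD by simp_all
    then show "ys \<in> (\<Union>D\<in>?I. ?S D)"
      unfolding split(1) by (intro UN_I[of ?D] image_eqI[of _ _ "(xs, zs)"]) simp_all
  next
    fix ys assume "ys \<in> (\<Union>D\<in>?I. ?S D)"
    then obtain D xs zs where D: "D \<in> ?I" and *: "xs \<in> ?G D" "zs \<in> ?P (A - D)" "ys = xs @ zs" by auto
    have "nested_greedy T (xs @ zs)"
      using nested_greedy_append_iff[OF _ _ _ A t(1) _ last full one[OF D], of xs zs] D * by auto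
    moreover have "xs @ zs \<in> permutations_of_set A"
      using D * by (auto simp: permutations_of_set_def)
    ultimately show "ys \<in> ?P A" using * by simp
  qed
  moreover have "card (\<Union>D\<in>?I. ?S D) = (\<Sum>D\<in>?I. card (?S D))"
  proof (rule card_UN_disjoint)
    show "finite ?I" using A by simp
    show "\<forall>D\<in>?I. finite (?S D)" by auto
    show "\<forall>D\<in>?I. \<forall>D'\<in>?I. D \<noteq> D' \<longrightarrow> ?S D \<inter> ?S D' = {}"
    proof (intro ballI impI, rule ccontr)
      fix D D' assume D: "D \<in> ?I" "D' \<in> ?I" "D \<noteq> D'" "?S D \<inter> ?S D' \<noteq> {}"
      then obtain xs zs xs' zs' where *: "xs \<in> ?G D" "xs' \<in> ?G D'" "xs @ zs = xs' @ zs'" by auto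
      then have "sum_list (map (Y t) xs) = 1" "sum_list (map (Y t) xs') = 1"
        using one D by (auto simp: sum_list_map_eq_sum)
      then have "xs = xs'" using good_prefix_unique[of "Y t" xs xs' zs zs'] * by simp
      then show False using * D by (auto simp: permutations_of_set_def)
    qed
  qed
  moreover have "card (?S D) = fact (card D - 1) * num_greedy T (A - D)" if D: "D \<in> ?I" for D
  proof -
    have "inj_on (\<lambda>(xs, zs). xs @ zs) (?G D \<times> ?P (A - D))"
      by (auto simp: inj_on_def dest!: length_finite_permutations_of_set)
    moreover have "finite D" using D A finite_subset by auto
    ultimately show ?thesis
      using cycle_lemma[OF _ one[OF D]] by (simp add: card_image card_cartesian_product num_greedy_def)
  qed
  ultimately show ?thesis by (simp add: num_greedy_def)
qed

text \<open>This frees \<open>num_greedy_rec\<close> from the distinguished block \<beta> t. Write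
  \<open>card A = card D + card (A - D)\<close>: the first summand turns
  \<open>fact (card D - 1)\<close> into \<open>fact (card D)\<close> for the sets \<open>D\<close>
  containing \<beta> t, and induction on \<open>A - D\<close> supplies the sets \<open>D'\<close>
  that avoid it.\<close>

lemma num_greedy_marked:
  assumes "finite A" and full: "\<And>x. x \<in> A \<Longrightarrow> Y N x \<le> 0" and "0 < b"
  shows "card A * num_greedy T A = (\<Sum>D | D \<subseteq> A \<and> D \<noteq> {} \<and> unif_greedy T D.
    fact (card D) * num_greedy T (A - D))"
  using assms(1,2)
proof (induction A rule: finite_psubset_induct)
  case (psubset A)
  note A = psubset.hyps and full = psubset.prems
  show ?case
  proof (cases "\<exists>i<N. i \<in> T \<and> \<beta> i \<in> A")
    \<comment> \<open>Without a jump among the blocks of \<open>A\<close> the rank stays 0, whereas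
      the final rank of a nonempty set of blocks is \<open>b\<close> times their number.\<close>
    case False
    have 0: "hits \<beta> T D N = 0" if "D \<subseteq> A" for D
      using False that by (auto simp: hits_def)
    have "\<not> unif_greedy T D" if D: "D \<subseteq> A" "D \<noteq> {}" for D
    proof
      assume "unif_greedy T D"
      then have "U D N = 0" using 0 D by (simp add: unif_greedy_def)
      moreover have "sum (Y N) D \<le> 0" using D full by (intro sum_nonpos) auto
      moreover have "0 < card D" using D A finite_subset by (auto simp: card_gt_0_iff)
      ultimately show False using \<open>0 < b\<close> by (simp add: unif_rank_def)
    qed
    then have none: "{D. D \<subseteq> A \<and> D \<noteq> {} \<and> unif_greedy T D} = {}" by auto
    have "num_greedy T A = 0" if "A \<noteq> {}"
    proof -
      have "\<not> nested_greedy T xs" if xs: "xs \<in> permutations_of_set A" for xs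
      proof
        assume "nested_greedy T xs"
        moreover have "set xs = A" using xs by (auto simp: permutations_of_set_def)
        ultimately have "R xs N = 0" "max_prefix (Y N) xs = 0"
          using 0 full by (auto simp: nested_greedy_def intro: max_prefix_wt_nonpos)
        then show False using \<open>0 < b\<close> \<open>A \<noteq> {}\<close> \<open>set xs = A\<close> by (simp add: nested_rank_def)
      qed
      then show ?thesis by (simp add: num_greedy_def)
    qed
    then show ?thesis unfolding none by (cases "A = {}") auto
  next
    case True
    define t where "t = Max {i. i < N \<and> i \<in> T \<and> \<beta> i \<in> A}"
    have fin: "finite {i. i < N \<and> i \<in> T \<and> \<beta> i \<in> A}" by simp
    have "t \<in> {i. i < N \<and> i \<in> T \<and> \<beta> i \<in> A}"
      unfolding t_def by (rule Max_in[OF fin]) (use True in auto)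
    then have t: "t < N" "t \<in> T" "\<beta> t \<in> A" by auto
    have last: "\<beta> i \<notin> A" if "t < i" "i < N" "i \<in> T" for i
    proof
      assume "\<beta> i \<in> A"
      then have "i \<le> t" unfolding t_def using that by (intro Max_ge[OF fin]) auto
      then show False using that by simp
    qed
    let ?e = "\<beta> t"
    let ?V = "\<lambda>A. {D. D \<subseteq> A \<and> ?e \<in> D \<and> unif_greedy T D}"
    let ?W = "\<lambda>A. {D. D \<subseteq> A \<and> D \<noteq> {} \<and> unif_greedy T D}"
    let ?c = "\<lambda>D. fact (card D - 1) :: nat"
    have rec: "num_greedy T B = (\<Sum>D\<in>?V B. ?c D * num_greedy T (B - D))" if "B \<subseteq> A" "?e \<in> B" for B
      using that A last full t finite_subset by (intro num_greedy_rec) auto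
    have card: "card A = card D + card (A - D)" if "D \<subseteq> A" for D
      using that A card_mono finite_subset by (metis card_Diff_subset le_add_diff_inverse)
    have fact: "?c D * card D = fact (card D)" if "D \<in> ?V A" for D
    proof -
      have "0 < card D" using that A finite_subset by (auto simp: card_gt_0_iff)
      then show ?thesis using fact_reduce[of "card D", where 'a = nat] by (simp add: mult.commute)
    qed
    have "card A * num_greedy T A = (\<Sum>D\<in>?V A. card A * (?c D * num_greedy T (A - D)))"
      using rec[OF subset_refl t(3)] by (simp add: sum_distrib_left)
    also have "\<dots> = (\<Sum>D\<in>?V A. fact (card D) * num_greedy T (A - D) +
        (\<Sum>D'\<in>?W (A - D). ?c D * (fact (card D') * num_greedy T (A - D - D'))))"
    proof (rule sum.cong[OF refl])
      fix D assume D: "D \<in> ?V A"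
      then have "card (A - D) * num_greedy T (A - D) = (\<Sum>D'\<in>?W (A - D). fact (card D') * num_greedy T (A - D - D'))"
        using t by (intro psubset.IH full) auto
      then have "?c D * (card (A - D) * num_greedy T (A - D)) =
          (\<Sum>D'\<in>?W (A - D). ?c D * (fact (card D') * num_greedy T (A - D - D')))"
        by (simp add: sum_distrib_left)
      moreover have "card A * (?c D * num_greedy T (A - D)) =
          (?c D * card D) * num_greedy T (A - D) + ?c D * (card (A - D) * num_greedy T (A - D))"
        using D card[of D] by (simp add: algebra_simps)
      ultimately show "card A * (?c D * num_greedy T (A - D)) = fact (card D) * num_greedy T (A - D) +
          (\<Sum>D'\<in>?W (A - D). ?c D * (fact (card D') * num_greedy T (A - D - D')))"
        using fact[OF D] by simp
    qed
    also have "\<dots> = (\<Sum>D\<in>?V A. fact (card D) * num_greedy T (A - D)) +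
        (\<Sum>D\<in>?V A. \<Sum>D' | D' \<in> ?W A - ?V A \<and> D' \<inter> D = {}. ?c D * (fact (card D') * num_greedy T (A - D - D')))"
    proof -
      have "?W (A - D) = {D'. D' \<in> ?W A - ?V A \<and> D' \<inter> D = {}}" if "D \<in> ?V A" for D
        using that by auto
      then show ?thesis by (simp add: sum.distrib)
    qed
    also have "(\<Sum>D\<in>?V A. \<Sum>D' | D' \<in> ?W A - ?V A \<and> D' \<inter> D = {}. ?c D * (fact (card D') * num_greedy T (A - D - D'))) =
        (\<Sum>D'\<in>?W A - ?V A. \<Sum>D | D \<in> ?V A \<and> D' \<inter> D = {}. ?c D * (fact (card D') * num_greedy T (A - D - D')))"
      using A by (intro sum.swap_restrict) auto
    \<comment> \<open>Since \<open>D'\<close> avoids \<beta> t, the position \<open>t\<close> is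
      still the last jump within \<open>A - D'\<close>, and the sum over \<open>D\<close> is the
      recursion for \<open>num_greedy T (A - D')\<close>.\<close>
    also have "\<dots> = (\<Sum>D'\<in>?W A - ?V A. fact (card D') * num_greedy T (A - D'))"
    proof (rule sum.cong[OF refl])
      fix D' assume D': "D' \<in> ?W A - ?V A"
      have "{D. D \<in> ?V A \<and> D' \<inter> D = {}} = ?V (A - D')" by auto
      moreover have "A - D - D' = A - D' - D" for D by auto
      ultimately have "(\<Sum>D | D \<in> ?V A \<and> D' \<inter> D = {}. ?c D * (fact (card D') * num_greedy T (A - D - D'))) =
          fact (card D') * (\<Sum>D\<in>?V (A - D'). ?c D * num_greedy T (A - D' - D))"
        by (simp add: sum_distrib_left mult.left_commute)
      also have "\<dots> = fact (card D') * num_greedy T (A - D')"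
        using rec[of "A - D'"] D' t by auto
      finally show "(\<Sum>D | D \<in> ?V A \<and> D' \<inter> D = {}. ?c D * (fact (card D') * num_greedy T (A - D - D'))) =
          fact (card D') * num_greedy T (A - D')" .
    qed
    also have "(\<Sum>D\<in>?V A. fact (card D) * num_greedy T (A - D)) +
        (\<Sum>D'\<in>?W A - ?V A. fact (card D') * num_greedy T (A - D')) = (\<Sum>D\<in>?W A. fact (card D) * num_greedy T (A - D))"
      using A by (subst add.commute, intro sum.subset_diff[symmetric]) auto
    finally show ?thesis .
  qed
qed

end

section \<open>Schubert, Catalan and uniform matroids\<close>

lemma card_nth_le:
  assumes "finite S"
  shows "card (S \<inter> {..j}) = card {i. i < card S \<and> sorted_list_of_set S ! i \<le> j}"
proof -
  let ?xs = "sorted_list_of_set S"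
  have xs: "distinct ?xs" "set ?xs = S" "length ?xs = card S" using assms by auto
  have "inj_on ((!) ?xs) {i. i < card S \<and> ?xs ! i \<le> j}"
    using xs by (intro inj_on_nth) auto
  moreover have "(!) ?xs ` {i. i < card S \<and> ?xs ! i \<le> j} = S \<inter> {..j}"
    using xs(2,3) by (auto simp: set_conv_nth image_iff)
  ultimately show ?thesis by (metis card_image)
qed

text \<open>Exchanging one element for another changes a counting function by at most one at each
  place, whereas it shifts order statistics; the exchange axiom is therefore checked on
  counts.\<close>

lemma sorted_list_of_set_le_iff:
  assumes "finite S" "finite T" "card T = card S"
  shows "(\<forall>i<card S. sorted_list_of_set T ! i \<le> sorted_list_of_set S ! i) \<longleftrightarrow>
    (\<forall>j. card (S \<inter> {..j}) \<le> card (T \<inter> {..j}))"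
proof (intro iffI allI impI)
  fix j assume le: "\<forall>i<card S. sorted_list_of_set T ! i \<le> sorted_list_of_set S ! i"
  show "card (S \<inter> {..j}) \<le> card (T \<inter> {..j})"
    unfolding card_nth_le[OF assms(1)] card_nth_le[OF assms(2)] assms(3)
    using le by (intro card_mono) (auto intro: order.trans)
next
  fix i assume le: "\<forall>j. card (S \<inter> {..j}) \<le> card (T \<inter> {..j})" and i: "i < card S"
  show "sorted_list_of_set T ! i \<le> sorted_list_of_set S ! i"
  proof (rule ccontr)
    let ?j = "sorted_list_of_set S ! i"
    assume "\<not> ?thesis"
    then have "{k. k < card S \<and> sorted_list_of_set T ! k \<le> ?j} \<subseteq> {..<i}"
      using assms sorted_nth_mono[OF sorted_sorted_list_of_set, of i _ T]
      by (force simp: not_le[symmetric])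
    then have "card (T \<inter> {..?j}) \<le> i"
      using card_mono[of "{..<i}"] unfolding card_nth_le[OF assms(2)] assms(3) by fastforce
    moreover have "{..i} \<subseteq> {k. k < card S \<and> sorted_list_of_set S ! k \<le> ?j}"
      using i assms(1) sorted_nth_mono[OF sorted_sorted_list_of_set, of _ i S] by auto
    then have "Suc i \<le> card (S \<inter> {..?j})"
      using card_mono[of "{k. k < card S \<and> sorted_list_of_set S ! k \<le> ?j}" "{..i}"]
      unfolding card_nth_le[OF assms(1)] by simp
    ultimately show False using le[rule_format, of ?j] by simp
  qed
qed

lemma bases_schubert_matroid:
  assumes "S \<subseteq> {1..N}"
  shows "bases (schubert_matroid N S) =
    {T. T \<subseteq> {1..N} \<and> card T = card S \<and> (\<forall>j. card (S \<inter> {..j}) \<le> card (T \<inter> {..j}))}"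
  using sorted_list_of_set_le_iff[of S] assms finite_subset[of _ "{1..N}"]
  unfolding schubert_matroid_def by auto

text \<open>Take the first \<open>j\<close> from \<open>x\<close> on at which the counts of
  \<open>A\<close> and \<open>S\<close> agree. Between \<open>x\<close> and \<open>j\<close> there
  is slack for removing \<open>x\<close>, and a new element \<open>y\<close> at or below
  \<open>j\<close> restores the count from \<open>j\<close> on. Such a \<open>y\<close> exists in
  \<open>B - A\<close>, for otherwise \<open>B\<close> would have too few elements up to
  \<open>j\<close>.\<close>

lemma is_matroid_schubert:
  assumes S: "S \<subseteq> {1..N}"
  shows "is_matroid (schubert_matroid N S)"
proof -
  note bases = bases_schubert_matroid[OF S]
  have ground: "ground (schubert_matroid N S) = {1..N}" by (simp add: schubert_matroid_def)
  have "\<exists>y\<in>B - A. insert y (A - {x}) \<in> bases (schubert_matroid N S)"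
    if A: "A \<in> bases (schubert_matroid N S)" and B: "B \<in> bases (schubert_matroid N S)" and x: "x \<in> A - B" for A B x
  proof -
    have A': "A \<subseteq> {1..N}" "card A = card S" "\<And>j. card (S \<inter> {..j}) \<le> card (A \<inter> {..j})"
      using A by (auto simp: bases)
    have B': "B \<subseteq> {1..N}" "card B = card S" "\<And>j. card (S \<inter> {..j}) \<le> card (B \<inter> {..j})"
      using B by (auto simp: bases)
    have fin: "finite A" "finite B" using A' B' finite_subset by blast+
    have "A \<inter> {..N} = A" "S \<inter> {..N} = S" using A'(1) S by auto
    then have "x \<le> N \<and> card (A \<inter> {..N}) = card (S \<inter> {..N})" using A' x by auto
    then obtain j where j: "x \<le> j" "card (A \<inter> {..j}) = card (S \<inter> {..j})"
      and least: "\<And>i. i < j \<Longrightarrow> x \<le> i \<Longrightarrow> card (A \<inter> {..i}) \<noteq> card (S \<inter> {..i})"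
      using exists_least_iff[of "\<lambda>j. x \<le> j \<and> card (A \<inter> {..j}) = card (S \<inter> {..j})"] by blast
    have "\<not> B \<inter> {..j} \<subseteq> A \<inter> {..j} - {x}"
    proof
      assume "B \<inter> {..j} \<subseteq> A \<inter> {..j} - {x}"
      then have "card (B \<inter> {..j}) \<le> card (A \<inter> {..j} - {x})" using fin by (intro card_mono) auto
      also have "\<dots> < card (A \<inter> {..j})" using fin x j by (intro card_Diff1_less) auto
      finally show False using j B'(3)[of j] by simp
    qed
    then obtain y where y: "y \<in> B - A" "y \<le> j" using x by auto
    have card: "card (insert y (A - {x})) = card A"
      using x y fin card.remove[of A x] by simp
    have "card (S \<inter> {..i}) \<le> card (insert y (A - {x}) \<inter> {..i})" for i
    proof -
      consider "i < x" | "x \<le> i" "i < j" | "j \<le> i" by linarith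
      then show ?thesis
      proof cases
        case 1
        then have "card (A \<inter> {..i}) \<le> card (insert y (A - {x}) \<inter> {..i})"
          using fin by (intro card_mono) auto
        then show ?thesis using A'(3)[of i] by linarith
      next
        case 2
        then have "card (S \<inter> {..i}) < card (A \<inter> {..i})" using least[of i] A'(3)[of i] by simp
        moreover have "card (A \<inter> {..i} - {x}) \<le> card (insert y (A - {x}) \<inter> {..i})"
          using fin by (intro card_mono) auto
        moreover have "card (A \<inter> {..i}) = Suc (card (A \<inter> {..i} - {x}))"
          using 2 x fin by (intro card.remove) auto
        ultimately show ?thesis by linarith
      next
        case 3
        then have "insert y (A - {x}) \<inter> {..i} = insert y (A \<inter> {..i} - {x})" using y by auto
        moreover have "card (A \<inter> {..i}) = Suc (card (A \<inter> {..i} - {x}))"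
          using 3 j x fin by (intro card.remove) auto
        ultimately have "card (insert y (A - {x}) \<inter> {..i}) = card (A \<inter> {..i})"
          using y fin by simp
        then show ?thesis using A'(3)[of i] by simp
      qed
    qed
    then have "insert y (A - {x}) \<in> bases (schubert_matroid N S)"
      using A' B' y card by (auto simp: bases)
    then show ?thesis using y by blast
  qed
  moreover have "S \<in> bases (schubert_matroid N S)" using S by (simp add: bases)
  ultimately show ?thesis unfolding is_matroid_def ground by (auto simp: bases)
qed

section \<open>Block coordinates for the Catalan matroid\<close>

definition position :: "nat \<Rightarrow> nat \<times> nat \<Rightarrow> nat" where
  "position c p = fst p * c + snd p + 1"

lemma position_le_iff:
  assumes "snd p < c"
  shows "position c p \<le> k * c \<longleftrightarrow> fst p < k"
proof
  assume "position c p \<le> k * c"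
  then have "fst p * c < k * c" unfolding position_def by linarith
  then show "fst p < k" by simp
next
  assume "fst p < k"
  then have "Suc (fst p) * c \<le> k * c" by (intro mult_le_mono1) auto
  then show "position c p \<le> k * c" using assms by (simp add: position_def)
qed

lemma inj_on_position: "inj_on (position c) ({..<n} \<times> {..<c})"
proof (rule inj_onI)
  fix p q assume pq: "p \<in> {..<n} \<times> {..<c}" "q \<in> {..<n} \<times> {..<c}" "position c p = position c q"
  then have "(fst p * c + snd p) div c = (fst q * c + snd q) div c" "(fst p * c + snd p) mod c = (fst q * c + snd q) mod c"
    by (simp_all add: position_def)
  then show "p = q" using pq by (auto simp: prod_eq_iff)
qed

lemma position_image: "position c ` ({..<n} \<times> {..<c}) = {1..n * c}"
proof -
  have "position c ` ({..<n} \<times> {..<c}) \<subseteq> {1..n * c}"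
    using position_le_iff[of _ c n] by (auto simp: position_def)
  moreover have "card (position c ` ({..<n} \<times> {..<c})) = card {1..n * c}"
    using inj_on_position by (simp add: card_image card_cartesian_product)
  ultimately show ?thesis by (intro card_subset_eq) auto
qed

lemma nth_catalan_word:
  assumes "q < n" "s < a + b"
  shows "catalan_word a b n ! (q * (a + b) + s) = (if s < a then 0 else 1)"
  using assms(1)
proof (induction n arbitrary: q)
  case (Suc n)
  have word: "catalan_word a b (Suc n) = (replicate a 0 @ replicate b 1) @ catalan_word a b n"
    by (simp add: catalan_word_def)
  show ?case
  proof (cases q)
    case 0
    moreover have "s - a < b" if "\<not> s < a" using assms(2) that by linarith
    ultimately show ?thesis using assms(2) unfolding word by (simp add: nth_append)
  next
    case (Suc q')
    then have "catalan_word a b (Suc n) ! (q * (a + b) + s) = catalan_word a b n ! (q' * (a + b) + s)"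
      unfolding word nth_append by (simp add: algebra_simps)
    then show ?thesis using Suc.IH[of q'] Suc.prems Suc by simp
  qed
qed simp

definition catalan_set :: "nat \<Rightarrow> nat \<Rightarrow> nat \<Rightarrow> nat set" where
  "catalan_set a b n = position (a + b) ` ({..<n} \<times> {a..<a + b})"

lemma catalan_matroid_eq: "catalan_matroid a b n = schubert_matroid (n * (a + b)) (catalan_set a b n)"
proof -
  let ?c = "a + b"
  have "i \<in> catalan_set a b n \<longleftrightarrow> catalan_word a b n ! (i - 1) = 1" if "i \<in> {1..n * ?c}" for i
  proof -
    obtain q s where qs: "q < n" "s < ?c" "i = position ?c (q, s)"
      using \<open>i \<in> {1..n * ?c}\<close> unfolding position_image[symmetric] by auto
    have "i \<in> catalan_set a b n \<longleftrightarrow> a \<le> s"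
    proof
      assume "i \<in> catalan_set a b n"
      then obtain p where p: "p \<in> {..<n} \<times> {a..<a + b}" "position ?c p = position ?c (q, s)"
        using qs by (auto simp: catalan_set_def)
      then have "p = (q, s)" using qs by (intro inj_onD[OF inj_on_position[of ?c n]]) auto
      then show "a \<le> s" using p by auto
    next
      assume "a \<le> s"
      then show "i \<in> catalan_set a b n" using qs unfolding catalan_set_def by auto
    qed
    moreover have "i - 1 = q * ?c + s" using qs by (simp add: position_def)
    ultimately show ?thesis using nth_catalan_word[OF qs(1,2)] by simp
  qed
  moreover have "catalan_set a b n \<subseteq> {1..n * ?c}"
    unfolding position_image[symmetric] catalan_set_def by auto
  ultimately have "{i \<in> {1..n * ?c}. catalan_word a b n ! (i - 1) = 1} = catalan_set a b n" by auto
  then show ?thesis by (simp add: catalan_matroid_def)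
qed

lemma catalan_set_subset: "catalan_set a b n \<subseteq> {1..n * (a + b)}"
  unfolding position_image[symmetric] catalan_set_def by auto

lemma card_catalan_set: "card (catalan_set a b n) = n * b"
proof -
  have "inj_on (position (a + b)) ({..<n} \<times> {a..<a + b})"
    by (rule inj_on_subset[OF inj_on_position[of _ n]]) auto
  then show ?thesis by (simp add: catalan_set_def card_image card_cartesian_product)
qed

lemma card_position_image_le:
  assumes "X \<subseteq> {..<n} \<times> {..<c}"
  shows "card (position c ` X \<inter> {..k * c}) = card {p \<in> X. fst p < k}"
proof -
  have "position c ` X \<inter> {..k * c} = position c ` {p \<in> X. fst p < k}"
    using assms position_le_iff[of _ c k] by auto
  moreover have "inj_on (position c) {p \<in> X. fst p < k}"
    using assms by (intro inj_on_subset[OF inj_on_position[of c n]]) auto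
  ultimately show ?thesis by (simp add: card_image)
qed

text \<open>Only block ends need testing. On the \<open>a\<close> zeros of a block the count of the
  Catalan set stands still, so the inequality is inherited from the previous end; on the
  \<open>b\<close> ones it grows at the fastest possible rate, so it is inherited backwards from the
  next end.\<close>

lemma basis_catalan_iff:
  assumes X: "X \<subseteq> {..<n} \<times> {..<a + b}" and "0 < a + b"
  shows "position (a + b) ` X \<in> bases (catalan_matroid a b n) \<longleftrightarrow>
    card X = n * b \<and> (\<forall>k\<le>n. k * b \<le> card {p \<in> X. fst p < k})"
proof -
  let ?c = "a + b" and ?S = "catalan_set a b n"
  let ?T = "position (a + b) ` X"
  have card: "card ?T = card X" using inj_on_subset[OF inj_on_position X] by (rule card_image)
  have T: "?T \<subseteq> {1..n * ?c}" using X unfolding position_image[symmetric] by auto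
  have S: "card (?S \<inter> {..k * ?c}) = k * b" if "k \<le> n" for k
  proof -
    have "card (?S \<inter> {..k * ?c}) = card {p \<in> {..<n} \<times> {a..<?c}. fst p < k}"
      unfolding catalan_set_def by (rule card_position_image_le[of _ n]) auto
    also have "{p \<in> {..<n} \<times> {a..<?c}. fst p < k} = {..<k} \<times> {a..<?c}" using that by auto
    finally show ?thesis by (simp add: card_cartesian_product)
  qed
  have "(\<forall>j. card (?S \<inter> {..j}) \<le> card (?T \<inter> {..j})) \<longleftrightarrow> (\<forall>k\<le>n. k * b \<le> card (?T \<inter> {..k * ?c}))"
    if "card X = n * b"
  proof (intro iffI allI impI)
    fix k assume "\<forall>j. card (?S \<inter> {..j}) \<le> card (?T \<inter> {..j})" "k \<le> n"
    then show "k * b \<le> card (?T \<inter> {..k * ?c})" using S[of k] by metis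
  next
    fix j assume ends: "\<forall>k\<le>n. k * b \<le> card (?T \<inter> {..k * ?c})"
    have fin: "finite ?T" "finite ?S" 
      using finite_subset[OF T] finite_subset[OF catalan_set_subset] by simp_all
    show "card (?S \<inter> {..j}) \<le> card (?T \<inter> {..j})"
    proof (cases "j < n * ?c")
      case False
      then have "{1..n * ?c} \<subseteq> {..j}" by auto
      then have "?T \<inter> {..j} = ?T" "?S \<inter> {..j} = ?S"
        using order.trans[OF T] order.trans[OF catalan_set_subset] by (simp_all only: Int_absorb2)
      then show ?thesis using that card by (simp add: card_catalan_set)
    next
      case True
      define q s where "q = j div ?c" and "s = j mod ?c"
      have j: "j = q * ?c + s" "s < ?c"
        unfolding q_def s_def using assms(2) by (simp_all only: div_mult_mod_eq mod_less_divisor)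
      have q: "q < n" using True unfolding q_def by (simp add: less_mult_imp_div_less)
      show ?thesis
      proof (cases "s \<le> a")
        case True
        have "?S \<inter> {..j} \<subseteq> ?S \<inter> {..q * ?c}"
        proof
          fix i assume i: "i \<in> ?S \<inter> {..j}"
          then obtain p where p: "p \<in> {..<n} \<times> {a..<?c}" "i = position ?c p" by (auto simp: catalan_set_def)
          have "fst p < q"
          proof (rule ccontr)
            assume "\<not> fst p < q"
            then have "q * ?c \<le> fst p * ?c" by (intro mult_le_mono1) simp
            moreover have "fst p * ?c + snd p + 1 \<le> q * ?c + s" using i p(2) j(1) by (simp add: position_def)
            moreover have "a \<le> snd p" using p(1) by auto
            ultimately show False using True by linarith
          qed
          then show "i \<in> ?S \<inter> {..q * ?c}" using i p by (auto simp: position_le_iff)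
        qed
        then have "card (?S \<inter> {..j}) \<le> card (?S \<inter> {..q * ?c})" using fin by (intro card_mono) auto
        also have "\<dots> \<le> card (?T \<inter> {..q * ?c})" using S[of q] ends q by simp
        also have "\<dots> \<le> card (?T \<inter> {..j})" using fin j by (intro card_mono) auto
        finally show ?thesis .
      next
        case False
        let ?e = "Suc q * ?c"
        have e: "j < ?e" using j by simp
        have sub: "{j<..?e} \<subseteq> ?S"
        proof
          fix i assume i: "i \<in> {j<..?e}"
          have "i = position ?c (q, i - 1 - q * ?c)" using i j by (auto simp: position_def)
          moreover have "(q, i - 1 - q * ?c) \<in> {..<n} \<times> {a..<?c}" using i j q False by auto
          ultimately show "i \<in> ?S" unfolding catalan_set_def by blast
        qed
        have split: "?S \<inter> {..?e} = ?S \<inter> {..j} \<union> {j<..?e}" using sub e by auto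
        have "card (?S \<inter> {..?e}) = card (?S \<inter> {..j}) + (?e - j)"
          unfolding split using fin by (subst card_Un_disjoint) auto
        moreover have "card (?S \<inter> {..?e}) \<le> card (?T \<inter> {..?e})" using S[of "Suc q"] ends q by (metis Suc_leI)
        moreover have "card (?T \<inter> {..?e}) \<le> card (?T \<inter> {..j} \<union> {j<..?e})"
          using fin by (intro card_mono) auto
        moreover have "card (?T \<inter> {..j} \<union> {j<..?e}) \<le> card (?T \<inter> {..j}) + (?e - j)"
          using card_Un_le[of "?T \<inter> {..j}" "{j<..?e}"] by simp
        ultimately show ?thesis by linarith
      qed
    qed
  qed
  then show ?thesis
    using T unfolding catalan_matroid_eq bases_schubert_matroid[OF catalan_set_subset] card_catalan_set
    by (auto simp: card card_position_image_le[OF X])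
qed

text \<open>The rank belonging to \<open>nested_indep\<close>, where capacities are imposed on a
  nested family: each final segment of the list of blocks holds at most \<open>b\<close> elements
  per block. Blocks are labels in any order, so that Catalan matroids with permuted blocks are
  covered.\<close>

fun nested_rk :: "nat \<Rightarrow> 'b list \<Rightarrow> ('b \<times> 'c) set \<Rightarrow> nat" where
  "nested_rk b [] X = 0"
| "nested_rk b (x # xs) X = min (b * Suc (length xs)) (card {p \<in> X. fst p = x} + nested_rk b xs X)"

fun nested_indep :: "nat \<Rightarrow> 'b list \<Rightarrow> ('b \<times> 'c) set \<Rightarrow> bool" where
  "nested_indep b [] I \<longleftrightarrow> True"
| "nested_indep b (x # xs) I \<longleftrightarrow>
    card {p \<in> I. fst p \<in> set (x # xs)} \<le> b * Suc (length xs) \<and> nested_indep b xs I"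

lemma nested_indep_subset:
  assumes "nested_indep b xs I" "{p \<in> J. fst p \<in> set xs} \<subseteq> I" "finite I"
  shows "nested_indep b xs J"
  using assms
proof (induction xs)
  case (Cons x xs)
  have "card {p \<in> J. fst p \<in> set (x # xs)} \<le> card {p \<in> I. fst p \<in> set (x # xs)}"
    using Cons.prems by (intro card_mono) auto
  moreover have "nested_indep b xs J" using Cons by auto
  ultimately show ?case using Cons.prems by simp
qed simp

lemma card_fst_Cons:
  assumes "finite I" "x \<notin> A"
  shows "card {p \<in> I. fst p \<in> insert x A} = card {p \<in> I. fst p = x} + card {p \<in> I. fst p \<in> A}"
proof -
  have "{p \<in> I. fst p \<in> insert x A} = {p \<in> I. fst p = x} \<union> {p \<in> I. fst p \<in> A}" by auto
  then show ?thesis using assms by (simp add: card_Un_disjoint disjoint_iff)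
qed

lemma nested_rk_upper:
  assumes "nested_indep b xs I" "I \<subseteq> X" "finite X" "distinct xs"
  shows "card {p \<in> I. fst p \<in> set xs} \<le> nested_rk b xs X"
  using assms(1,4)
proof (induction xs)
  case (Cons x xs)
  have "finite I" using assms finite_subset by blast
  then have "card {p \<in> I. fst p \<in> set (x # xs)} = card {p \<in> I. fst p = x} + card {p \<in> I. fst p \<in> set xs}"
    using Cons.prems card_fst_Cons[of I x "set xs"] by simp
  moreover have "card {p \<in> I. fst p = x} \<le> card {p \<in> X. fst p = x}"
    using assms by (intro card_mono) auto
  ultimately show ?case using Cons by auto
qed simp

text \<open>Extend within the later blocks, add the whole of block \<open>x\<close>, and thin out to
  the capacity while keeping \<open>I\<close>; passing to a subset cannot violate the inner
  constraints.\<close>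

lemma nested_indep_extend:
  assumes "nested_indep b xs I" "I \<subseteq> X" "fst ` X \<subseteq> set xs" "finite X" "distinct xs"
  shows "\<exists>J. I \<subseteq> J \<and> J \<subseteq> X \<and> nested_indep b xs J \<and> card J = nested_rk b xs X"
  using assms
proof (induction xs arbitrary: I X)
  case (Cons x xs)
  let ?X = "{p \<in> X. fst p \<in> set xs}" and ?P = "{p \<in> X. fst p = x}"
  have finI: "finite I" using Cons.prems finite_subset by blast
  have "nested_indep b xs {p \<in> I. fst p \<in> set xs}"
    using Cons.prems finI by (auto intro: nested_indep_subset)
  then obtain J where J: "{p \<in> I. fst p \<in> set xs} \<subseteq> J" "J \<subseteq> ?X" "nested_indep b xs J" "card J = nested_rk b xs ?X"
    using Cons.IH[of "{p \<in> I. fst p \<in> set xs}" ?X] Cons.prems by auto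
  have rk: "nested_rk b ys ?X = nested_rk b ys X" if "set ys \<subseteq> set xs" for ys
    using that
  proof (induction ys)
    case (Cons y ys)
    then have "{p \<in> ?X. fst p = y} = {p \<in> X. fst p = y}" by auto
    then show ?case using Cons by simp
  qed simp
  have finJ: "finite J" by (rule finite_subset[of J X]) (use J(2) Cons.prems(4) in auto)
  have "x \<notin> set xs" using Cons.prems by simp
  then have card: "card (?P \<union> J) = card ?P + nested_rk b xs X"
    using J rk[of xs] finJ Cons.prems by (subst card_Un_disjoint) auto
  have "{p \<in> I. fst p \<in> set (x # xs)} = I" using Cons.prems by auto
  then have "card I \<le> b * Suc (length xs)" using Cons.prems(1) by simp
  moreover have sub: "I \<subseteq> ?P \<union> J" using Cons.prems J by auto
  then have "card I \<le> card (?P \<union> J)" using finJ Cons.prems by (intro card_mono) auto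
  ultimately have "card I \<le> nested_rk b (x # xs) X" by (simp add: card)
  moreover have "nested_rk b (x # xs) X \<le> card (?P \<union> J)" by (simp add: card)
  ultimately obtain K where K: "I \<subseteq> K" "K \<subseteq> ?P \<union> J" "card K = nested_rk b (x # xs) X"
    using exists_subset_between[of I "nested_rk b (x # xs) X" "?P \<union> J"] sub finJ Cons.prems by auto
  have "K \<subseteq> X" using K J by auto
  moreover have "nested_indep b xs K"
    using K J finJ \<open>x \<notin> set xs\<close> by (intro nested_indep_subset[OF J(3)]) auto
  moreover have "{p \<in> K. fst p \<in> set (x # xs)} = K" using \<open>K \<subseteq> X\<close> Cons.prems by auto
  then have "card {p \<in> K. fst p \<in> set (x # xs)} \<le> b * Suc (length xs)" using K by simp
  ultimately show ?case using K by auto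
qed simp

lemma nested_rk_full:
  assumes "\<And>x. x \<in> set xs \<Longrightarrow> b \<le> card {p \<in> X. fst p = x}"
  shows "nested_rk b xs X = b * length xs"
  using assms
proof (induction xs)
  case (Cons x xs)
  then have "b \<le> card {p \<in> X. fst p = x}" "nested_rk b xs X = b * length xs" by auto
  then show ?case by simp
qed simp

lemma nested_indep_upt:
  assumes "k \<le> n"
  shows "nested_indep b [k..<n] I \<longleftrightarrow> (\<forall>l. k \<le> l \<and> l \<le> n \<longrightarrow> card {p \<in> I. l \<le> fst p \<and> fst p < n} \<le> b * (n - l))"
  using assms
proof (induction rule: inc_induct)
  case base
  have "card {p \<in> I. n \<le> fst p \<and> fst p < n} = 0" unfolding card_eq_0_iff by auto
  then show ?case by (auto dest: le_antisym)
next
  case (step k)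
  have "{p \<in> I. fst p \<in> set (k # [Suc k..<n])} = {p \<in> I. k \<le> fst p \<and> fst p < n}"
    using step.hyps by auto
  moreover have "[k..<n] = k # [Suc k..<n]" "Suc (length [Suc k..<n]) = n - k"
    using step.hyps by (simp_all add: upt_conv_Cons Suc_diff_Suc)
  ultimately have Cons: "nested_indep b [k..<n] I \<longleftrightarrow>
    card {p \<in> I. k \<le> fst p \<and> fst p < n} \<le> b * (n - k) \<and> nested_indep b [Suc k..<n] I"
    by (simp only: nested_indep.simps)
  have "k \<le> l \<and> l \<le> n \<longleftrightarrow> l = k \<or> Suc k \<le> l \<and> l \<le> n" for l
    using step.hyps by auto
  then show ?case by (simp only: Cons step.IH imp_disjL all_conj_distrib simp_thms)
qed

text \<open>A basis has \<open>n * b\<close> elements, so at least \<open>k * b\<close> of them in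
  the first \<open>k\<close> blocks means at most \<open>b * (n - k)\<close> in the others.\<close>

lemma basis_catalan_nested_iff:
  assumes X: "X \<subseteq> {..<n} \<times> {..<a + b}" and "0 < a + b"
  shows "position (a + b) ` X \<in> bases (catalan_matroid a b n) \<longleftrightarrow>
    card X = n * b \<and> nested_indep b [0..<n] X"
proof -
  have fin: "finite X" using X finite_subset by blast
  have "(\<forall>k\<le>n. k * b \<le> card {p \<in> X. fst p < k}) \<longleftrightarrow> nested_indep b [0..<n] X" if card: "card X = n * b"
  proof -
    have "k * b \<le> card {p \<in> X. fst p < k} \<longleftrightarrow> card {p \<in> X. k \<le> fst p \<and> fst p < n} \<le> b * (n - k)"
      if "k \<le> n" for k
    proof -
      have "X = {p \<in> X. fst p < k} \<union> {p \<in> X. k \<le> fst p \<and> fst p < n}" using X by auto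
      then have "card X = card {p \<in> X. fst p < k} + card {p \<in> X. k \<le> fst p \<and> fst p < n}"
        using fin by (subst \<open>X = _\<close>, subst card_Un_disjoint) auto
      moreover have "b * (n - k) + k * b = n * b" 
        using that by (simp only: mult.commute[of _ b] add_mult_distrib2[symmetric] le_add_diff_inverse2)
      ultimately show ?thesis using card by linarith
    qed
    then show ?thesis by (simp add: nested_indep_upt)
  qed
  then show ?thesis unfolding basis_catalan_iff[OF assms] by auto
qed

lemma indep_catalan_iff:
  assumes I: "I \<subseteq> {..<n} \<times> {..<a + b}" and "0 < a + b"
  shows "indep (catalan_matroid a b n) (position (a + b) ` I) \<longleftrightarrow> nested_indep b [0..<n] I"
proof
  let ?E = "{..<n} \<times> {..<a + b}"
  assume "indep (catalan_matroid a b n) (position (a + b) ` I)"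
  then obtain B where B: "B \<in> bases (catalan_matroid a b n)" "position (a + b) ` I \<subseteq> B"
    by (auto simp: indep_def)
  have "B \<subseteq> {1..n * (a + b)}"
    using B unfolding catalan_matroid_eq bases_schubert_matroid[OF catalan_set_subset] by auto
  then obtain J where J: "J \<subseteq> ?E" "B = position (a + b) ` J"
    unfolding position_image[symmetric] by (auto simp: subset_image_iff)
  have "I \<subseteq> J"
  proof
    fix p assume p: "p \<in> I"
    then obtain q where "q \<in> J" "position (a + b) p = position (a + b) q" using B(2) J(2) by auto
    then show "p \<in> J" using p I J(1) inj_onD[OF inj_on_position, of "a + b" p q n] by auto
  qed
  moreover have "nested_indep b [0..<n] J" using B J basis_catalan_nested_iff[OF J(1)] assms by auto
  moreover have "finite J" using J finite_subset by blast
  ultimately show "nested_indep b [0..<n] I" by (auto intro: nested_indep_subset)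
next
  let ?E = "{..<n} \<times> {..<a + b}"
  assume indep: "nested_indep b [0..<n] I"
  have fst: "fst ` ?E \<subseteq> set [0..<n]" by auto
  obtain J where J: "I \<subseteq> J" "J \<subseteq> ?E" "nested_indep b [0..<n] J" "card J = nested_rk b [0..<n] ?E"
    using nested_indep_extend[OF indep I fst] by auto
  have "{p \<in> ?E. fst p = x} = {x} \<times> {..<a + b}" if "x < n" for x using that by auto
  then have "nested_rk b [0..<n] ?E = b * n"
    by (subst nested_rk_full) (auto simp: card_cartesian_product)
  then have "position (a + b) ` J \<in> bases (catalan_matroid a b n)"
    using J assms(2) by (simp add: basis_catalan_nested_iff mult.commute)
  then show "indep (catalan_matroid a b n) (position (a + b) ` I)" using J by (auto simp: indep_def)
qed

lemma rk_catalan: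
  assumes X: "X \<subseteq> {..<n} \<times> {..<a + b}" and "0 < a + b"
  shows "rk (catalan_matroid a b n) (position (a + b) ` X) = nested_rk b [0..<n] X"
  unfolding rk_def
proof (rule Max_eqI)
  have finX: "finite X" using X finite_subset by blast
  then show "finite (card ` {I. I \<subseteq> position (a + b) ` X \<and> indep (catalan_matroid a b n) I})"
    by (intro finite_imageI, elim rev_finite_subset[OF finite_Pow_iff[THEN iffD2], OF finite_imageI]) auto
  have card: "card (position (a + b) ` I) = card I" if "I \<subseteq> X" for I
    using that X by (intro card_image inj_on_subset[OF inj_on_position[of _ n]]) auto
  show "m \<le> nested_rk b [0..<n] X"
    if m: "m \<in> card ` {I. I \<subseteq> position (a + b) ` X \<and> indep (catalan_matroid a b n) I}" for m
  proof -
    obtain I where I: "I \<subseteq> X" "indep (catalan_matroid a b n) (position (a + b) ` I)" "m = card I"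
      using m card by (auto simp: subset_image_iff)
    have "I \<subseteq> {..<n} \<times> {..<a + b}" using I X by blast
    then have "nested_indep b [0..<n] I" using indep_catalan_iff[of I n a b] I assms by blast
    moreover have "{p \<in> I. fst p \<in> set [0..<n]} = I" using I X by auto
    ultimately show ?thesis using nested_rk_upper[of b "[0..<n]" I X] I finX by simp
  qed
  have "nested_indep b [0..<n] ({} :: (nat \<times> nat) set)" by (simp add: nested_indep_upt)
  then obtain J where J: "J \<subseteq> X" "nested_indep b [0..<n] J" "card J = nested_rk b [0..<n] X"
  proof -
    have "fst ` X \<subseteq> set [0..<n]" using X by auto
    then show thesis
      using nested_indep_extend[OF \<open>nested_indep b [0..<n] {}\<close> empty_subsetI, of X] finX that by auto
  qed
  then have "indep (catalan_matroid a b n) (position (a + b) ` J)"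
    using indep_catalan_iff[of J n a b] X assms(2) by blast
  then show "nested_rk b [0..<n] X \<in> card ` {I. I \<subseteq> position (a + b) ` X \<and> indep (catalan_matroid a b n) I}"
    using J card[OF J(1)] by (intro image_eqI[of _ _ "position (a + b) ` J"]) auto
qed

lemma loopless_catalan:
  assumes "0 < b"
  shows "loopless (catalan_matroid a b n)"
  unfolding loopless_def
proof
  fix e assume "e \<in> ground (catalan_matroid a b n)"
  then have "e \<in> {1..n * (a + b)}" by (simp add: catalan_matroid_def schubert_matroid_def)
  then obtain p where p: "p \<in> {..<n} \<times> {..<a + b}" "e = position (a + b) p"
    unfolding position_image[symmetric] by auto
  have "card {q \<in> {p}. l \<le> fst q \<and> fst q < n} \<le> b * (n - l)" for l
  proof (cases "l \<le> fst p \<and> fst p < n")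
    case True
    then have "{q \<in> {p}. l \<le> fst q \<and> fst q < n} = {p}" by auto
    moreover have "1 \<le> b * (n - l)" using True assms by (simp add: Suc_le_eq)
    ultimately show ?thesis by simp
  next
    case False
    then have "{q \<in> {p}. l \<le> fst q \<and> fst q < n} = {}" by auto
    then show ?thesis by (simp only: card.empty zero_le)
  qed
  then have "nested_indep b [0..<n] {p}" by (simp add: nested_indep_upt)
  then show "indep (catalan_matroid a b n) {e}" using indep_catalan_iff[of "{p}" n a b] p assms by simp
qed

theorem KL_poly_catalan:
  assumes "0 < b"
  shows "KL_poly (catalan_matroid a b n) = kl ({..<n} \<times> {..<a + b}) (nested_rk b [0..<n])"
proof -
  let ?M = "catalan_matroid a b n" and ?E = "{..<n} \<times> {..<a + b}"
  have "is_matroid ?M" unfolding catalan_matroid_eq by (rule is_matroid_schubert[OF catalan_set_subset])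
  then have "KL_poly ?M = kl (ground ?M) (rk ?M)"
    using loopless_catalan assms by (intro KL_poly_eq_kl)
  also have "ground ?M = position (a + b) ` ?E"
    by (simp add: position_image catalan_matroid_def schubert_matroid_def)
  also have "kl (position (a + b) ` ?E) (rk ?M) = kl ?E (\<lambda>X. rk ?M (position (a + b) ` X))"
    by (rule kl_image[OF inj_on_position])
  also have "\<dots> = kl ?E (nested_rk b [0..<n])"
    using assms by (intro kl_cong rk_catalan) auto
  finally show ?thesis .
qed

section \<open>Uniform matroids\<close>

lemma is_matroid_uniform:
  assumes "r \<le> N"
  shows "is_matroid (uniform_matroid r N)"
proof -
  have "{T. T \<subseteq> {1..N} \<and> card T = r} \<noteq> {}"
    using assms obtain_subset_with_card_n[of r "{1..N}"] by auto
  moreover have "\<exists>y\<in>B - A. insert y (A - {x}) \<subseteq> {1..N} \<and> card (insert y (A - {x})) = r"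
    if AB: "A \<subseteq> {1..N}" "card A = r" "B \<subseteq> {1..N}" "card B = r" "x \<in> A - B" for A B x
  proof -
    have fin: "finite A" "finite B" using AB finite_subset by blast+
    have "\<not> B \<subseteq> A"
      using AB fin card_subset_eq[of A B] by auto
    then obtain y where "y \<in> B - A" by blast
    then show ?thesis using AB fin card.remove[of A x] by (intro bexI[of _ y]) auto
  qed
  ultimately show ?thesis by (auto simp: is_matroid_def uniform_matroid_def)
qed

lemma indep_uniform:
  assumes "r \<le> N"
  shows "indep (uniform_matroid r N) I \<longleftrightarrow> I \<subseteq> {1..N} \<and> card I \<le> r"
proof
  assume "indep (uniform_matroid r N) I"
  then obtain T where T: "T \<subseteq> {1..N}" "card T = r" "I \<subseteq> T" by (auto simp: indep_def uniform_matroid_def)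
  moreover have "finite T" using T finite_subset by blast
  ultimately show "I \<subseteq> {1..N} \<and> card I \<le> r" using card_mono by blast
next
  assume "I \<subseteq> {1..N} \<and> card I \<le> r"
  then obtain T where "I \<subseteq> T" "T \<subseteq> {1..N}" "card T = r"
    using exists_subset_between[of I r "{1..N}"] assms by auto
  then show "indep (uniform_matroid r N) I" by (auto simp: indep_def uniform_matroid_def)
qed

lemma rk_uniform:
  assumes "r \<le> N" "X \<subseteq> {1..N}"
  shows "rk (uniform_matroid r N) X = min r (card X)"
  unfolding rk_def
proof (rule Max_eqI)
  have fin: "finite X" using assms finite_subset by blast
  then show "finite (card ` {I. I \<subseteq> X \<and> indep (uniform_matroid r N) I})"
    by (intro finite_imageI, elim rev_finite_subset[OF finite_Pow_iff[THEN iffD2]]) auto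
  show "m \<le> min r (card X)" if "m \<in> card ` {I. I \<subseteq> X \<and> indep (uniform_matroid r N) I}" for m
    using that fin assms by (auto simp: indep_uniform intro: card_mono)
  obtain I where "I \<subseteq> X" "card I = min r (card X)"
    using obtain_subset_with_card_n[of "min r (card X)" X] by auto
  then show "min r (card X) \<in> card ` {I. I \<subseteq> X \<and> indep (uniform_matroid r N) I}"
    using assms by (intro image_eqI[of _ _ I]) (auto simp: indep_uniform)
qed

text \<open>\<open>E\<close> is any set of the right size because the uniform summands will live on
  \<open>D \<times> {..<a + b}\<close> for varying sets \<open>D\<close> of blocks.\<close>

theorem KL_poly_U:
  assumes "0 < b" "0 < m" and E: "finite E" "card E = m * (a + b)"
  shows "KL_poly (U_matroid a b m) = kl E (\<lambda>X. min (b * m) (card X))"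
proof -
  let ?N = "m * (a + b)" and ?r = "m * b"
  let ?M = "uniform_matroid ?r ?N"
  have le: "?r \<le> ?N" by simp
  have ground: "ground ?M = {1..?N}" by (simp add: uniform_matroid_def)
  obtain f where f: "bij_betw f E {1..?N}"
    using E finite_same_card_bij[of E "{1..?N}"] by auto
  have "loopless ?M"
    using assms unfolding loopless_def ground indep_uniform[OF le] by (simp add: Suc_le_eq)
  then have "KL_poly ?M = kl {1..?N} (rk ?M)"
    using KL_poly_eq_kl[OF is_matroid_uniform[OF le]] by (simp add: ground)
  also have "\<dots> = kl {1..?N} (\<lambda>X. min (b * m) (card X))"
    unfolding mult.commute[of b m] by (rule kl_cong) (rule rk_uniform[OF le])
  also have "{1..?N} = f ` E" using f by (simp add: bij_betw_def)
  also have "kl (f ` E) (\<lambda>X. min (b * m) (card X)) = kl E (\<lambda>X. min (b * m) (card (f ` X)))"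
    using f by (intro kl_image) (simp add: bij_betw_def)
  also have "\<dots> = kl E (\<lambda>X. min (b * m) (card X))"
  proof (rule kl_cong)
    fix X assume "X \<subseteq> E"
    then have "card (f ` X) = card X" using f by (meson bij_betw_def card_image inj_on_subset)
    then show "min (b * m) (card (f ` X)) = min (b * m) (card X)" by simp
  qed
  finally show ?thesis by (simp add: U_matroid_def)
qed

section \<open>From counts of orders to functions along a chain\<close>

context
  fixes \<beta> :: "nat \<Rightarrow> 'b" and b N :: nat
begin

text \<open>Exactly one set \<open>T\<close>, that of the positions where \<open>s\<close> rises, is
  compatible with \<open>s\<close>. In this expansion the argument of \<Phi> depends on
  \<open>T\<close> alone, so different sequences can be compared by counting. The \<open>min\<close>
  freezes the index at \<open>N\<close>, as \<open>take\<close> does for a word of length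
  \<open>N\<close>.\<close>

lemma sum_over_jumps:
  fixes \<Phi> :: "(nat \<Rightarrow> nat) \<Rightarrow> int poly"
  assumes cover: "\<And>i. i < N \<Longrightarrow> \<beta> i \<in> A" and "s 0 = 0"
    and step: "\<And>j. j < N \<Longrightarrow> s (Suc j) = s j \<or> s (Suc j) = s j + 1"
  shows "(\<Sum>T\<in>Pow {..<N}. if \<forall>j\<le>N. s j = hits \<beta> T A j
      then \<Phi> (\<lambda>j. nat (hits \<beta> T A (min j N))) else 0) = \<Phi> (\<lambda>j. nat (s (min j N)))"
proof -
  define T where "T = {j. j < N \<and> s (Suc j) \<noteq> s j}"
  have T: "\<forall>j\<le>N. s j = hits \<beta> T A j"
  proof (intro allI impI)
    fix j assume "j \<le> N"
    then show "s j = hits \<beta> T A j"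
    proof (induction j)
      case (Suc j)
      then show ?case using step[of j] cover[of j] by (auto simp: hits_Suc T_def)
    qed (simp add: assms)
  qed
  have unique: "T' = T" if T': "T' \<subseteq> {..<N}" "\<forall>j\<le>N. s j = hits \<beta> T' A j" for T'
  proof (rule set_eqI)
    fix i
    show "i \<in> T' \<longleftrightarrow> i \<in> T"
    proof (cases "i < N")
      case True
      then have "hits \<beta> T' A (Suc i) = s (Suc i)" "hits \<beta> T' A i = s i" using T' by auto
      then show ?thesis using cover[OF True] True by (auto simp: hits_Suc T_def split: if_splits)
    qed (use T' in \<open>auto simp: T_def\<close>)
  qed
  have "(\<Sum>T'\<in>Pow {..<N}. if \<forall>j\<le>N. s j = hits \<beta> T' A j
      then \<Phi> (\<lambda>j. nat (hits \<beta> T' A (min j N))) else 0) =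
    (\<Sum>T'\<in>Pow {..<N}. if T' = T then \<Phi> (\<lambda>j. nat (hits \<beta> T A (min j N))) else 0)"
    using T unique by (intro sum.cong) auto
  also have "\<dots> = \<Phi> (\<lambda>j. nat (hits \<beta> T A (min j N)))"
    by (simp add: sum.delta) (auto simp: T_def)
  also have "(\<lambda>j. nat (hits \<beta> T A (min j N))) = (\<lambda>j. nat (s (min j N)))"
    using T by (simp add: fun_eq_iff)
  finally show ?thesis .
qed

text \<open>Expand both sides over jump sets. For fixed \<open>T\<close> the value of \<Phi> is
  common, and its coefficients are the numbers compared in \<open>num_greedy_marked\<close>.\<close>

theorem chain_identity:
  fixes \<Phi> :: "(nat \<Rightarrow> nat) \<Rightarrow> int poly"
  assumes A: "finite A" and "0 < b" and cover: "\<And>i. i < N \<Longrightarrow> \<beta> i \<in> A"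
    and full: "\<And>x. x \<in> A \<Longrightarrow> wt \<beta> b N x \<le> 0"
  shows "of_nat (card A) * (\<Sum>xs\<in>permutations_of_set A. \<Phi> (\<lambda>j. nat (nested_rank \<beta> b xs (min j N)))) =
    (\<Sum>D\<in>Pow A - {{}}. \<Sum>zs\<in>permutations_of_set (A - D).
      of_nat (fact (card D)) * \<Phi> (\<lambda>j. nat (unif_rank \<beta> b D (min j N) + nested_rank \<beta> b zs (min j N))))"
proof -
  let ?F = "\<lambda>T. \<Phi> (\<lambda>j. nat (hits \<beta> T A (min j N)))"
  let ?n = "num_greedy \<beta> b N" and ?g = "nested_greedy \<beta> b N" and ?u = "unif_greedy \<beta> b N"
  have if_sum: "(\<Sum>xs\<in>permutations_of_set B. if ?g T xs then p else 0) = of_nat (?n T B) * p" for T B and p :: "int poly"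
    by (simp add: num_greedy_def sum.If_cases Int_def)
  have nested: "\<Phi> (\<lambda>j. nat (nested_rank \<beta> b xs (min j N))) = (\<Sum>T\<in>Pow {..<N}. if ?g T xs then ?F T else 0)"
    if "xs \<in> permutations_of_set A" for xs
  proof -
    have xs: "set xs = A" "distinct xs" using that by (auto simp: permutations_of_set_def)
    have "nested_rank \<beta> b xs (Suc j) = nested_rank \<beta> b xs j \<or>
        nested_rank \<beta> b xs (Suc j) = nested_rank \<beta> b xs j + 1" for j
      using nested_rank_Suc[OF xs(2)] by blast
    then show ?thesis
      using sum_over_jumps[of A "nested_rank \<beta> b xs" \<Phi>] cover xs(1)
      by (simp add: nested_greedy_def)
  qed
  have direct: "\<Phi> (\<lambda>j. nat (unif_rank \<beta> b D (min j N) + nested_rank \<beta> b zs (min j N))) =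
      (\<Sum>T\<in>Pow {..<N}. if ?u T D \<and> ?g T zs then ?F T else 0)"
    if D: "D \<in> Pow A - {{}}" and zs: "zs \<in> permutations_of_set (A - D)" for D zs
  proof -
    have zs': "set zs = A - D" "distinct zs" using zs by (auto simp: permutations_of_set_def)
    have fin: "finite D" using D A finite_subset by auto
    have un: "D \<union> set zs = A" "D \<inter> set zs = {}" using D zs' by auto
    have "unif_rank \<beta> b D (Suc j) + nested_rank \<beta> b zs (Suc j) = unif_rank \<beta> b D j + nested_rank \<beta> b zs j \<or> unif_rank \<beta> b D (Suc j) + nested_rank \<beta> b zs (Suc j) = unif_rank \<beta> b D j + nested_rank \<beta> b zs j + 1" for j
      using nested_rank_Suc[OF zs'(2), of \<beta> b j] unif_rank_Suc[OF fin, of \<beta> b j] un(2) by auto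
    then have "\<Phi> (\<lambda>j. nat (unif_rank \<beta> b D (min j N) + nested_rank \<beta> b zs (min j N))) =
      (\<Sum>T\<in>Pow {..<N}. if \<forall>j\<le>N. unif_rank \<beta> b D j + nested_rank \<beta> b zs j = hits \<beta> T A j then ?F T else 0)"
      using sum_over_jumps[of A "\<lambda>j. unif_rank \<beta> b D j + nested_rank \<beta> b zs j" \<Phi>] cover by simp
    then show ?thesis using direct_sum_greedy_iff[OF fin zs'(2) un(2), of N \<beta> b] un(1) by simp
  qed
  have "of_nat (card A) * (\<Sum>xs\<in>permutations_of_set A. \<Phi> (\<lambda>j. nat (nested_rank \<beta> b xs (min j N)))) =
      of_nat (card A) * (\<Sum>xs\<in>permutations_of_set A. \<Sum>T\<in>Pow {..<N}. if ?g T xs then ?F T else 0)"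
    using nested by simp
  also have "\<dots> = of_nat (card A) * (\<Sum>T\<in>Pow {..<N}. \<Sum>xs\<in>permutations_of_set A. if ?g T xs then ?F T else 0)"
    by (subst sum.swap) simp
  also have "\<dots> = (\<Sum>T\<in>Pow {..<N}. of_nat (card A * ?n T A) * ?F T)"
    by (simp add: if_sum sum_distrib_left mult.assoc)
  also have "\<dots> = (\<Sum>T\<in>Pow {..<N}. \<Sum>D\<in>Pow A - {{}}. of_nat (fact (card D)) * (if ?u T D then of_nat (?n T (A - D)) * ?F T else 0))"
  proof (rule sum.cong[OF refl])
    fix T
    have filter: "{D. D \<subseteq> A \<and> D \<noteq> {} \<and> ?u T D} = {D \<in> Pow A - {{}}. ?u T D}" by auto
    have "card A * ?n T A = (\<Sum>D\<in>Pow A - {{}}. if ?u T D then fact (card D) * ?n T (A - D) else 0)"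
      using num_greedy_marked[OF A full \<open>0 < b\<close>, where T = T] A unfolding filter
      by (simp only: sum.inter_filter finite_Diff finite_Pow_iff)
    then show "of_nat (card A * ?n T A) * ?F T = (\<Sum>D\<in>Pow A - {{}}. of_nat (fact (card D)) * (if ?u T D then of_nat (?n T (A - D)) * ?F T else 0))"
      by (simp add: sum_distrib_right if_distrib[of of_nat] if_distrib[of "\<lambda>x. x * _"] if_distrib[of "\<lambda>x. _ * x"] mult.assoc cong: if_cong)
  qed
  also have "\<dots> = (\<Sum>T\<in>Pow {..<N}. \<Sum>D\<in>Pow A - {{}}. \<Sum>zs\<in>permutations_of_set (A - D).
      of_nat (fact (card D)) * (if ?u T D \<and> ?g T zs then ?F T else 0))"
  proof (intro sum.cong refl)
    fix T D
    show "of_nat (fact (card D)) * (if ?u T D then of_nat (?n T (A - D)) * ?F T else 0) =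
      (\<Sum>zs\<in>permutations_of_set (A - D). of_nat (fact (card D)) * (if ?u T D \<and> ?g T zs then ?F T else 0))"
      unfolding sum_distrib_left[symmetric] if_sum[symmetric] by simp
  qed
  also have "\<dots> = (\<Sum>D\<in>Pow A - {{}}. \<Sum>zs\<in>permutations_of_set (A - D). \<Sum>T\<in>Pow {..<N}.
      of_nat (fact (card D)) * (if ?u T D \<and> ?g T zs then ?F T else 0))"
    by (subst sum.swap, intro sum.cong refl, rule sum.swap)
  also have "\<dots> = (\<Sum>D\<in>Pow A - {{}}. \<Sum>zs\<in>permutations_of_set (A - D).
      of_nat (fact (card D)) * \<Phi> (\<lambda>j. nat (unif_rank \<beta> b D (min j N) + nested_rank \<beta> b zs (min j N))))"
    by (intro sum.cong refl) (simp add: direct sum_distrib_left)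
  finally show ?thesis .
qed

end

section \<open>The recursion for the Catalan matroids\<close>

text \<open>Subtracting \<open>min u v\<close> from \<open>u\<close> gives
  \<open>max 0 (u - v)\<close>, so the deficit of the rank from \<open>b * length xs\<close> obeys
  the recursion of \<open>max_prefix\<close>.\<close>

lemma nested_rk_eq:
  "int (nested_rk b xs X) =
    int (b * length xs) - max_prefix (\<lambda>x. int b - int (card {p \<in> X. fst p = x})) xs"
proof (induction xs)
  case (Cons x xs)
  have "int (b * length (x # xs)) = int b + int (b * length xs)"
    "int (b * Suc (length xs)) = int b + int (b * length xs)" by (simp_all add: algebra_simps)
  then show ?case
    using Cons unfolding nested_rk.simps max_prefix.simps of_nat_min of_nat_add by linarith
qed simp

lemma nested_rk_empty [simp]: "nested_rk b xs {} = 0"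
  by (induction xs) auto

lemma nested_rk_mono:
  assumes "X \<subseteq> Y" "finite Y"
  shows "nested_rk b xs X \<le> nested_rk b xs Y"
proof (induction xs)
  case (Cons x xs)
  have "card {p \<in> X. fst p = x} \<le> card {p \<in> Y. fst p = x}" using assms by (intro card_mono) auto
  then show ?case using Cons by auto
qed simp

lemma nested_rk_cong:
  assumes "\<And>x. x \<in> set xs \<Longrightarrow> {p \<in> X. fst p = x} = {p \<in> Y. fst p = x}"
  shows "nested_rk b xs X = nested_rk b xs Y"
  using assms by (induction xs) simp_all

lemma nested_rk_map:
  assumes "\<And>x. x \<in> set xs \<Longrightarrow> card {p \<in> Y. fst p = g x} = card {p \<in> X. fst p = x}"
  shows "nested_rk b (map g xs) Y = nested_rk b xs X"
  using assms by (induction xs) simp_all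

lemma card_take_filter:
  assumes "distinct w"
  shows "card {p \<in> set (take j w). P p} = card {i. i < min j (length w) \<and> P (w ! i)}"
proof -
  have "inj_on ((!) w) {i. i < min j (length w) \<and> P (w ! i)}"
    using assms by (intro inj_on_nth) auto
  moreover have "set (take j w) = (!) w ` {0..<min j (length w)}"
    by (simp add: nth_image min_def)
  then have "(!) w ` {i. i < min j (length w) \<and> P (w ! i)} = {p \<in> set (take j w). P p}"
    by auto
  ultimately show ?thesis by (metis card_image)
qed

lemma nested_rank_chain:
  assumes "distinct w"
  shows "nested_rank (\<lambda>i. fst (w ! i)) b xs (min j (length w)) = int (nested_rk b xs (set (take j w)))"
  unfolding nested_rank_def nested_rk_eq wt_def[abs_def] card_take_filter[OF assms] ..

lemma sum_wt: "finite D \<Longrightarrow> sum (wt \<beta> b j) D = int (b * card D) - hits \<beta> UNIV D j"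
  by (induction j) (auto simp: sum_wt_Suc hits_Suc)

lemma unif_rank_chain:
  assumes "distinct w" "finite D"
  shows "unif_rank (\<lambda>i. fst (w ! i)) b D (min j (length w)) =
    int (min (b * card D) (card {p \<in> set (take j w). fst p \<in> D}))"
  unfolding unif_rank_def sum_wt[OF assms(2)] hits_def card_take_filter[OF assms(1)]
  by (simp only: UNIV_I simp_thms of_nat_min)

text \<open>All block orders give isomorphic matroids, so a sum over orders is a multiple of one
  polynomial.\<close>

lemma kl_nested_rk:
  fixes c :: nat
  assumes "xs \<in> permutations_of_set A"
  shows "kl (A \<times> {..<c}) (nested_rk b xs) = kl ({..<card A} \<times> {..<c}) (nested_rk b [0..<card A])"
proof -
  let ?m = "card A" and ?C = "{..<c} :: nat set"
  have xs: "set xs = A" "distinct xs" "length xs = ?m"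
    using assms length_finite_permutations_of_set[OF assms] by (auto simp: permutations_of_set_def)
  define f where "f = (\<lambda>(i, s :: nat). (xs ! i, s))"
  have inj: "inj_on f ({..<?m} \<times> ?C)"
    using xs by (auto simp: inj_on_def f_def nth_eq_iff_index_eq)
  have image: "f ` ({..<?m} \<times> ?C) = A \<times> ?C"
  proof -
    have "(!) xs ` {..<?m} = A" using nth_image[of ?m xs] xs by (simp add: lessThan_atLeast0)
    moreover have "f ` ({..<?m} \<times> ?C) = (!) xs ` {..<?m} \<times> ?C" by (force simp: f_def)
    ultimately show ?thesis by simp
  qed
  have "nested_rk b xs (f ` X) = nested_rk b [0..<?m] X" if X: "X \<subseteq> {..<?m} \<times> ?C" for X
  proof -
    have "card {p \<in> f ` X. fst p = xs ! i} = card {p \<in> X. fst p = i}" if i: "i \<in> set [0..<?m]" for i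
    proof -
      have "{p \<in> f ` X. fst p = xs ! i} = f ` {p \<in> X. fst p = i}"
        using i X xs by (force simp: f_def nth_eq_iff_index_eq)
      moreover have "inj_on f {p \<in> X. fst p = i}" using X by (intro inj_on_subset[OF inj]) auto
      ultimately show ?thesis by (simp add: card_image)
    qed
    then have "nested_rk b (map ((!) xs) [0..<?m]) (f ` X) = nested_rk b [0..<?m] X"
      by (rule nested_rk_map)
    then show ?thesis using map_nth[of xs] xs(3) by simp
  qed
  then have "kl ({..<?m} \<times> ?C) (\<lambda>X. nested_rk b xs (f ` X)) = kl ({..<?m} \<times> ?C) (nested_rk b [0..<?m])"
    by (rule kl_cong)
  then show ?thesis using kl_image[OF inj, of "nested_rk b xs"] image by simp
qed

lemma kl_unif_nested:
  fixes A D :: "nat set"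
  assumes "finite A" "D \<subseteq> A" "D \<noteq> {}" "0 < b" and zs: "zs \<in> permutations_of_set (A - D)"
  shows "kl (A \<times> {..<a + b}) (\<lambda>X. min (b * card D) (card {p \<in> X. fst p \<in> D}) + nested_rk b zs X) =
    KL_poly (U_matroid a b (card D)) * KL_poly (catalan_matroid a b (card A - card D))"
proof -
  let ?C = "{..<a + b}"
  let ?u = "\<lambda>X. min (b * card D) (card X)"
  have fin: "finite D" "finite (D \<times> ?C)" "finite ((A - D) \<times> ?C)" using assms finite_subset by auto
  have set: "set zs = A - D" using zs by (auto simp: permutations_of_set_def)
  have E: "A \<times> ?C = D \<times> ?C \<union> (A - D) \<times> ?C" using assms by auto
  have "kl (A \<times> ?C) (\<lambda>X. min (b * card D) (card {p \<in> X. fst p \<in> D}) + nested_rk b zs X) =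
    kl (A \<times> ?C) (\<lambda>X. ?u (X \<inter> D \<times> ?C) + nested_rk b zs (X \<inter> (A - D) \<times> ?C))"
  proof (rule kl_cong)
    fix X assume X: "X \<subseteq> A \<times> ?C"
    then have "{p \<in> X. fst p \<in> D} = X \<inter> D \<times> ?C" by auto
    moreover have "nested_rk b zs X = nested_rk b zs (X \<inter> (A - D) \<times> ?C)"
      using X set by (intro nested_rk_cong) auto
    ultimately show "min (b * card D) (card {p \<in> X. fst p \<in> D}) + nested_rk b zs X =
      ?u (X \<inter> D \<times> ?C) + nested_rk b zs (X \<inter> (A - D) \<times> ?C)" by simp
  qed
  also have "\<dots> = kl (D \<times> ?C) ?u * kl ((A - D) \<times> ?C) (nested_rk b zs)"
    unfolding E
  proof (rule kl_direct_sum)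
    show "rank_fun (D \<times> ?C) ?u"
      unfolding rank_fun_def
    proof (intro conjI allI impI)
      fix X Y assume XY: "X \<subseteq> Y \<and> Y \<subseteq> D \<times> ?C"
      then have "finite Y" using fin(2) finite_subset by blast
      then show "?u X \<le> ?u Y" using XY by (intro min.mono card_mono) auto
    qed (use fin in auto)
    show "rank_fun ((A - D) \<times> ?C) (nested_rk b zs)"
      using fin by (auto simp: rank_fun_def intro!: nested_rk_mono finite_subset[OF _ fin(3)])
  qed auto
  also have "kl (D \<times> ?C) ?u = KL_poly (U_matroid a b (card D))"
    using assms fin by (intro KL_poly_U[symmetric]) (auto simp: card_cartesian_product card_gt_0_iff)
  also have "kl ((A - D) \<times> ?C) (nested_rk b zs) = KL_poly (catalan_matroid a b (card A - card D))"
    using assms fin kl_nested_rk[OF zs] by (simp add: KL_poly_catalan card_Diff_subset)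
  finally show ?thesis .
qed

lemma sum_Pow_card:
  fixes f :: "nat \<Rightarrow> 'b::comm_semiring_1"
  assumes "finite A"
  shows "(\<Sum>D\<in>Pow A - {{}}. f (card D)) = (\<Sum>k\<in>{1..card A}. of_nat (card A choose k) * f k)"
proof -
  have "(\<Sum>D\<in>Pow A - {{}}. f (card D)) = (\<Sum>k\<in>{1..card A}. \<Sum>D | D \<in> Pow A - {{}} \<and> card D = k. f (card D))"
  proof (rule sum.group[symmetric])
    show "card ` (Pow A - {{}}) \<subseteq> {1..card A}"
    proof (rule image_subsetI)
      fix D assume D: "D \<in> Pow A - {{}}"
      then have "finite D" using assms finite_subset by auto
      then have "0 < card D" using D by (auto simp: card_gt_0_iff)
      moreover have "card D \<le> card A" using D assms by (auto intro: card_mono)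
      ultimately show "card D \<in> {1..card A}" by simp
    qed
  qed (use assms in auto)
  also have "\<dots> = (\<Sum>k\<in>{1..card A}. of_nat (card A choose k) * f k)"
  proof (rule sum.cong[OF refl])
    fix k assume k: "k \<in> {1..card A}"
    then have eq: "{D. D \<in> Pow A - {{}} \<and> card D = k} = {D. D \<subseteq> A \<and> card D = k}" by auto
    have "(\<Sum>D | D \<in> Pow A - {{}} \<and> card D = k. f (card D)) = (\<Sum>D | D \<subseteq> A \<and> card D = k. f k)"
      unfolding eq by (rule sum.cong) auto
    then show "(\<Sum>D | D \<in> Pow A - {{}} \<and> card D = k. f (card D)) = of_nat (card A choose k) * f k"
      by (simp add: n_subsets[OF assms])
  qed
  finally show ?thesis .
qed

text \<open>\<open>valuative_eqI\<close> transfers \<open>chain_identity\<close> to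
  \<open>kl\<close>. On the left all \<open>fact n\<close> orders give the same polynomial; on the
  right there are \<open>n choose k\<close> sets of size \<open>k\<close>, each with weight
  \<open>fact k * fact (n - k)\<close>. Both sides thus carry the factor
  \<open>fact n\<close>.\<close>

theorem KL_poly_catalan_recursion:
  assumes "0 < b"
  shows "of_nat n * KL_poly (catalan_matroid a b n) =
    (\<Sum>k\<in>{1..n}. KL_poly (U_matroid a b k) * KL_poly (catalan_matroid a b (n - k)))"
proof -
  let ?A = "{..<n}" and ?C = "{..<a + b}"
  let ?E = "?A \<times> ?C"
  let ?p = "\<lambda>k. KL_poly (U_matroid a b k)" and ?q = "\<lambda>n. KL_poly (catalan_matroid a b n)"
  let ?J = "Sigma (Pow ?A - {{}}) (\<lambda>D. permutations_of_set (?A - D))"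
  let ?s = "\<lambda>(D, zs) X. min (b * card D) (card {p \<in> X. fst p \<in> D}) + nested_rk b zs X"
  let ?d = "\<lambda>(D, zs). of_nat (fact (card D)) :: int poly"
  have "(\<Sum>xs\<in>permutations_of_set ?A. of_nat n * kl ?E (nested_rk b xs)) = (\<Sum>i\<in>?J. ?d i * kl ?E (?s i))"
  proof (rule valuative_eqI[OF valuative_kl])
    fix w :: "(nat \<times> nat) list" and \<phi> :: "(nat \<Rightarrow> nat) \<Rightarrow> int poly"
    assume w: "distinct w" "set w = ?E"
    let ?\<beta> = "\<lambda>i. fst (w ! i)" and ?N = "length w"
    \<comment> \<open>At the end of the chain each block has been used up, so its weight is
      \<open>b - (a + b)\<close>.\<close>
    have full: "wt ?\<beta> b ?N x \<le> 0" if "x \<in> ?A" for x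
    proof -
      have "{p \<in> ?E. fst p = x} = {x} \<times> ?C" using that by auto
      then have "card {i. i < ?N \<and> ?\<beta> i = x} = a + b"
        using card_take_filter[OF w(1), of ?N "\<lambda>p. fst p = x"] w(2) by (simp add: card_cartesian_product)
      then show ?thesis by (simp add: wt_def)
    qed
    have cover: "?\<beta> i \<in> ?A" if "i < ?N" for i
      using nth_mem[OF that] unfolding w(2) by auto
    have "(\<Sum>xs\<in>permutations_of_set ?A. of_nat n * \<phi> (\<lambda>j. nested_rk b xs (set (take j w)))) =
        of_nat (card ?A) * (\<Sum>xs\<in>permutations_of_set ?A. \<phi> (\<lambda>j. nat (nested_rank ?\<beta> b xs (min j ?N))))"
      by (simp add: nested_rank_chain[OF w(1)] sum_distrib_left)
    also have "\<dots> = (\<Sum>D\<in>Pow ?A - {{}}. \<Sum>zs\<in>permutations_of_set (?A - D).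
        of_nat (fact (card D)) * \<phi> (\<lambda>j. nat (unif_rank ?\<beta> b D (min j ?N) + nested_rank ?\<beta> b zs (min j ?N))))"
      using cover full assms by (intro chain_identity) auto
    also have "\<dots> = (\<Sum>D\<in>Pow ?A - {{}}. \<Sum>zs\<in>permutations_of_set (?A - D).
        ?d (D, zs) * \<phi> (\<lambda>j. ?s (D, zs) (set (take j w))))"
    proof (intro sum.cong refl)
      fix D zs assume "D \<in> Pow ?A - {{}}"
      then have "finite D" using finite_subset by auto
      then show "of_nat (fact (card D)) * \<phi> (\<lambda>j. nat (unif_rank ?\<beta> b D (min j ?N) + nested_rank ?\<beta> b zs (min j ?N))) =
          ?d (D, zs) * \<phi> (\<lambda>j. ?s (D, zs) (set (take j w)))"
        by (simp only: nested_rank_chain[OF w(1)] unif_rank_chain[OF w(1)] of_nat_add[symmetric] nat_int case_prod_conv)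
    qed
    also have "\<dots> = (\<Sum>i\<in>?J. ?d i * \<phi> (\<lambda>j. ?s i (set (take j w))))"
      by (subst sum.Sigma) (auto simp: case_prod_unfold)
    finally show "(\<Sum>xs\<in>permutations_of_set ?A. of_nat n * \<phi> (\<lambda>j. nested_rk b xs (set (take j w)))) =
        (\<Sum>i\<in>?J. ?d i * \<phi> (\<lambda>j. ?s i (set (take j w))))" .
  qed simp
  also have "(\<Sum>xs\<in>permutations_of_set ?A. of_nat n * kl ?E (nested_rk b xs)) = of_nat (fact n) * (of_nat n * ?q n)"
    using kl_nested_rk[of _ ?A "a + b" b] by (simp add: KL_poly_catalan[OF assms])
  also have "(\<Sum>i\<in>?J. ?d i * kl ?E (?s i)) =
      (\<Sum>(D, zs)\<in>?J. of_nat (fact (card D)) * (?p (card D) * ?q (n - card D)))"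
  proof (rule sum.cong[OF refl])
    fix i assume "i \<in> ?J"
    then obtain D zs where i: "i = (D, zs)" "D \<subseteq> ?A" "D \<noteq> {}" "zs \<in> permutations_of_set (?A - D)"
      by auto
    then have "kl ?E (?s (D, zs)) = ?p (card D) * ?q (n - card D)"
      using kl_unif_nested[of ?A D b zs a] assms by simp
    then show "?d i * kl ?E (?s i) = (case i of (D, zs) \<Rightarrow> of_nat (fact (card D)) * (?p (card D) * ?q (n - card D)))"
      by (simp add: i)
  qed
  also have "\<dots> = (\<Sum>D\<in>Pow ?A - {{}}. \<Sum>zs\<in>permutations_of_set (?A - D).
      of_nat (fact (card D)) * (?p (card D) * ?q (n - card D)))"
    by (subst sum.Sigma) auto
  also have "\<dots> = (\<Sum>D\<in>Pow ?A - {{}}. of_nat (fact (card D) * fact (n - card D)) * (?p (card D) * ?q (n - card D)))"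
  proof (rule sum.cong[OF refl])
    fix D assume D: "D \<in> Pow ?A - {{}}"
    then have "finite D" using finite_subset[of D ?A] by auto
    then have "card (?A - D) = n - card D" using D by (subst card_Diff_subset) auto
    then show "(\<Sum>zs\<in>permutations_of_set (?A - D). of_nat (fact (card D)) * (?p (card D) * ?q (n - card D))) =
        of_nat (fact (card D) * fact (n - card D)) * (?p (card D) * ?q (n - card D))"
      by simp
  qed
  also have "\<dots> = (\<Sum>k\<in>{1..n}. of_nat (n choose k) * (of_nat (fact k * fact (n - k)) * (?p k * ?q (n - k))))"
    using sum_Pow_card[of ?A "\<lambda>k. of_nat (fact k * fact (n - k)) * (?p k * ?q (n - k))"] by simp
  also have "\<dots> = (\<Sum>k\<in>{1..n}. of_nat (fact n) * (?p k * ?q (n - k)))"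
  proof (rule sum.cong[OF refl])
    fix k assume "k \<in> {1..n}"
    then have "(n choose k) * (fact k * fact (n - k)) = fact n"
      using binomial_fact_lemma[of k n] by (simp add: ac_simps)
    then show "of_nat (n choose k) * (of_nat (fact k * fact (n - k)) * (?p k * ?q (n - k))) =
        of_nat (fact n) * (?p k * ?q (n - k))"
      by (metis mult.assoc of_nat_mult)
  qed
  finally have "of_nat (fact n) * (of_nat n * ?q n) = of_nat (fact n) * (\<Sum>k\<in>{1..n}. ?p k * ?q (n - k))"
    by (simp add: sum_distrib_left)
  moreover have "(of_nat (fact n) :: int poly) \<noteq> 0" by (simp only: of_nat_eq_0_iff fact_nonzero) simp
  ultimately show ?thesis by simp
qed

section \<open>Sums over partitions\<close>

lemma z_part_superset:
  assumes "finite S" "set_mset l \<subseteq> S"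
  shows "z_part l = (\<Prod>i\<in>S. i ^ count l i * fact (count l i))"
  unfolding z_part_def using assms
  by (intro prod.mono_neutral_left) (auto simp: not_in_iff)

lemma z_part_add_mset: "z_part (add_mset k m) = k * count (add_mset k m) k * z_part m"
proof -
  let ?S = "insert k (set_mset m)"
  have "z_part (add_mset k m) = (\<Prod>i\<in>?S. i ^ count (add_mset k m) i * fact (count (add_mset k m) i))"
    by (intro z_part_superset) auto
  also have "\<dots> = k * Suc (count m k) * (k ^ count m k * fact (count m k)) *
      (\<Prod>i\<in>?S - {k}. i ^ count m i * fact (count m i))"
    by (simp add: prod.remove[of ?S k] algebra_simps)
  also have "\<dots> = k * Suc (count m k) * (\<Prod>i\<in>?S. i ^ count m i * fact (count m i))"
    by (simp add: prod.remove[of ?S k])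
  also have "(\<Prod>i\<in>?S. i ^ count m i * fact (count m i)) = z_part m"
    by (intro z_part_superset[symmetric]) auto
  finally show ?thesis by simp
qed

lemma z_part_pos: "(\<forall>i\<in>#l. 0 < i) \<Longrightarrow> 0 < z_part l"
  unfolding z_part_def by (intro prod_pos) auto

lemma sum_mset_count:
  assumes "finite S" "set_mset l \<subseteq> S"
  shows "sum_mset l = (\<Sum>i\<in>S. i * count l i)"
  using assms(2)
proof (induction l)
  case (add x l)
  have "(\<Sum>i\<in>S. i * count (add_mset x l) i) = (\<Sum>i\<in>S. i * count l i + (if i = x then x else 0))"
    by (intro sum.cong) auto
  also have "\<dots> = (\<Sum>i\<in>S. i * count l i) + x" using add.prems assms(1) by (simp add: sum.distrib)
  finally show ?case using add by simp
qed simp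

definition partition_sum :: "(nat \<Rightarrow> 'a::field_char_0 poly) \<Rightarrow> nat \<Rightarrow> 'a poly" where
  "partition_sum P n = (\<Sum>l\<in>partitions n. smult (1 / of_nat (z_part l)) (\<Prod>j\<in>#l. P j))"

lemma partition_sum_0: "partition_sum P 0 = 1"
proof -
  have "partitions 0 = {{#}}" 
    by (auto simp: partitions_def) (metis multiset_nonemptyE less_irrefl)
  then show ?thesis by (simp add: partition_sum_def z_part_def)
qed

text \<open>Removing a part \<open>k\<close> of multiplicity \<open>m\<close> from a partition divides \<open>z_part\<close> by \<open>k * m\<close>,
  and these factors sum to the size of the partition.\<close>

lemma partition_sum_recursion:
  "of_nat n * partition_sum P n = (\<Sum>k\<in>{1..n}. P k * partition_sum P (n - k))"
proof -
  let ?t = "\<lambda>l. smult (1 / of_nat (z_part l)) (\<Prod>j\<in>#l. P j)"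
  have "of_nat n * partition_sum P n = (\<Sum>l\<in>partitions n. of_nat n * ?t l)"
    by (simp add: partition_sum_def sum_distrib_left)
  also have "\<dots> = (\<Sum>l\<in>partitions n. \<Sum>k\<in>set_mset l. P k * ?t (l - {#k#}))"
  proof (rule sum.cong[OF refl])
    fix l assume l: "l \<in> partitions n"
    have "of_nat (k * count l k) * ?t l = P k * ?t (l - {#k#})" if k: "k \<in># l" for k
    proof -
      obtain m where m: "l = add_mset k m" using k by (metis insert_DiffM)
      have pos: "0 < k" "0 < z_part m" using l k m by (auto simp: partitions_def intro: z_part_pos)
      have cancel: "(of_nat x / of_nat (x * z) :: 'a) = 1 / of_nat z" if "x \<noteq> 0" for x z :: nat
        using that by simp
      have "(of_nat (k * count l k) / of_nat (z_part l) :: 'a) = 1 / of_nat (z_part m)"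
        using pos unfolding m z_part_add_mset by (intro cancel) simp
      then have "of_nat (k * count l k) * ?t l = smult (1 / of_nat (z_part m)) (\<Prod>j\<in>#l. P j)"
        by (simp only: of_nat_poly mult_smult_right) simp
      then show ?thesis by (simp add: m)
    qed
    then have "(\<Sum>k\<in>set_mset l. P k * ?t (l - {#k#})) = (\<Sum>k\<in>set_mset l. of_nat (k * count l k)) * ?t l"
      unfolding sum_distrib_right by (intro sum.cong) auto
    also have "(\<Sum>k\<in>set_mset l. of_nat (k * count l k)) = (of_nat n :: 'a poly)"
      unfolding of_nat_sum[symmetric] using l sum_mset_count[of "set_mset l" l] by (simp add: partitions_def)
    finally show "of_nat n * ?t l = (\<Sum>k\<in>set_mset l. P k * ?t (l - {#k#}))" by simp
  qed
  also have "\<dots> = (\<Sum>(l, k)\<in>Sigma (partitions n) set_mset. P k * ?t (l - {#k#}))"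
    by (subst sum.Sigma) (auto simp: finite_partitions)
  also have "\<dots> = (\<Sum>(k, m)\<in>Sigma {1..n} (\<lambda>k. partitions (n - k)). P k * ?t m)"
  \<comment> \<open>Removing a part \<open>k\<close> from a partition of \<open>n\<close> leaves an
    arbitrary partition of \<open>n - k\<close>; the chosen \<open>k\<close> is a value, not an
    occurrence, so this is a bijection.\<close>
  proof (rule sum.reindex_bij_witness[of _ "\<lambda>(k, m). (add_mset k m, k)" "\<lambda>(l, k). (k, l - {#k#})"])
    fix x assume x: "x \<in> Sigma (partitions n) set_mset"
    then obtain l k where lk: "x = (l, k)" "l \<in> partitions n" "k \<in># l" by auto
    then obtain m where m: "l = add_mset k m" by (metis insert_DiffM)
    show "(case x of (l, k) \<Rightarrow> (k, l - {#k#})) \<in> Sigma {1..n} (\<lambda>k. partitions (n - k))"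
      using lk m by (auto simp: partitions_def)
  qed (auto simp: partitions_def)
  also have "\<dots> = (\<Sum>k\<in>{1..n}. P k * partition_sum P (n - k))"
    by (subst sum.Sigma[symmetric]) (auto simp: finite_partitions partition_sum_def sum_distrib_left)
  finally show ?thesis .
qed

text \<open>In characteristic 0 the factor \<open>of_nat n\<close> cancels for positive
  \<open>n\<close>, so the recursion determines each term from the earlier ones.\<close>

lemma partition_sum_unique:
  fixes Q :: "nat \<Rightarrow> 'a::field_char_0 poly"
  assumes "Q 0 = 1" "\<And>n. of_nat n * Q n = (\<Sum>k\<in>{1..n}. P k * Q (n - k))"
  shows "Q n = partition_sum P n"
proof (induction n rule: less_induct)
  case (less n)
  show ?case
  proof (cases "n = 0")
    case False
    have "of_nat n * Q n = of_nat n * partition_sum P n"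
      unfolding assms(2) partition_sum_recursion using less by (intro sum.cong) auto
    then show ?thesis using False by simp
  qed (simp add: assms(1) partition_sum_0)
qed

lemma map_poly_of_int_mult:
  "map_poly rat_of_int (p * q) = map_poly rat_of_int p * map_poly rat_of_int q"
  by (rule poly_eqI) (simp add: coeff_map_poly coeff_mult)

lemma map_poly_of_int_sum:
  "map_poly rat_of_int (\<Sum>x\<in>A. f x) = (\<Sum>x\<in>A. map_poly rat_of_int (f x))"
  by (rule poly_eqI) (simp add: coeff_map_poly coeff_sum)

lemma map_poly_of_int_of_nat: "map_poly rat_of_int (of_nat n) = of_nat n"
  by (simp add: of_nat_poly map_poly_pCons)

theorem corollary4p7:
  fixes a b n :: nat
  assumes "a > 0" and "b > 0" and "n > 0"
  shows "map_poly rat_of_int (KL_poly (catalan_matroid a b n)) =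
    (\<Sum>l\<in>partitions n.
       smult (1 / of_nat (z_part l))
         (\<Prod>j\<in>#l. map_poly rat_of_int (KL_poly (U_matroid a b j))))"
proof -
  let ?Q = "\<lambda>n. map_poly rat_of_int (KL_poly (catalan_matroid a b n))"
  let ?P = "\<lambda>j. map_poly rat_of_int (KL_poly (U_matroid a b j))"
  have "?Q n = partition_sum ?P n"
  proof (rule partition_sum_unique)
    \<comment> \<open>With no blocks the ground set is empty.\<close>
    show "?Q 0 = 1" using assms by (simp add: KL_poly_catalan)
    show "of_nat n * ?Q n = (\<Sum>k\<in>{1..n}. ?P k * ?Q (n - k))" for n
      unfolding map_poly_of_int_mult[symmetric] map_poly_of_int_sum[symmetric]
        map_poly_of_int_of_nat[symmetric] KL_poly_catalan_recursion[OF assms(2)] ..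
  qed
  then show ?thesis by (simp add: partition_sum_def)
qed

end
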